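(* For $j\ge1$ let $p_j$ be the $j$-th prime number, let $\boldsymbol{\gamma}=(\gamma_j)_{j\ge1}$ be positive real weights, and for $s\in\mathbb{N}$ put $\boldsymbol{p}=(p_1,\ldots,p_s)$. Let $\widehat{e}_{N,s}(\mathcal{H}_{\boldsymbol{p}},K_{s,\boldsymbol{\gamma}})$ be the root mean square worst-case error, in the weighted anchored Sobolev space $\mathscr{H}(K_{s,\boldsymbol{\gamma}})$, of the QMC rule based on the first $N$ points of the randomly $\boldsymbol{p}$-adically shifted Halton sequence. If $$\sum_{j\ge1}\gamma_j\, j^2\log j<\infty,$$ then for every $\delta>0$ there is a constant $C>0$, depending only on $\delta$ and on the sequences $(\gamma_j)_{j\ge 1}$ and $(p_j)_{j\ge 1}$ (and not on the dimension $s$ or on $N$), such that $$\widehat{e}_{N,s}(\mathcal{H}_{\boldsymbol{p}},K_{s,\boldsymbol{\gamma}})\le\frac{C}{N^{1-\delta}}\qquad\text{for all } s\in\mathbb{N}\text{ and all } N\ge2.$$ Consequently, the corresponding QMC rule achieves a strong polynomial tractability error bound with $\varepsilon$-exponent equal to one, and this exponent is optimal for open type QMC rules, i.e. no open type QMC rule for $\mathscr{H}(K_{s,\boldsymbol{\gamma}})$ has an $\varepsilon$-exponent smaller than one.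
   Context: $\log$ is the natural logarithm. Function space: $\mathscr{H}(K_{s,\boldsymbol{\gamma}})$ is the reproducing kernel Hilbert space of functions on $[0,1]^s$ with kernel $K_{s,\boldsymbol{\gamma}}(\boldsymbol{x},\boldsymbol{y})=\prod_{j=1}^s(1+\gamma_j\min(1-x_j,1-y_j))$. Worst-case error: for a sequence $\mathcal{S}=(\boldsymbol{x}_n)_{n\ge0}$ in $[0,1)^s$ and a reproducing kernel $K$, $e_{N,s}(\mathcal{S},K)=\sup_{\|f\|_K\le1}\left|\int_{[0,1]^s}f(\boldsymbol{x})\,\mathrm{d}\boldsymbol{x}-\frac1N\sum_{n=0}^{N-1}f(\boldsymbol{x}_n)\right|$. A QMC rule is of open type if it uses the first $N$ points of an infinite sequence as nodes. Halton sequence: for a prime $p$ and $n=n_0+n_1p+n_2p^2+\cdots\in\mathbb{N}_0$ (base $p$ expansion) let $\phi_p(n)=\sum_{k\ge1}n_{k-1}p^{-k}$. Then $\mathcal{H}_{\boldsymbol{p}}=(\boldsymbol{x}_n)_{n\ge0}$ with $\boldsymbol{x}_n=(\phi_{p_1}(n),\ldots,\phi_{p_s}(n))$. $\boldsymbol{p}$-adic shift: let $\mathbb{Z}_p$ be the $p$-adic integers $z=\sum_{r\ge0}z_rp^r$, $z_r\in\{0,\ldots,p-1\}$, with $p$-adic addition. Extend $\phi_p$ to $\phi_p:\mathbb{Z}_p\to[0,1)$, $\phi_p(z)=\sum_{r\ge0}z_rp^{-r-1}\pmod 1$, and let $\phi_p^+:[0,1)\to\mathbb{Z}_p$, $\phi_p^+(\sum_{r\ge0}x_rp^{-r-1})=\sum_{r\ge0}x_rp^r$,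 always using the finite base $p$ expansion when one exists. For $x,\sigma\in[0,1)$ put $x\oplus_p\sigma=\phi_p(\phi_p^+(x)+\phi_p^+(\sigma))$, and define $\boldsymbol{x}\oplus_{\boldsymbol{p}}\boldsymbol{\sigma}=(x_1\oplus_{p_1}\sigma_1,\ldots,x_s\oplus_{p_s}\sigma_s)$. Let $\mathcal{H}_{\boldsymbol{p},\boldsymbol{\sigma}}=(\boldsymbol{x}_n\oplus_{\boldsymbol{p}}\boldsymbol{\sigma})_{n\ge0}$, where $(\boldsymbol{x}_n)_{n\ge0}=\mathcal{H}_{\boldsymbol{p}}$. RMS worst-case error: $\widehat{e}_{N,s}(\mathcal{H}_{\boldsymbol{p}},K_{s,\boldsymbol{\gamma}})=\sqrt{\mathbb{E}_{\boldsymbol{\sigma}}[e_{N,s}^2(\mathcal{H}_{\boldsymbol{p},\boldsymbol{\sigma}},K_{s,\boldsymbol{\gamma}})]}$, where $\boldsymbol{\sigma}$ is uniformly distributed on $[0,1)^s$. Tractability: for errors $E_{N,s}$ (either $E_{N,s}=\widehat{e}_{N,s}(\mathcal{H}_{\boldsymbol{p}},K_{s,\boldsymbol{\gamma}})$, or $E_{N,s}=e_{N,s}(\mathcal{S}_s,K_{s,\boldsymbol{\gamma}})$ for an open type rule given by sequences $\mathcal{S}_s$ in $[0,1)^s$, $s\in\mathbb{N}$) let $N(\varepsilon,s)=\min\{N\in\mathbb{N}: E_{N,s}\le\varepsilon\}$ ($=\infty$ if there is no such $N$). A strong polynomial tractability error bound is achieved if there are $C,\tau>0$ with $N(\varepsilon,s)\le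 C\varepsilon^{-\tau}$ for all $\varepsilon\in(0,1)$ and $s\in\mathbb{N}$; the $\varepsilon$-exponent is the infimum of all such $\tau$. *)

theory Defs
  imports "HOL-Analysis.Analysis" "HOL-Library.Infinite_Set" "HOL-Library.Extended_Real"
    "HOL-Library.Extended_Nat" "HOL-Computational_Algebra.Primes"
begin

text \<open>
  A point of \<open>s\<close>-dimensional space is an extensional function with index set \<open>{1..s}\<close>,
  since \<open>s\<close> varies inside the statements below.
\<close>

definition unit_cube :: "nat \<Rightarrow> (nat \<Rightarrow> real) set" where
  "unit_cube s = PiE {1..s} (\<lambda>_. {0..1})"

definition half_open_cube :: "nat \<Rightarrow> (nat \<Rightarrow> real) set" where
  "half_open_cube s = PiE {1..s} (\<lambda>_. {0..<1})"

abbreviation lebesgue_dim :: "nat \<Rightarrow> (nat \<Rightarrow> real) measure" where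
  "lebesgue_dim s \<equiv> PiM {1..s} (\<lambda>_. lborel)"


subsection \<open>Reproducing kernel Hilbert spaces\<close>

text \<open>Functions on a set \<open>D\<close> are the members of \<open>extensional D\<close>.\<close>

definition fun_add :: "'a set \<Rightarrow> ('a \<Rightarrow> real) \<Rightarrow> ('a \<Rightarrow> real) \<Rightarrow> 'a \<Rightarrow> real" where
  "fun_add D f g = (\<lambda>x\<in>D. f x + g x)"

definition fun_scale :: "'a set \<Rightarrow> real \<Rightarrow> ('a \<Rightarrow> real) \<Rightarrow> 'a \<Rightarrow> real" where
  "fun_scale D c f = (\<lambda>x\<in>D. c * f x)"

definition fun_diff :: "'a set \<Rightarrow> ('a \<Rightarrow> real) \<Rightarrow> ('a \<Rightarrow> real) \<Rightarrow> 'a \<Rightarrow> real" where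
  "fun_diff D f g = (\<lambda>x\<in>D. f x - g x)"

definition function_subspace :: "'a set \<Rightarrow> ('a \<Rightarrow> real) set \<Rightarrow> bool" where
  "function_subspace D H \<longleftrightarrow>
     H \<subseteq> extensional D \<and> (\<lambda>x\<in>D. 0) \<in> H \<and>
     (\<forall>f\<in>H. \<forall>g\<in>H. fun_add D f g \<in> H) \<and>
     (\<forall>c. \<forall>f\<in>H. fun_scale D c f \<in> H)"

definition inner_product_on ::
  "'a set \<Rightarrow> ('a \<Rightarrow> real) set \<Rightarrow> (('a \<Rightarrow> real) \<Rightarrow> ('a \<Rightarrow> real) \<Rightarrow> real) \<Rightarrow> bool" where
  "inner_product_on D H ip \<longleftrightarrow>
     (\<forall>f\<in>H. \<forall>g\<in>H. ip f g = ip g f) \<and>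
     (\<forall>f\<in>H. \<forall>g\<in>H. \<forall>h\<in>H. ip (fun_add D f g) h = ip f h + ip g h) \<and>
     (\<forall>c. \<forall>f\<in>H. \<forall>g\<in>H. ip (fun_scale D c f) g = c * ip f g) \<and>
     (\<forall>f\<in>H. 0 \<le> ip f f) \<and>
     (\<forall>f\<in>H. ip f f = 0 \<longrightarrow> f = (\<lambda>x\<in>D. 0))"

definition ip_norm :: "(('a \<Rightarrow> real) \<Rightarrow> ('a \<Rightarrow> real) \<Rightarrow> real) \<Rightarrow> ('a \<Rightarrow> real) \<Rightarrow> real" where
  "ip_norm ip f = sqrt (ip f f)"

definition complete_in_norm ::
  "'a set \<Rightarrow> ('a \<Rightarrow> real) set \<Rightarrow> (('a \<Rightarrow> real) \<Rightarrow> ('a \<Rightarrow> real) \<Rightarrow> real) \<Rightarrow> bool" where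
  "complete_in_norm D H ip \<longleftrightarrow>
     (\<forall>F :: nat \<Rightarrow> 'a \<Rightarrow> real.
        (\<forall>n. F n \<in> H) \<and>
        (\<forall>e>0. \<exists>M. \<forall>m\<ge>M. \<forall>n\<ge>M. ip_norm ip (fun_diff D (F m) (F n)) < e) \<longrightarrow>
        (\<exists>f\<in>H. (\<lambda>n. ip_norm ip (fun_diff D (F n) f)) \<longlonglongrightarrow> 0))"

definition is_rkhs ::
  "'a set \<Rightarrow> ('a \<Rightarrow> 'a \<Rightarrow> real) \<Rightarrow>
   ('a \<Rightarrow> real) set \<times> (('a \<Rightarrow> real) \<Rightarrow> ('a \<Rightarrow> real) \<Rightarrow> real) \<Rightarrow> bool" where
  "is_rkhs D K = (\<lambda>(H, ip).
     function_subspace D H \<and> inner_product_on D H ip \<and> complete_in_norm D H ip \<and>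
     (\<forall>y\<in>D. (\<lambda>x\<in>D. K x y) \<in> H \<and> (\<forall>f\<in>H. ip f (\<lambda>x\<in>D. K x y) = f y)))"

text \<open>
  By the Moore--Aronszajn theorem such a space exists for every symmetric positive semidefinite
  \<open>K\<close>, and its carrier and the values of its inner product on the carrier are unique, so the
  choice below only affects values of the inner product outside the carrier.
\<close>

definition rkhs ::
  "'a set \<Rightarrow> ('a \<Rightarrow> 'a \<Rightarrow> real) \<Rightarrow>
   ('a \<Rightarrow> real) set \<times> (('a \<Rightarrow> real) \<Rightarrow> ('a \<Rightarrow> real) \<Rightarrow> real)" where
  "rkhs D K = (SOME S. is_rkhs D K S)"

definition rkhs_carrier :: "'a set \<Rightarrow> ('a \<Rightarrow> 'a \<Rightarrow> real) \<Rightarrow> ('a \<Rightarrow> real) set" where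
  "rkhs_carrier D K = fst (rkhs D K)"

definition rkhs_norm :: "'a set \<Rightarrow> ('a \<Rightarrow> 'a \<Rightarrow> real) \<Rightarrow> ('a \<Rightarrow> real) \<Rightarrow> real" where
  "rkhs_norm D K = ip_norm (snd (rkhs D K))"

definition anchored_sobolev_kernel ::
  "nat \<Rightarrow> (nat \<Rightarrow> real) \<Rightarrow> (nat \<Rightarrow> real) \<Rightarrow> (nat \<Rightarrow> real) \<Rightarrow> real" where
  "anchored_sobolev_kernel s \<gamma> x y = (\<Prod>j=1..s. 1 + \<gamma> j * min (1 - x j) (1 - y j))"

definition worst_case_error ::
  "nat \<Rightarrow> nat \<Rightarrow> (nat \<Rightarrow> nat \<Rightarrow> real) \<Rightarrow> ((nat \<Rightarrow> real) \<Rightarrow> (nat \<Rightarrow> real) \<Rightarrow> real) \<Rightarrow> real" where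
  "worst_case_error N s X K =
     (SUP f \<in> {f \<in> rkhs_carrier (unit_cube s) K. rkhs_norm (unit_cube s) K f \<le> 1}.
        \<bar>(LINT x : unit_cube s | lebesgue_dim s. f x) - (1 / real N) * (\<Sum>n<N. f (X n))\<bar>)"


subsection \<open>Halton sequences and \<open>p\<close>-adic shifts\<close>

definition radical_inverse :: "nat \<Rightarrow> nat \<Rightarrow> real" where
  "radical_inverse p n = (\<Sum>r. real (n div p ^ r mod p) / real p ^ (r + 1))"

definition halton :: "(nat \<Rightarrow> nat) \<Rightarrow> nat \<Rightarrow> nat \<Rightarrow> nat \<Rightarrow> real" where
  "halton p s n = (\<lambda>j\<in>{1..s}. radical_inverse (p j) n)"

text \<open>
  A \<open>p\<close>-adic integer is represented by its digit sequence \<open>z\<close> with \<open>z r < p\<close> for all \<open>r\<close>;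
  \<open>p\<close>-adic addition is then addition of digits with carry.
\<close>

primrec padic_carry :: "nat \<Rightarrow> (nat \<Rightarrow> nat) \<Rightarrow> (nat \<Rightarrow> nat) \<Rightarrow> nat \<Rightarrow> nat" where
  "padic_carry p y z 0 = 0"
| "padic_carry p y z (Suc r) = (y r + z r + padic_carry p y z r) div p"

definition padic_add :: "nat \<Rightarrow> (nat \<Rightarrow> nat) \<Rightarrow> (nat \<Rightarrow> nat) \<Rightarrow> nat \<Rightarrow> nat" where
  "padic_add p y z r = (y r + z r + padic_carry p y z r) mod p"

definition padic_phi :: "nat \<Rightarrow> (nat \<Rightarrow> nat) \<Rightarrow> real" where
  "padic_phi p z = frac (\<Sum>r. real (z r) / real p ^ (r + 1))"

text \<open>
  For \<open>x\<close> in \<open>[0,1)\<close> the following digits are those of the base \<open>p\<close> expansion of \<open>x\<close>; taking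
  floors yields the finite expansion whenever there is one.
\<close>

definition padic_phi_plus :: "nat \<Rightarrow> real \<Rightarrow> nat \<Rightarrow> nat" where
  "padic_phi_plus p x r = nat \<lfloor>x * real p ^ (r + 1)\<rfloor> mod p"

definition padic_shift :: "nat \<Rightarrow> real \<Rightarrow> real \<Rightarrow> real" where
  "padic_shift p x \<sigma> = padic_phi p (padic_add p (padic_phi_plus p x) (padic_phi_plus p \<sigma>))"

definition shifted_halton :: "(nat \<Rightarrow> nat) \<Rightarrow> nat \<Rightarrow> (nat \<Rightarrow> real) \<Rightarrow> nat \<Rightarrow> nat \<Rightarrow> real" where
  "shifted_halton p s \<sigma> n = (\<lambda>j\<in>{1..s}. padic_shift (p j) (halton p s n j) (\<sigma> j))"

text \<open>
  The half-open cube has volume one, so the integral over it is the expectation for a uniformly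
  distributed shift.
\<close>

definition rms_worst_case_error ::
  "nat \<Rightarrow> nat \<Rightarrow> (nat \<Rightarrow> nat) \<Rightarrow> ((nat \<Rightarrow> real) \<Rightarrow> (nat \<Rightarrow> real) \<Rightarrow> real) \<Rightarrow> real" where
  "rms_worst_case_error N s p K =
     sqrt (LINT \<sigma> : half_open_cube s | lebesgue_dim s.
             (worst_case_error N s (shifted_halton p s \<sigma>) K)\<^sup>2)"

definition nth_prime :: "nat \<Rightarrow> nat" where
  "nth_prime j = enumerate {q :: nat. prime q} (j - 1)"


subsection \<open>Tractability\<close>

text \<open>
  Errors are given as a function \<open>E N s\<close>. The infimum is the minimum of the set if that is
  nonempty, and \<open>\<infinity>\<close> otherwise.
\<close>

definition information_complexity :: "(nat \<Rightarrow> nat \<Rightarrow> real) \<Rightarrow> real \<Rightarrow> nat \<Rightarrow> enat" where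
  "information_complexity E \<epsilon> s = (INF N \<in> {N. 1 \<le> N \<and> E N s \<le> \<epsilon>}. enat N)"

definition spt_exponents :: "(nat \<Rightarrow> nat \<Rightarrow> real) \<Rightarrow> real set" where
  "spt_exponents E =
     {\<tau>. 0 < \<tau> \<and> (\<exists>C>0. \<forall>\<epsilon>. 0 < \<epsilon> \<and> \<epsilon> < 1 \<longrightarrow> (\<forall>s\<ge>1.
        ereal_of_enat (information_complexity E \<epsilon> s) \<le> ereal (C * \<epsilon> powr (- \<tau>))))}"

definition strongly_polynomially_tractable :: "(nat \<Rightarrow> nat \<Rightarrow> real) \<Rightarrow> bool" where
  "strongly_polynomially_tractable E \<longleftrightarrow> spt_exponents E \<noteq> {}"

text \<open>Only meaningful for strongly polynomially tractable errors.\<close>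

definition eps_exponent :: "(nat \<Rightarrow> nat \<Rightarrow> real) \<Rightarrow> real" where
  "eps_exponent E = Inf (spt_exponents E)"

definition open_type_rule :: "(nat \<Rightarrow> nat \<Rightarrow> nat \<Rightarrow> real) \<Rightarrow> bool" where
  "open_type_rule X \<longleftrightarrow> (\<forall>s\<ge>1. \<forall>n. X s n \<in> half_open_cube s)"

end

theory Submission imports Defs begin

text \<open>
  In a reproducing kernel Hilbert space the squared worst-case error is the kernel integrated twice
  against the signed measure ``uniform minus empirical''. For the anchored Sobolev kernel this is the
  explicit expression \<open>wce_square\<close> (lemma \<open>worst_case_error_anchored\<close>). The definition of the
  error picks some reproducing kernel Hilbert space, so the existence of one has to be shown first
  (\<open>rkhs_exists\<close>, the Moore--Aronszajn theorem).

  Under a random \<open>p\<close>-adic shift every Halton point becomes uniformly distributed, and the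
  coordinates of the shift are independent. Hence the mean squared error is
  \<open>N\<^sup>-\<^sup>2 (\<Sum>n<N. \<Sum>m<N. \<Prod>j. E\<^sub>j n m) - (\<Prod>j. 1 + \<gamma>\<^sub>j / 3)\<close>, where \<open>E\<^sub>j n m\<close> is the expected value
  of the one-dimensional kernel at the shifted points number \<open>n\<close> and \<open>m\<close>. Since two points stay
  together exactly for the first digits in which \<open>n\<close> and \<open>m\<close> agree, \<open>E\<^sub>j\<close> depends on \<open>n - m\<close> only:
  it is \<open>1 + \<gamma>\<^sub>j (1/3 + \<Sum>g\<ge>1. shell p\<^sub>j g (n - m))\<close> (\<open>shifted_pair_expectation\<close>). The function
  \<open>shell p g\<close> has period \<open>p\<^sup>g\<close>, mean zero, support in the multiples of \<open>p\<^sup>g\<^sup>-\<^sup>1\<close>, and absolute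
  value at most \<open>p\<^sup>1\<^sup>-\<^sup>g\<close>.

  Expand the product over \<open>j\<close>. A term is given by a nonempty set \<open>u\<close> of coordinates and levels
  \<open>g\<^sub>j \<ge> 1\<close> for \<open>j \<in> u\<close>. By the Chinese remainder theorem its product of shells has period
  \<open>P = \<Prod>p\<^sub>j\<^sup>g\<close>, mean zero, support in the multiples of \<open>Q = P / \<Prod>p\<^sub>j\<close>, and size at most \<open>1/Q\<close>.
  Complete periods cancel, and the remaining \<open>r = N mod P\<close> indices contribute about
  \<open>r/Q + (r/Q)\<^sup>2\<close>, which for every \<open>0 < \<theta> \<le> 1\<close> is at most \<open>2 N\<^sup>\<theta> \<Prod>p\<^sub>j\<^sup>2 p\<^sub>j\<^sup>-\<^sup>\<theta>\<^sup>g\<close>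
  (\<open>shell_product_double_sum_le\<close>). Summed over all terms this is again a product, with factors
  \<open>1 + \<gamma>\<^sub>j O(p\<^sub>j\<^sup>2\<^sup>-\<^sup>\<theta>)\<close>. The saving \<open>p\<^sub>j\<^sup>-\<^sup>\<theta>\<close> absorbs the logarithm in \<open>p\<^sub>j \<approx> j log j\<close>, so the
  factors are \<open>1 + O(\<gamma>\<^sub>j j\<^sup>2)\<close> and the product is bounded independently of the dimension. With
  \<open>\<theta> = 2\<delta>\<close> the mean squared error is \<open>O(N\<^sup>2\<^sup>\<delta>\<^sup>-\<^sup>2)\<close>.

  Nothing beats the rate \<open>1/N\<close>, because this fails already in dimension one: for \<open>N\<close> arbitrary points
  the squared error is at least \<open>\<gamma>\<^sub>1 / (12 N\<^sup>2)\<close>, with equality for the midpoints of \<open>N\<close> equal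
  intervals (\<open>wce_square_one_dim_ge\<close>). This gives the lower bound for both the shifted Halton
  sequence and arbitrary open type rules.
\<close>

section \<open>The Moore--Aronszajn construction\<close>

text \<open>
  Members of \<open>fin_coeffs D\<close> stand for finite linear combinations of point evaluations;
  \<open>pairing\<close> applies such a functional to a function.
\<close>

definition fin_coeffs :: "'a set \<Rightarrow> ('a \<Rightarrow> real) set" where
  "fin_coeffs D = {a. finite {x. a x \<noteq> 0} \<and> {x. a x \<noteq> 0} \<subseteq> D}"

definition pairing :: "('a \<Rightarrow> real) \<Rightarrow> ('a \<Rightarrow> real) \<Rightarrow> real" where
  "pairing a f = (\<Sum>x | a x \<noteq> 0. a x * f x)"

definition psd_kernel :: "'a set \<Rightarrow> ('a \<Rightarrow> 'a \<Rightarrow> real) \<Rightarrow> bool" where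
  "psd_kernel D K \<longleftrightarrow> (\<forall>x\<in>D. \<forall>y\<in>D. K x y = K y x) \<and>
     (\<forall>F c. finite F \<longrightarrow> F \<subseteq> D \<longrightarrow> 0 \<le> (\<Sum>x\<in>F. \<Sum>y\<in>F. c x * c y * K x y))"

text \<open>
  The inner product of two functionals in the dual of the space with kernel \<open>K\<close>.
\<close>

definition energy :: "('a \<Rightarrow> 'a \<Rightarrow> real) \<Rightarrow> ('a \<Rightarrow> real) \<Rightarrow> ('a \<Rightarrow> real) \<Rightarrow> real" where
  "energy K a b = pairing a (\<lambda>x. pairing b (K x))"

text \<open>
  By Legendre duality the squared norm of \<open>f\<close> is the supremum of
  \<open>2 a(f) - \<parallel>a\<parallel>\<^sup>2\<close> over the functionals \<open>a\<close>. Taken as the definition of the norm, it makes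
  completions unnecessary: the space consists of the functions for which the supremum is finite.
\<close>

definition dual_gain :: "('a \<Rightarrow> 'a \<Rightarrow> real) \<Rightarrow> ('a \<Rightarrow> real) \<Rightarrow> ('a \<Rightarrow> real) \<Rightarrow> real" where
  "dual_gain K f a = 2 * pairing a f - energy K a a"

definition sqnorm :: "'a set \<Rightarrow> ('a \<Rightarrow> 'a \<Rightarrow> real) \<Rightarrow> ('a \<Rightarrow> real) \<Rightarrow> real" where
  "sqnorm D K f = (SUP a \<in> fin_coeffs D. dual_gain K f a)"

definition finite_sqnorm :: "'a set \<Rightarrow> ('a \<Rightarrow> 'a \<Rightarrow> real) \<Rightarrow> ('a \<Rightarrow> real) \<Rightarrow> bool" where
  "finite_sqnorm D K f \<longleftrightarrow> bdd_above (dual_gain K f ` fin_coeffs D)"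

text \<open>
  Polarisation of \<open>sqnorm\<close>, which turns out to be the inner product.
\<close>

definition polar :: "'a set \<Rightarrow> ('a \<Rightarrow> 'a \<Rightarrow> real) \<Rightarrow> ('a \<Rightarrow> real) \<Rightarrow> ('a \<Rightarrow> real) \<Rightarrow> real" where
  "polar D K f g = (sqnorm D K (\<lambda>x. f x + g x) - sqnorm D K (\<lambda>x. f x - g x)) / 4"

lemma pairing_eq_sum:
  assumes "finite F" "\<And>x. x \<notin> F \<Longrightarrow> a x = 0"
  shows "pairing a f = (\<Sum>x\<in>F. a x * f x)"
  unfolding pairing_def by (rule sum.mono_neutral_left) (use assms in auto)

lemma fin_coeffsD: "a \<in> fin_coeffs D \<Longrightarrow> finite {x. a x \<noteq> 0}"
  "a \<in> fin_coeffs D \<Longrightarrow> a x \<noteq> 0 \<Longrightarrow> x \<in> D"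
  by (auto simp: fin_coeffs_def)

lemma fin_coeffs_0: "(\<lambda>x. 0) \<in> fin_coeffs D" by (simp add: fin_coeffs_def)

lemma fin_coeffs_lin:
  assumes "a \<in> fin_coeffs D" "b \<in> fin_coeffs D"
  shows "(\<lambda>x. s * a x + t * b x) \<in> fin_coeffs D"
proof -
  have "{x. s * a x + t * b x \<noteq> 0} \<subseteq> {x. a x \<noteq> 0} \<union> {x. b x \<noteq> 0}" by auto
  then show ?thesis using assms unfolding fin_coeffs_def by (auto intro: finite_subset)
qed

lemma fin_coeffs_delta: "y \<in> D \<Longrightarrow> (\<lambda>x. if x = y then t else 0) \<in> fin_coeffs D"
  by (auto simp: fin_coeffs_def intro: finite_subset[of _ "{y}"])

lemma pairing_lin_left:
  assumes "a \<in> fin_coeffs D" "b \<in> fin_coeffs D"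
  shows "pairing (\<lambda>x. s * a x + t * b x) f = s * pairing a f + t * pairing b f"
proof -
  let ?F = "{x. a x \<noteq> 0} \<union> {x. b x \<noteq> 0}"
  have fin: "finite ?F" using assms by (auto dest: fin_coeffsD)
  have "pairing (\<lambda>x. s * a x + t * b x) f = (\<Sum>x\<in>?F. (s * a x + t * b x) * f x)"
    by (rule pairing_eq_sum[OF fin]) auto
  moreover have "pairing a f = (\<Sum>x\<in>?F. a x * f x)" by (rule pairing_eq_sum[OF fin]) auto
  moreover have "pairing b f = (\<Sum>x\<in>?F. b x * f x)" by (rule pairing_eq_sum[OF fin]) auto
  ultimately show ?thesis by (simp add: sum_distrib_left sum.distrib algebra_simps)
qed

lemma pairing_lin_right:
  "pairing a (\<lambda>x. s * f x + t * g x) = s * pairing a f + t * pairing a g"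
  by (simp add: pairing_def sum_distrib_left sum.distrib algebra_simps)

lemma pairing_cong:
  assumes "a \<in> fin_coeffs D" "\<And>x. x \<in> D \<Longrightarrow> f x = g x" shows "pairing a f = pairing a g"
  unfolding pairing_def by (rule sum.cong) (use assms in \<open>auto dest: fin_coeffsD\<close>)

lemma pairing_delta: "pairing (\<lambda>x. if x = y then t else 0) f = t * f y"
  by (subst pairing_eq_sum[of "{y}"]) auto

lemma energy_lin_left:
  assumes "a \<in> fin_coeffs D" "b \<in> fin_coeffs D"
  shows "energy K (\<lambda>x. s * a x + t * b x) c = s * energy K a c + t * energy K b c"
  unfolding energy_def by (rule pairing_lin_left[OF assms])

lemma energy_sym:
  assumes "psd_kernel D K" "a \<in> fin_coeffs D" "b \<in> fin_coeffs D"
  shows "energy K a b = energy K b a"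
proof -
  have "energy K a b = (\<Sum>x | a x \<noteq> 0. \<Sum>y | b y \<noteq> 0. a x * (b y * K x y))"
    by (simp add: energy_def pairing_def sum_distrib_left)
  also have "\<dots> = (\<Sum>y | b y \<noteq> 0. \<Sum>x | a x \<noteq> 0. a x * (b y * K x y))" by (rule sum.swap)
  also have "\<dots> = (\<Sum>y | b y \<noteq> 0. \<Sum>x | a x \<noteq> 0. b y * (a x * K y x))"
  proof (intro sum.cong refl)
    fix x y assume "x \<in> {x. a x \<noteq> 0}" "y \<in> {y. b y \<noteq> 0}"
    then have "x \<in> D" "y \<in> D" using assms by (auto dest: fin_coeffsD)
    then have "K x y = K y x" using assms(1) by (auto simp: psd_kernel_def)
    then show "a x * (b y * K x y) = b y * (a x * K y x)" by simp
  qed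
  finally show ?thesis by (simp add: energy_def pairing_def sum_distrib_left)
qed

lemma energy_lin_right:
  assumes "psd_kernel D K" "a \<in> fin_coeffs D" "b \<in> fin_coeffs D" "c \<in> fin_coeffs D"
  shows "energy K c (\<lambda>x. s * a x + t * b x) = s * energy K c a + t * energy K c b"
  unfolding energy_sym[OF assms(1,4) fin_coeffs_lin[OF assms(2,3)]]
    energy_lin_left[OF assms(2,3)] energy_sym[OF assms(1,4,2)] energy_sym[OF assms(1,4,3)] ..

lemma energy_nonneg: "psd_kernel D K \<Longrightarrow> a \<in> fin_coeffs D \<Longrightarrow> 0 \<le> energy K a a"
  unfolding psd_kernel_def energy_def pairing_def fin_coeffs_def
  by (simp add: sum_distrib_left mult.assoc)

lemma energy_lin_both:
  assumes "psd_kernel D K" "a \<in> fin_coeffs D" "b \<in> fin_coeffs D"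
  shows "energy K (\<lambda>x. s * a x + t * b x) (\<lambda>x. s * a x + t * b x) =
    s\<^sup>2 * energy K a a + 2 * s * t * energy K a b + t\<^sup>2 * energy K b b"
  unfolding energy_lin_left[OF assms(2,3)] energy_lin_right[OF assms assms(2)]
    energy_lin_right[OF assms assms(3)] energy_sym[OF assms(1,3,2)]
  by (simp add: power2_eq_square algebra_simps)

text \<open>
  The substitution \<open>(a, b) \<mapsto> ((a + b) / 2, (a - b) / 2)\<close> is the parallelogram law for the
  dual norm. Taking suprema on both sides transports it to \<open>sqnorm\<close>.
\<close>

lemma dual_gain_parallelogram:
  assumes "psd_kernel D K" "a \<in> fin_coeffs D" "b \<in> fin_coeffs D"
  shows "dual_gain K (\<lambda>x. f x + g x) a + dual_gain K (\<lambda>x. f x - g x) b =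
    2 * dual_gain K f (\<lambda>x. (1/2) * a x + (1/2) * b x) +
    2 * dual_gain K g (\<lambda>x. (1/2) * a x + (-1/2) * b x)"
  using pairing_lin_right[of a 1 f 1 g] pairing_lin_right[of b 1 f "-1" g]
  unfolding dual_gain_def energy_lin_both[OF assms] pairing_lin_left[OF assms(2,3)]
  by (simp add: power2_eq_square algebra_simps)

lemma dual_gain_scale:
  assumes "psd_kernel D K" "a \<in> fin_coeffs D" "c \<noteq> 0"
  shows "dual_gain K (\<lambda>x. c * f x) a = c\<^sup>2 * dual_gain K f (\<lambda>x. (1/c) * a x + 0 * a x)"
proof -
  have "pairing a (\<lambda>x. c * f x) = c * pairing a f" using pairing_lin_right[of a c f 0 f] by simp
  then show ?thesis using assms(3)
    unfolding dual_gain_def energy_lin_both[OF assms(1,2,2)] pairing_lin_left[OF assms(2,2)]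
    by (simp add: power2_eq_square field_simps)
qed

text \<open>
  Adding a kernel section to \<open>f\<close> amounts to translating the functional by a multiple of a
  point evaluation: completing the square. This yields the reproducing property.
\<close>

lemma dual_gain_add_kernel:
  assumes "psd_kernel D K" "a \<in> fin_coeffs D" "y \<in> D"
  shows "dual_gain K (\<lambda>x. f x + t * K x y) a =
    dual_gain K f (\<lambda>x. 1 * a x + (-1) * (if x = y then t else 0)) + 2 * t * f y + t\<^sup>2 * K y y"
proof -
  let ?d = "\<lambda>x. if x = y then t else 0"
  have d: "?d \<in> fin_coeffs D" by (rule fin_coeffs_delta[OF assms(3)])
  have "energy K a ?d = pairing a (\<lambda>x. t * K x y)"
    unfolding energy_def by (simp add: pairing_delta)
  moreover have "pairing a (\<lambda>x. t * K x y) = t * pairing a (\<lambda>x. K x y)"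
    using pairing_lin_right[of a t "\<lambda>x. K x y" 0] by simp
  moreover have "energy K ?d ?d = t\<^sup>2 * K y y"
    unfolding energy_def by (simp add: pairing_delta power2_eq_square)
  ultimately show ?thesis
    using pairing_lin_right[of a 1 f t "\<lambda>x. K x y"] unfolding dual_gain_def
    by (simp only: energy_lin_both[OF assms(1,2) d] pairing_lin_left[OF assms(2) d] pairing_delta)
       (simp add: algebra_simps)
qed

lemma dual_gain_cong:
  assumes "a \<in> fin_coeffs D" "\<And>x. x \<in> D \<Longrightarrow> f x = g x"
  shows "dual_gain K f a = dual_gain K g a"
  using pairing_cong[OF assms] by (simp add: dual_gain_def)

lemma sqnorm_cong: "(\<And>x. x \<in> D \<Longrightarrow> f x = g x) \<Longrightarrow> sqnorm D K f = sqnorm D K g"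
  unfolding sqnorm_def by (intro SUP_cong refl dual_gain_cong) auto

lemma finite_sqnorm_cong:
  assumes "\<And>x. x \<in> D \<Longrightarrow> f x = g x" shows "finite_sqnorm D K f = finite_sqnorm D K g"
proof -
  have "dual_gain K f ` fin_coeffs D = dual_gain K g ` fin_coeffs D"
    by (intro image_cong refl dual_gain_cong) (use assms in auto)
  then show ?thesis by (simp add: finite_sqnorm_def)
qed

lemma dual_gain_le_sqnorm: "finite_sqnorm D K f \<Longrightarrow> a \<in> fin_coeffs D \<Longrightarrow> dual_gain K f a \<le> sqnorm D K f"
  unfolding sqnorm_def finite_sqnorm_def by (rule cSUP_upper)

lemma sqnorm_least: "(\<And>a. a \<in> fin_coeffs D \<Longrightarrow> dual_gain K f a \<le> B) \<Longrightarrow> sqnorm D K f \<le> B"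
  unfolding sqnorm_def using fin_coeffs_0 by (intro cSUP_least) auto

lemma finite_sqnormI: "(\<And>a. a \<in> fin_coeffs D \<Longrightarrow> dual_gain K f a \<le> B) \<Longrightarrow> finite_sqnorm D K f"
  unfolding finite_sqnorm_def by (rule bdd_aboveI2)

lemma dual_gain_at_0: "dual_gain K f (\<lambda>x. 0) = 0"
  by (simp add: dual_gain_def energy_def pairing_def)

lemma sqnorm_nonneg: "finite_sqnorm D K f \<Longrightarrow> 0 \<le> sqnorm D K f"
  using dual_gain_le_sqnorm[of D K f "\<lambda>x. 0"] by (simp add: fin_coeffs_0 dual_gain_at_0)

lemma dual_gain_zero_le: "psd_kernel D K \<Longrightarrow> a \<in> fin_coeffs D \<Longrightarrow> dual_gain K (\<lambda>x. 0) a \<le> 0"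
  using energy_nonneg[of D K a] by (simp add: dual_gain_def pairing_def)

lemma sqnorm_zero:
  assumes "psd_kernel D K" shows "finite_sqnorm D K (\<lambda>x. 0)" "sqnorm D K (\<lambda>x. 0) = 0"
proof -
  show *: "finite_sqnorm D K (\<lambda>x. 0)" by (rule finite_sqnormI) (rule dual_gain_zero_le[OF assms])
  show "sqnorm D K (\<lambda>x. 0) = 0"
    using sqnorm_nonneg[OF *] sqnorm_least[of D K "\<lambda>x. 0" 0] dual_gain_zero_le[OF assms]
    by (intro antisym) auto
qed

lemma dual_gain_sum_le:
  assumes "psd_kernel D K" "finite_sqnorm D K f" "finite_sqnorm D K g"
    "a \<in> fin_coeffs D" "b \<in> fin_coeffs D"
  shows "dual_gain K (\<lambda>x. f x + g x) a + dual_gain K (\<lambda>x. f x - g x) b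
    \<le> 2 * sqnorm D K f + 2 * sqnorm D K g"
  unfolding dual_gain_parallelogram[OF assms(1,4,5)]
  using assms by (intro add_mono mult_left_mono dual_gain_le_sqnorm fin_coeffs_lin) auto

lemma finite_sqnorm_add_diff:
  assumes "psd_kernel D K" "finite_sqnorm D K f" "finite_sqnorm D K g"
  shows "finite_sqnorm D K (\<lambda>x. f x + g x)" "finite_sqnorm D K (\<lambda>x. f x - g x)"
  using dual_gain_sum_le[OF assms _ fin_coeffs_0] dual_gain_sum_le[OF assms fin_coeffs_0]
  by (auto intro: finite_sqnormI simp: dual_gain_at_0)

lemma sqnorm_parallelogram_le:
  assumes "psd_kernel D K" "finite_sqnorm D K f" "finite_sqnorm D K g"
  shows "sqnorm D K (\<lambda>x. f x + g x) + sqnorm D K (\<lambda>x. f x - g x)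
    \<le> 2 * sqnorm D K f + 2 * sqnorm D K g"
proof -
  let ?B = "2 * sqnorm D K f + 2 * sqnorm D K g"
  have "sqnorm D K (\<lambda>x. f x + g x) \<le> ?B - dual_gain K (\<lambda>x. f x - g x) b" if "b \<in> fin_coeffs D" for b
    using dual_gain_sum_le[OF assms _ that] by (intro sqnorm_least) (simp add: le_diff_eq)
  then have "sqnorm D K (\<lambda>x. f x - g x) \<le> ?B - sqnorm D K (\<lambda>x. f x + g x)"
    by (intro sqnorm_least) (simp add: le_diff_eq add.commute)
  then show ?thesis by simp
qed

text \<open>
  One inequality for all scalars gives the other one by scaling back with \<open>1 / c\<close>.
\<close>

lemma sqnorm_scale:
  assumes "psd_kernel D K" "finite_sqnorm D K f"
  shows "finite_sqnorm D K (\<lambda>x. c * f x)" "sqnorm D K (\<lambda>x. c * f x) = c\<^sup>2 * sqnorm D K f"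
proof -
  have fin: "finite_sqnorm D K (\<lambda>x. c * h x) \<and> sqnorm D K (\<lambda>x. c * h x) \<le> c\<^sup>2 * sqnorm D K h"
    if h: "finite_sqnorm D K h" for c h
  proof (cases "c = 0")
    case True then show ?thesis using sqnorm_zero[OF assms(1)] by simp
  next
    case False
    have gain: "dual_gain K (\<lambda>x. c * h x) a \<le> c\<^sup>2 * sqnorm D K h" if "a \<in> fin_coeffs D" for a
      unfolding dual_gain_scale[OF assms(1) that False]
      by (intro mult_left_mono dual_gain_le_sqnorm h fin_coeffs_lin that) auto
    show ?thesis using finite_sqnormI[OF gain] sqnorm_least[OF gain] by blast
  qed
  show f: "finite_sqnorm D K (\<lambda>x. c * f x)" using fin[OF assms(2)] by blast
  show "sqnorm D K (\<lambda>x. c * f x) = c\<^sup>2 * sqnorm D K f"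
  proof (cases "c = 0")
    case True then show ?thesis using sqnorm_zero[OF assms(1)] by simp
  next
    case False
    have "sqnorm D K (\<lambda>x. (1/c) * (c * f x)) \<le> (1/c)\<^sup>2 * sqnorm D K (\<lambda>x. c * f x)"
      using fin[OF f] by blast
    then have "sqnorm D K f \<le> sqnorm D K (\<lambda>x. c * f x) / c\<^sup>2"
      using False by (simp add: power_divide)
    then have "c\<^sup>2 * sqnorm D K f \<le> sqnorm D K (\<lambda>x. c * f x)"
      using False by (simp add: pos_le_divide_eq mult.commute)
    then show ?thesis using fin[OF assms(2), of c] by linarith
  qed
qed

text \<open>
  The reverse inequality is the first one applied to \<open>f + g\<close> and \<open>f - g\<close>.
\<close>

lemma sqnorm_parallelogram:
  assumes "psd_kernel D K" "finite_sqnorm D K f" "finite_sqnorm D K g"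
  shows "sqnorm D K (\<lambda>x. f x + g x) + sqnorm D K (\<lambda>x. f x - g x)
    = 2 * sqnorm D K f + 2 * sqnorm D K g"
proof -
  note fin = finite_sqnorm_add_diff[OF assms]
  have "sqnorm D K (\<lambda>x. (f x + g x) + (f x - g x)) + sqnorm D K (\<lambda>x. (f x + g x) - (f x - g x))
    \<le> 2 * sqnorm D K (\<lambda>x. f x + g x) + 2 * sqnorm D K (\<lambda>x. f x - g x)"
    by (rule sqnorm_parallelogram_le[OF assms(1) fin])
  moreover have "sqnorm D K (\<lambda>x. (f x + g x) + (f x - g x)) = 4 * sqnorm D K f"
    using sqnorm_scale(2)[OF assms(1,2), of 2] by simp
  moreover have "sqnorm D K (\<lambda>x. (f x + g x) - (f x - g x)) = 4 * sqnorm D K g"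
    using sqnorm_scale(2)[OF assms(1,3), of 2] by simp
  ultimately show ?thesis using sqnorm_parallelogram_le[OF assms] by linarith
qed

lemma sqnorm_add_kernel:
  assumes "psd_kernel D K" "finite_sqnorm D K f" "y \<in> D"
  shows "finite_sqnorm D K (\<lambda>x. f x + t * K x y)"
    "sqnorm D K (\<lambda>x. f x + t * K x y) = sqnorm D K f + 2 * t * f y + t\<^sup>2 * K y y"
proof -
  have fin: "finite_sqnorm D K (\<lambda>x. h x + t * K x y) \<and>
      sqnorm D K (\<lambda>x. h x + t * K x y) \<le> sqnorm D K h + 2 * t * h y + t\<^sup>2 * K y y"
    if h: "finite_sqnorm D K h" for h t
  proof -
    have gain: "dual_gain K (\<lambda>x. h x + t * K x y) a \<le> sqnorm D K h + 2 * t * h y + t\<^sup>2 * K y y"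
      if "a \<in> fin_coeffs D" for a
      unfolding dual_gain_add_kernel[OF assms(1) that assms(3)]
      by (intro add_mono order_refl dual_gain_le_sqnorm[OF h] fin_coeffs_lin that
          fin_coeffs_delta assms(3))
    show ?thesis using finite_sqnormI[OF gain] sqnorm_least[OF gain] by blast
  qed
  show f: "finite_sqnorm D K (\<lambda>x. f x + t * K x y)" using fin[OF assms(2)] by blast
  have "sqnorm D K (\<lambda>x. (f x + t * K x y) + (-t) * K x y)
      \<le> sqnorm D K (\<lambda>x. f x + t * K x y) + 2 * (-t) * (f y + t * K y y) + (-t)\<^sup>2 * K y y"
    using fin[OF f, of "-t"] by blast
  then have "sqnorm D K f + 2 * t * f y + t\<^sup>2 * K y y \<le> sqnorm D K (\<lambda>x. f x + t * K x y)"
    by (simp add: power2_eq_square algebra_simps)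
  then show "sqnorm D K (\<lambda>x. f x + t * K x y) = sqnorm D K f + 2 * t * f y + t\<^sup>2 * K y y"
    using fin[OF assms(2), of t] by linarith
qed

lemma discriminant_le:
  fixes a b c :: real
  assumes nonneg: "\<And>t. 0 \<le> a + 2 * t * b + t\<^sup>2 * c" and c: "0 \<le> c"
  shows "b\<^sup>2 \<le> a * c"
proof (cases "c = 0")
  case True
  have "b = 0"
  proof (rule ccontr)
    assume "b \<noteq> 0"
    then show False using nonneg[of "- (a + 1) / (2 * b)"] True by (simp add: field_simps)
  qed
  then show ?thesis using True by simp
next
  case False
  then show ?thesis using nonneg[of "- b / c"] c by (simp add: field_simps power2_eq_square)
qed

lemma psd_kernel_diag: "psd_kernel D K \<Longrightarrow> y \<in> D \<Longrightarrow> 0 \<le> K y y"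
  using energy_nonneg[OF _ fin_coeffs_delta, of D K y 1] by (simp add: energy_def pairing_delta)

lemma sqnorm_bounds_value:
  assumes "psd_kernel D K" "finite_sqnorm D K f" "y \<in> D"
  shows "(f y)\<^sup>2 \<le> sqnorm D K f * K y y"
proof (rule discriminant_le)
  show "0 \<le> sqnorm D K f + 2 * t * f y + t\<^sup>2 * K y y" for t
    using sqnorm_nonneg[OF sqnorm_add_kernel(1)[OF assms]] sqnorm_add_kernel(2)[OF assms] by simp
qed (rule psd_kernel_diag[OF assms(1,3)])

text \<open>
  Needed to pass from additivity to homogeneity in the Jordan--von Neumann argument. The
  defect \<open>l t - t * l 1\<close> is additive, vanishes on the integers, hence is periodic and bounded, hence
  is zero.
\<close>

lemma additive_bounded_linear:
  fixes l :: "real \<Rightarrow> real"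
  assumes add: "\<And>s t. l (s + t) = l s + l t"
    and bdd: "\<And>t. 0 \<le> t \<Longrightarrow> t \<le> 1 \<Longrightarrow> \<bar>l t\<bar> \<le> B"
  shows "l c = c * l 1"
proof -
  define h where "h t = l t - t * l 1" for t
  have hadd: "h (s + t) = h s + h t" for s t by (simp add: h_def add algebra_simps)
  have h0: "h 0 = 0" using hadd[of 0 0] by simp
  have hn: "h (real n * t) = real n * h t" for n t
    by (induction n) (auto simp: h0 hadd algebra_simps)
  have hneg: "h (- t) = - h t" for t using hadd[of t "-t"] h0 by simp
  have "h 1 = 0" by (simp add: h_def)
  then have hnat: "h (real n) = 0" for n using hn[of n 1] by simp
  have hint: "h (of_int i) = 0" for i
    by (cases i rule: int_cases2) (auto simp: hnat hneg)
  have hbdd: "\<bar>h t\<bar> \<le> B + \<bar>l 1\<bar>" for t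
  proof -
    have "h t = h (frac t)" using hadd[of "of_int \<lfloor>t\<rfloor>" "frac t"] hint by (simp add: frac_def)
    moreover have "\<bar>frac t * l 1\<bar> \<le> \<bar>l 1\<bar>"
      using frac_lt_1[of t] by (simp add: abs_mult mult_left_le_one_le)
    moreover have "\<bar>l (frac t)\<bar> \<le> B" using frac_lt_1[of t] by (intro bdd) auto
    ultimately show ?thesis unfolding h_def by linarith
  qed
  have "h c = 0"
  proof (rule ccontr)
    assume "h c \<noteq> 0"
    then obtain n :: nat where "real n * \<bar>h c\<bar> > B + \<bar>l 1\<bar>"
      using reals_Archimedean3[of "\<bar>h c\<bar>"] by auto
    then show False using hbdd[of "real n * c"] by (simp add: hn abs_mult)
  qed
  then show ?thesis by (simp add: h_def)
qed

lemma polar_sym: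
  assumes "psd_kernel D K" "finite_sqnorm D K f" "finite_sqnorm D K g"
  shows "polar D K f g = polar D K g f"
  using sqnorm_scale(2)[OF assms(1) finite_sqnorm_add_diff(2)[OF assms], of "-1"]
  by (simp add: polar_def add.commute)

lemma polar_self: "psd_kernel D K \<Longrightarrow> finite_sqnorm D K f \<Longrightarrow> polar D K f f = sqnorm D K f"
  using sqnorm_scale(2)[of D K f 2] sqnorm_zero[of D K] by (simp add: polar_def)

lemma polar_zero:
  assumes "psd_kernel D K" "finite_sqnorm D K f" shows "polar D K (\<lambda>x. 0) f = 0"
  using sqnorm_scale(2)[OF assms, of "-1"] by (simp add: polar_def)

text \<open>
  Two parallelograms, one for \<open>f + h\<close> and \<open>g + h\<close>, one for \<open>f - h\<close> and \<open>g - h\<close>. The choice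
  \<open>g = 0\<close> then identifies the right-hand side with \<open>polar (f + g) h\<close>.
\<close>

lemma polar_add_double:
  assumes K: "psd_kernel D K" and f: "finite_sqnorm D K f" and g: "finite_sqnorm D K g"
    and h: "finite_sqnorm D K h"
  shows "polar D K f h + polar D K g h = polar D K (\<lambda>x. f x + g x) (\<lambda>x. 2 * h x) / 2"
proof -
  note c = finite_sqnorm_add_diff[OF K]
  have "sqnorm D K (\<lambda>x. (f x + h x) + (g x + h x)) + sqnorm D K (\<lambda>x. (f x + h x) - (g x + h x))
      = 2 * sqnorm D K (\<lambda>x. f x + h x) + 2 * sqnorm D K (\<lambda>x. g x + h x)"
    by (intro sqnorm_parallelogram K c f g h)
  moreover have "sqnorm D K (\<lambda>x. (f x - h x) + (g x - h x)) + sqnorm D K (\<lambda>x. (f x - h x) - (g x - h x))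
      = 2 * sqnorm D K (\<lambda>x. f x - h x) + 2 * sqnorm D K (\<lambda>x. g x - h x)"
    by (intro sqnorm_parallelogram K c f g h)
  moreover have "(\<lambda>x. (f x + h x) + (g x + h x)) = (\<lambda>x. (f x + g x) + 2 * h x)"
     "(\<lambda>x. (f x - h x) + (g x - h x)) = (\<lambda>x. (f x + g x) - 2 * h x)" by auto
  ultimately show ?thesis unfolding polar_def by (simp add: field_simps)
qed

lemma polar_add:
  assumes K: "psd_kernel D K" and f: "finite_sqnorm D K f" and g: "finite_sqnorm D K g"
    and h: "finite_sqnorm D K h"
  shows "polar D K (\<lambda>x. f x + g x) h = polar D K f h + polar D K g h"
  using polar_add_double[OF K finite_sqnorm_add_diff(1)[OF K f g] sqnorm_zero(1)[OF K] h]
    polar_add_double[OF K f g h] polar_zero[OF K h] by simp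

lemma polar_scale:
  assumes K: "psd_kernel D K" and f: "finite_sqnorm D K f" and g: "finite_sqnorm D K g"
  shows "polar D K (\<lambda>x. c * f x) g = c * polar D K f g"
proof -
  define l where "l t = polar D K (\<lambda>x. t * f x) g" for t
  note sc = sqnorm_scale[OF K]
  note c = finite_sqnorm_add_diff[OF K]
  have "l c = c * l 1"
  proof (rule additive_bounded_linear)
    show "l (s + t) = l s + l t" for s t
      unfolding l_def using polar_add[OF K sc(1)[OF f] sc(1)[OF f] g, of s t]
      by (simp add: algebra_simps)
    fix t :: real assume t: "0 \<le> t" "t \<le> 1"
    have "sqnorm D K (\<lambda>x. t * f x + g x) + sqnorm D K (\<lambda>x. t * f x - g x)
        = 2 * (t\<^sup>2 * sqnorm D K f) + 2 * sqnorm D K g"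
      using sqnorm_parallelogram[OF K sc(1)[OF f] g] by (simp add: sc(2)[OF f])
    moreover have "0 \<le> sqnorm D K (\<lambda>x. t * f x + g x)" "0 \<le> sqnorm D K (\<lambda>x. t * f x - g x)"
      by (intro sqnorm_nonneg c sc(1) f g)+
    moreover have "t\<^sup>2 * sqnorm D K f \<le> sqnorm D K f"
      using t sqnorm_nonneg[OF f] by (simp add: mult_left_le_one_le power_le_one)
    ultimately show "\<bar>l t\<bar> \<le> sqnorm D K f + sqnorm D K g"
      unfolding l_def polar_def abs_le_iff
      using sqnorm_nonneg[OF f] sqnorm_nonneg[OF g] by (simp add: field_simps)
  qed
  then show ?thesis by (simp add: l_def)
qed

lemma polar_kernel:
  assumes "psd_kernel D K" "finite_sqnorm D K f" "y \<in> D"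
  shows "polar D K f (\<lambda>x. K x y) = f y"
  using sqnorm_add_kernel(2)[OF assms, of 1] sqnorm_add_kernel(2)[OF assms, of "-1"]
  by (simp add: polar_def)

lemma finite_sqnorm_kernel: "psd_kernel D K \<Longrightarrow> y \<in> D \<Longrightarrow> finite_sqnorm D K (\<lambda>x. K x y)"
  using sqnorm_add_kernel(1)[of D K "\<lambda>x. 0" y 1] sqnorm_zero[of D K] by simp

lemma polar_cong:
  assumes "\<And>x. x \<in> D \<Longrightarrow> f x = f' x" "\<And>x. x \<in> D \<Longrightarrow> g x = g' x"
  shows "polar D K f g = polar D K f' g'"
  unfolding polar_def
  using sqnorm_cong[of D "\<lambda>x. f x + g x" "\<lambda>x. f' x + g' x" K]
    sqnorm_cong[of D "\<lambda>x. f x - g x" "\<lambda>x. f' x - g' x" K] assms by simp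

text \<open>
  A Cauchy sequence converges pointwise because point evaluations are bounded. Convergence in
  norm is then automatic, as a supremum of functions that are continuous for pointwise convergence is
  lower semicontinuous.
\<close>

lemma sqnorm_complete:
  assumes K: "psd_kernel D K" and F: "\<And>n. finite_sqnorm D K (F n)"
    and C: "\<And>e. e > 0 \<Longrightarrow> \<exists>M. \<forall>m\<ge>M. \<forall>n\<ge>M. sqrt (sqnorm D K (\<lambda>x. F m x - F n x)) < e"
  shows "\<exists>f. finite_sqnorm D K f \<and> (\<lambda>n. sqrt (sqnorm D K (\<lambda>x. F n x - f x))) \<longlonglongrightarrow> 0"
proof -
  note c = finite_sqnorm_add_diff[OF K]
  define f where "f y = lim (\<lambda>n. F n y)" for y
  have lim: "(\<lambda>n. F n y) \<longlonglongrightarrow> f y" if y: "y \<in> D" for y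
  proof -
    have "Cauchy (\<lambda>n. F n y)"
    proof (rule metric_CauchyI)
      fix e :: real assume e: "e > 0"
      define k where "k = sqrt (K y y)"
      have k: "k \<ge> 0" using psd_kernel_diag[OF K y] by (simp add: k_def)
      have "e / (k + 1) > 0" using e k by simp
      then obtain M where M: "\<And>m n. m \<ge> M \<Longrightarrow> n \<ge> M \<Longrightarrow>
          sqrt (sqnorm D K (\<lambda>x. F m x - F n x)) < e / (k + 1)"
        using C by blast
      have "dist (F m y) (F n y) < e" if "m \<ge> M" "n \<ge> M" for m n
      proof -
        have "(F m y - F n y)\<^sup>2 \<le> sqnorm D K (\<lambda>x. F m x - F n x) * K y y"
          by (rule sqnorm_bounds_value[OF K c(2)[OF F F] y])
        then have "\<bar>F m y - F n y\<bar> \<le> sqrt (sqnorm D K (\<lambda>x. F m x - F n x)) * k"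
          by (metis k_def real_sqrt_abs real_sqrt_le_mono real_sqrt_mult)
        also have "\<dots> \<le> e / (k + 1) * k"
          by (intro mult_right_mono k less_imp_le[OF M] that)
        also have "\<dots> < e" using e k by (simp add: field_simps)
        finally show ?thesis by (simp add: dist_real_def)
      qed
      then show "\<exists>M. \<forall>m\<ge>M. \<forall>n\<ge>M. dist (F m y) (F n y) < e" by blast
    qed
    then show ?thesis unfolding f_def by (simp add: Cauchy_convergent_iff convergent_LIMSEQ_iff)
  qed
  have pair_lim: "(\<lambda>m. dual_gain K (\<lambda>x. F n x - F m x) a) \<longlonglongrightarrow> dual_gain K (\<lambda>x. F n x - f x) a"
    if "a \<in> fin_coeffs D" for n a
    unfolding dual_gain_def pairing_def
    by (intro tendsto_intros lim) (use that in \<open>auto dest: fin_coeffsD\<close>)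
  have small: "\<exists>M. \<forall>n\<ge>M. finite_sqnorm D K (\<lambda>x. F n x - f x) \<and> sqnorm D K (\<lambda>x. F n x - f x) \<le> e\<^sup>2"
    if e: "e > 0" for e
  proof -
    obtain M where M: "\<And>m n. m \<ge> M \<Longrightarrow> n \<ge> M \<Longrightarrow> sqrt (sqnorm D K (\<lambda>x. F m x - F n x)) < e"
      using C[OF e] by blast
    have gain: "dual_gain K (\<lambda>x. F n x - f x) a \<le> e\<^sup>2" if "n \<ge> M" "a \<in> fin_coeffs D" for n a
    proof (rule LIMSEQ_le_const2[OF pair_lim[OF that(2)]], intro exI[of _ M] allI impI)
      fix m assume "m \<ge> M"
      have "sqnorm D K (\<lambda>x. F n x - F m x) \<le> e\<^sup>2"
        using M[OF that(1) \<open>m \<ge> M\<close>] sqnorm_nonneg[OF c(2)[OF F F], of n m]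
        by (intro sqrt_le_D less_imp_le)
      then show "dual_gain K (\<lambda>x. F n x - F m x) a \<le> e\<^sup>2"
        using dual_gain_le_sqnorm[OF c(2)[OF F F] that(2), of n m] by linarith
    qed
    show ?thesis
      by (intro exI[of _ M] allI impI conjI finite_sqnormI sqnorm_least) (use gain in auto)
  qed
  obtain n where "finite_sqnorm D K (\<lambda>x. F n x - f x)" using small[of 1] by auto
  from c(2)[OF F this, of n] have f: "finite_sqnorm D K f" by simp
  have "(\<lambda>n. sqrt (sqnorm D K (\<lambda>x. F n x - f x))) \<longlonglongrightarrow> 0"
  proof (rule LIMSEQ_I)
    fix e :: real assume e: "e > 0"
    then obtain M where M: "\<And>n. n \<ge> M \<Longrightarrow> sqnorm D K (\<lambda>x. F n x - f x) \<le> (e/2)\<^sup>2"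
      using small[of "e/2"] by auto
    have "norm (sqrt (sqnorm D K (\<lambda>x. F n x - f x)) - 0) < e" if "n \<ge> M" for n
    proof -
      have "sqrt (sqnorm D K (\<lambda>x. F n x - f x)) \<le> e/2"
        using real_sqrt_le_mono[OF M[OF that]] e by simp
      moreover have "0 \<le> sqrt (sqnorm D K (\<lambda>x. F n x - f x))"
        using sqnorm_nonneg[OF c(2)[OF F f], of n] by simp
      ultimately show ?thesis using e by simp
    qed
    then show "\<exists>M. \<forall>n\<ge>M. norm (sqrt (sqnorm D K (\<lambda>x. F n x - f x)) - 0) < e" by blast
  qed
  with f show ?thesis by blast
qed

text \<open>
  The Moore--Aronszajn theorem: the functions of finite dual norm, with the polarised norm,
  satisfy every requirement on a reproducing kernel Hilbert space.
\<close>

theorem rkhs_exists: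
  assumes K: "psd_kernel D K"
  shows "is_rkhs D K ({f \<in> extensional D. finite_sqnorm D K f}, polar D K)"
proof -
  let ?H = "{f \<in> extensional D. finite_sqnorm D K f}"
  have r: "finite_sqnorm D K (restrict f D) = finite_sqnorm D K f" for f
    by (rule finite_sqnorm_cong) simp
  have rp1: "polar D K (restrict f D) g = polar D K f g" for f g by (rule polar_cong) auto
  have rp2: "polar D K g (restrict f D) = polar D K g f" for f g by (rule polar_cong) auto
  have rs: "sqnorm D K (restrict f D) = sqnorm D K f" for f by (rule sqnorm_cong) auto
  note c = finite_sqnorm_add_diff[OF K] and s = sqnorm_scale[OF K] and z = sqnorm_zero[OF K]
  have norm_eq: "ip_norm (polar D K) (fun_diff D f g) = sqrt (sqnorm D K (\<lambda>x. f x - g x))"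
    if "finite_sqnorm D K f" "finite_sqnorm D K g" for f g
    unfolding ip_norm_def fun_diff_def by (simp add: rp1 rp2 polar_self[OF K c(2)[OF that]])
  have "function_subspace D ?H"
    unfolding function_subspace_def fun_add_def fun_scale_def using c s z by (auto simp: r)
  moreover have "inner_product_on D ?H (polar D K)"
    unfolding inner_product_on_def fun_add_def fun_scale_def
  proof (intro conjI ballI allI impI)
    fix f assume f: "f \<in> ?H" and 0: "polar D K f f = 0"
    then have "sqnorm D K f = 0" using polar_self[OF K] by auto
    then have "f x = 0" if "x \<in> D" for x
      using sqnorm_bounds_value[OF K _ that, of f] f by simp
    then show "f = (\<lambda>x\<in>D. 0)" using f by (auto simp: extensional_def)
  qed (auto simp: rp1 polar_sym[OF K] polar_add[OF K] polar_scale[OF K] polar_self[OF K] sqnorm_nonneg)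
  moreover have "complete_in_norm D ?H (polar D K)"
    unfolding complete_in_norm_def
  proof (intro allI impI, elim conjE)
    fix F :: "nat \<Rightarrow> 'a \<Rightarrow> real"
    assume F: "\<forall>n. F n \<in> ?H"
      and C: "\<forall>e>0. \<exists>M. \<forall>m\<ge>M. \<forall>n\<ge>M. ip_norm (polar D K) (fun_diff D (F m) (F n)) < e"
    have F': "finite_sqnorm D K (F n)" for n using F by blast
    obtain f where f: "finite_sqnorm D K f" "(\<lambda>n. sqrt (sqnorm D K (\<lambda>x. F n x - f x))) \<longlonglongrightarrow> 0"
      using sqnorm_complete[of D K F, OF K F'] C by (auto simp: norm_eq F')
    have fr: "finite_sqnorm D K (restrict f D)" using f(1) by (simp add: r)
    have "sqnorm D K (\<lambda>x. F n x - restrict f D x) = sqnorm D K (\<lambda>x. F n x - f x)" for n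
      by (rule sqnorm_cong) simp
    then have "(\<lambda>n. ip_norm (polar D K) (fun_diff D (F n) (restrict f D))) \<longlonglongrightarrow> 0"
      using f(2) by (simp add: norm_eq[OF F' fr])
    then show "\<exists>f\<in>?H. (\<lambda>n. ip_norm (polar D K) (fun_diff D (F n) f)) \<longlonglongrightarrow> 0"
      using fr by (intro bexI[of _ "restrict f D"]) auto
  qed
  moreover have "(\<lambda>x\<in>D. K x y) \<in> ?H" "\<forall>f\<in>?H. polar D K f (\<lambda>x\<in>D. K x y) = f y" if "y \<in> D" for y
    using that by (auto simp: r rp2 finite_sqnorm_kernel[OF K] polar_kernel[OF K])
  ultimately show ?thesis unfolding is_rkhs_def by simp
qed

lemma is_rkhs_rkhs: "psd_kernel D K \<Longrightarrow> is_rkhs D K (rkhs D K)"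
  unfolding rkhs_def by (rule someI) (rule rkhs_exists)

section \<open>Worst-case errors in a reproducing kernel Hilbert space\<close>

locale kernel_space =
  fixes D :: "'a set" and K :: "'a \<Rightarrow> 'a \<Rightarrow> real" and H :: "('a \<Rightarrow> real) set"
    and ip :: "('a \<Rightarrow> real) \<Rightarrow> ('a \<Rightarrow> real) \<Rightarrow> real"
  assumes rkhs: "is_rkhs D K (H, ip)"
begin

abbreviation section_at :: "'a \<Rightarrow> 'a \<Rightarrow> real" where
  "section_at y \<equiv> (\<lambda>x\<in>D. K x y)"

text \<open>
  The Riesz representer of a functional, which exists for point evaluations by the
  reproducing property and hence for their finite combinations.
\<close>

definition represents :: "('a \<Rightarrow> real) \<Rightarrow> (('a \<Rightarrow> real) \<Rightarrow> real) \<Rightarrow> bool" where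
  "represents h l \<longleftrightarrow> h \<in> H \<and> (\<forall>f\<in>H. ip f h = l f)"

lemma closed_add: "f \<in> H \<Longrightarrow> g \<in> H \<Longrightarrow> fun_add D f g \<in> H"
  and closed_scale: "f \<in> H \<Longrightarrow> fun_scale D c f \<in> H"
  and closed_zero: "(\<lambda>x\<in>D. 0) \<in> H"
  using rkhs by (auto simp: is_rkhs_def function_subspace_def)

lemma ip_sym: "f \<in> H \<Longrightarrow> g \<in> H \<Longrightarrow> ip f g = ip g f"
  and ip_add: "f \<in> H \<Longrightarrow> g \<in> H \<Longrightarrow> h \<in> H \<Longrightarrow> ip (fun_add D f g) h = ip f h + ip g h"
  and ip_scale: "f \<in> H \<Longrightarrow> g \<in> H \<Longrightarrow> ip (fun_scale D c f) g = c * ip f g"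
  and ip_nonneg: "f \<in> H \<Longrightarrow> 0 \<le> ip f f"
  using rkhs by (auto simp: is_rkhs_def inner_product_on_def)

lemma ip_add_right: "f \<in> H \<Longrightarrow> g \<in> H \<Longrightarrow> h \<in> H \<Longrightarrow> ip h (fun_add D f g) = ip h f + ip h g"
  using ip_add[of f g h] ip_sym[of h "fun_add D f g"] ip_sym[of h f] ip_sym[of h g] closed_add
  by simp

lemma ip_scale_right: "f \<in> H \<Longrightarrow> g \<in> H \<Longrightarrow> ip g (fun_scale D c f) = c * ip g f"
  using ip_scale[of f g c] ip_sym[of g "fun_scale D c f"] ip_sym[of g f] closed_scale by simp

lemma section_in: "y \<in> D \<Longrightarrow> section_at y \<in> H"
  and reproducing: "y \<in> D \<Longrightarrow> f \<in> H \<Longrightarrow> ip f (section_at y) = f y"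
  using rkhs by (auto simp: is_rkhs_def)

lemma kernel_sym: "x \<in> D \<Longrightarrow> y \<in> D \<Longrightarrow> K x y = K y x"
  using reproducing[of x "section_at y"] reproducing[of y "section_at x"]
    ip_sym[of "section_at x" "section_at y"] section_in[of x] section_in[of y] by simp

lemma cauchy_schwarz:
  assumes f: "f \<in> H" and g: "g \<in> H"
  shows "(ip f g)\<^sup>2 \<le> ip f f * ip g g"
proof (rule discriminant_le)
  fix t
  let ?g = "fun_scale D t g"
  have tg: "?g \<in> H" by (rule closed_scale[OF g])
  have "0 \<le> ip (fun_add D f ?g) (fun_add D f ?g)" by (intro ip_nonneg closed_add f tg)
  also have "\<dots> = ip f f + 2 * t * ip f g + t\<^sup>2 * ip g g"
    using f g tg by (simp add: ip_add ip_add_right closed_add ip_scale ip_scale_right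
        ip_sym[OF g f] power2_eq_square algebra_simps)
  finally show "0 \<le> ip f f + 2 * t * ip f g + t\<^sup>2 * ip g g" .
qed (rule ip_nonneg[OF g])

lemma represents_eval: "y \<in> D \<Longrightarrow> represents (section_at y) (\<lambda>f. f y)"
  by (simp add: represents_def section_in reproducing)

lemma represents_zero: "represents (\<lambda>x\<in>D. 0) (\<lambda>f. 0)"
proof -
  have "ip f (\<lambda>x\<in>D. 0) = 0" if "f \<in> H" for f
    using ip_scale_right[OF that that, of 0] by (simp add: fun_scale_def)
  then show ?thesis by (simp add: represents_def closed_zero)
qed

lemma represents_add_scale:
  assumes "represents g l" "represents h l'"
  shows "represents (fun_add D g (fun_scale D c h)) (\<lambda>f. l f + c * l' f)"
  using assms by (auto simp: represents_def closed_add closed_scale ip_add_right ip_scale_right)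

lemma represents_sum:
  assumes "finite I" "\<And>i. i \<in> I \<Longrightarrow> y i \<in> D"
  shows "\<exists>h. represents h (\<lambda>f. \<Sum>i\<in>I. c i * f (y i))"
  using assms
proof (induction I)
  case empty then show ?case using represents_zero by auto
next
  case (insert i I)
  then obtain h where "represents h (\<lambda>f. \<Sum>i\<in>I. c i * f (y i))" by auto
  from represents_add_scale[OF this represents_eval, of "y i" "c i"] insert show ?case
    by (auto simp: add.commute)
qed

lemma represents_value:
  assumes "represents h l" "x \<in> D" shows "h x = l (section_at x)"
  using assms reproducing[of x h] ip_sym[of h "section_at x"] section_in[of x]
  by (simp add: represents_def)

text \<open>
  Functionals such as integration are limits of finite combinations \<open>A m\<close> of point
  evaluations. The norm of \<open>A m\<close> is the norm of its representer \<open>h m\<close>, so the norm of the limit \<open>L\<close>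
  is at most the limit of these norms; the normalised representers show that it is attained in the
  limit. No representer of \<open>L\<close> itself is constructed.
\<close>

lemma dual_norm_eq_limit:
  assumes rep: "\<And>m. represents (h m) (A m)"
    and conv: "\<And>f. f \<in> H \<Longrightarrow> (\<lambda>m. A m f) \<longlonglongrightarrow> L f"
    and V1: "(\<lambda>m. A m (h m)) \<longlonglongrightarrow> V"
    and V2: "(\<lambda>m. L (h m)) \<longlonglongrightarrow> V"
    and hom: "\<And>c f. f \<in> H \<Longrightarrow> L (fun_scale D c f) = c * L f"
  shows "0 \<le> V" "(SUP f \<in> {f \<in> H. ip_norm ip f \<le> 1}. \<bar>L f\<bar>) = sqrt V"
proof -
  have hH: "h m \<in> H" and norm_h: "ip (h m) (h m) = A m (h m)" for m
    using rep by (auto simp: represents_def)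
  show V: "0 \<le> V"
    by (rule LIMSEQ_le_const[OF V1]) (use norm_h ip_nonneg[OF hH] in auto)
  have upper: "\<bar>L f\<bar> \<le> sqrt V" if f: "f \<in> H" "ip_norm ip f \<le> 1" for f
  proof (rule LIMSEQ_le)
    show "(\<lambda>m. \<bar>A m f\<bar>) \<longlonglongrightarrow> \<bar>L f\<bar>" by (intro tendsto_rabs conv f)
    show "(\<lambda>m. sqrt (A m (h m))) \<longlonglongrightarrow> sqrt V" by (intro tendsto_real_sqrt V1)
    have "\<bar>A m f\<bar> \<le> sqrt (A m (h m))" for m
    proof -
      have "(A m f)\<^sup>2 \<le> ip f f * ip (h m) (h m)"
        using cauchy_schwarz[OF f(1) hH] rep f(1) by (auto simp: represents_def)
      also have "\<dots> \<le> 1 * ip (h m) (h m)"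
        using f ip_nonneg[OF hH] by (intro mult_right_mono) (auto simp: ip_norm_def)
      finally show ?thesis using norm_h by (intro real_le_rsqrt) simp
    qed
    then show "\<exists>N. \<forall>n\<ge>N. \<bar>A n f\<bar> \<le> sqrt (A n (h n))" by blast
  qed
  let ?S = "{f \<in> H. ip_norm ip f \<le> 1}"
  have bdd: "bdd_above ((\<lambda>f. \<bar>L f\<bar>) ` ?S)" using upper by (intro bdd_aboveI2) auto
  have zero: "(\<lambda>x\<in>D. 0) \<in> ?S"
    using represents_zero closed_zero by (simp add: ip_norm_def represents_def)
  have "sqrt V \<le> (SUP f \<in> ?S. \<bar>L f\<bar>)"
  proof (cases "V = 0")
    case True
    then show ?thesis using cSUP_upper[OF zero bdd] abs_ge_zero order_trans by simp
  next
    case False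
    then have Vp: "V > 0" using V by simp
    have ev: "\<forall>\<^sub>F m in sequentially. A m (h m) > 0"
      using order_tendstoD(1)[OF V1 Vp] .
    show ?thesis
    proof (rule tendsto_upperbound)
      show "(\<lambda>m. \<bar>(1 / sqrt (A m (h m))) * L (h m)\<bar>) \<longlonglongrightarrow> sqrt V"
      proof -
        have "(\<lambda>m. \<bar>(1 / sqrt (A m (h m))) * L (h m)\<bar>) \<longlonglongrightarrow> \<bar>(1 / sqrt V) * V\<bar>"
          by (intro tendsto_intros V1 V2) (use Vp in auto)
        moreover have "\<bar>(1 / sqrt V) * V\<bar> = sqrt V" using Vp by (simp add: real_div_sqrt)
        ultimately show ?thesis by simp
      qed
      show "\<forall>\<^sub>F m in sequentially. \<bar>(1 / sqrt (A m (h m))) * L (h m)\<bar> \<le> (SUP f \<in> ?S. \<bar>L f\<bar>)"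
        using ev
      proof eventually_elim
        case (elim m)
        let ?c = "1 / sqrt (A m (h m))"
        have "ip (fun_scale D ?c (h m)) (fun_scale D ?c (h m)) = ?c * (?c * A m (h m))"
          by (simp only: ip_scale ip_scale_right closed_scale hH norm_h)
        also have "\<dots> = 1" using elim by (simp add: field_simps)
        finally have "fun_scale D ?c (h m) \<in> ?S" by (simp add: ip_norm_def closed_scale hH)
        from cSUP_upper[OF this bdd] show ?case by (simp only: hom hH)
      qed
    qed simp
  qed
  moreover have "(SUP f \<in> ?S. \<bar>L f\<bar>) \<le> sqrt V" using zero upper by (intro cSUP_least) auto
  ultimately show "(SUP f \<in> ?S. \<bar>L f\<bar>) = sqrt V" by simp
qed

end

text \<open>
  Maps \<open>r m\<close> of finite range that tend to the identity replace integrals by finite sums, so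
  that every integral below is a limit of finite combinations of point evaluations.
\<close>

locale sampled_kernel_space = kernel_space D K H ip + finite_measure \<mu>
  for D :: "'a set" and K H ip and \<mu> :: "'a measure" +
  fixes r :: "nat \<Rightarrow> 'a \<Rightarrow> 'a" and B :: real
  assumes space_D: "space \<mu> = D"
    and mass_D: "measure \<mu> D = 1"
    and r_in: "x \<in> D \<Longrightarrow> r m x \<in> D"
    and r_finite: "finite (r m ` D)"
    and r_meas: "z \<in> D \<Longrightarrow> {x \<in> D. r m x = z} \<in> sets \<mu>"
    and K_bound: "x \<in> D \<Longrightarrow> y \<in> D \<Longrightarrow> \<bar>K x y\<bar> \<le> B"
    and K_conv2: "x \<in> D \<Longrightarrow> y \<in> D \<Longrightarrow> (\<lambda>m. K (r m x) (r m y)) \<longlonglongrightarrow> K x y"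
    and K_conv1: "x \<in> D \<Longrightarrow> y \<in> D \<Longrightarrow> (\<lambda>m. K (r m x) y) \<longlonglongrightarrow> K x y"
begin

lemma r_expand:
  assumes "x \<in> D"
  shows "F (r m x) = (\<Sum>z \<in> r m ` D. (F z :: real) * indicator {x \<in> D. r m x = z} x)"
proof -
  have "(\<Sum>z \<in> r m ` D. F z * indicator {x \<in> D. r m x = z} x) = (\<Sum>z \<in> {r m x}. F z * indicator {x \<in> D. r m x = z} x)"
    by (rule sum.mono_neutral_right) (use assms r_finite in \<open>auto simp: indicator_def\<close>)
  then show ?thesis using assms by simp
qed

lemma r_measurable: "(\<lambda>x. F (r m x) :: real) \<in> borel_measurable \<mu>"
proof -
  have "(\<lambda>x. \<Sum>z \<in> r m ` D. F z * indicator {x \<in> D. r m x = z} x) \<in> borel_measurable \<mu>"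
    by (intro borel_measurable_sum borel_measurable_times borel_measurable_const
        borel_measurable_indicator r_meas) (use r_in in auto)
  then show ?thesis by (rule measurable_cong[THEN iffD1, rotated]) (simp add: space_D r_expand)
qed

lemma r_integral:
  "(\<integral>x. (F (r m x) :: real) \<partial>\<mu>) = (\<Sum>z \<in> r m ` D. measure \<mu> {x \<in> D. r m x = z} * F z)"
proof -
  have "(\<integral>x. (F (r m x) :: real) \<partial>\<mu>) = (\<integral>x. (\<Sum>z \<in> r m ` D. F z * indicator {x \<in> D. r m x = z} x) \<partial>\<mu>)"
    by (rule Bochner_Integration.integral_cong) (auto simp: space_D r_expand)
  also have "\<dots> = (\<Sum>z \<in> r m ` D. F z * measure \<mu> {x \<in> D. r m x = z})"
  proof (subst Bochner_Integration.integral_sum)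
    have A: "{x \<in> D. r m x = z} \<in> sets \<mu>" if "z \<in> r m ` D" for z
      using that r_in by (intro r_meas) auto
    then have int: "integrable \<mu> (indicat_real {x \<in> D. r m x = z})" if "z \<in> r m ` D" for z
      using that by (intro integrable_real_indicator) (auto simp: emeasure_eq_measure)
    then show "integrable \<mu> (\<lambda>x. F z * indicator {x \<in> D. r m x = z} x)" if "z \<in> r m ` D" for z
      using that by (intro integrable_mult_right) auto
    show "(\<Sum>z \<in> r m ` D. \<integral>x. F z * indicator {x \<in> D. r m x = z} x \<partial>\<mu>)
      = (\<Sum>z \<in> r m ` D. F z * measure \<mu> {x \<in> D. r m x = z})"
      using A sets.sets_into_space by (intro sum.cong refl) (simp add: Int_absorb2)
  qed
  finally show ?thesis by (simp add: mult.commute)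
qed

lemma r_point_conv:
  assumes f: "f \<in> H" and x: "x \<in> D" shows "(\<lambda>m. f (r m x)) \<longlonglongrightarrow> f x"
proof -
  let ?q = "\<lambda>m. K (r m x) (r m x) - 2 * K (r m x) x + K x x"
  have bound: "\<bar>f (r m x) - f x\<bar> \<le> sqrt (ip f f * ?q m)" for m
  proof -
    note y = r_in[OF x, of m]
    let ?d = "fun_add D (section_at (r m x)) (fun_scale D (-1) (section_at x))"
    have d: "?d \<in> H" by (intro closed_add closed_scale section_in x y)
    have "ip f ?d = f (r m x) - f x"
      using f x y by (simp add: ip_add_right ip_scale_right closed_scale section_in reproducing)
    moreover have "ip ?d ?d = ip ?d (section_at (r m x)) + (-1) * ip ?d (section_at x)"
      by (simp only: ip_add_right[OF section_in[OF y] closed_scale[OF section_in[OF x]] d]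
          ip_scale_right[OF section_in[OF x] d])
    then have "ip ?d ?d = ?q m"
      using reproducing[OF x d] reproducing[OF y d] x y
      by (simp add: fun_add_def fun_scale_def kernel_sym[OF x y])
    ultimately show ?thesis using cauchy_schwarz[OF f d] by (intro real_le_rsqrt) simp
  qed
  have "(\<lambda>m. sqrt (ip f f * ?q m)) \<longlonglongrightarrow> sqrt (ip f f * (K x x - 2 * K x x + K x x))"
    by (intro tendsto_intros K_conv1 K_conv2 x)
  then have "(\<lambda>m. sqrt (ip f f * ?q m)) \<longlonglongrightarrow> 0" by simp
  then have "(\<lambda>m. f (r m x) - f x) \<longlonglongrightarrow> 0"
    by (rule Lim_null_comparison[rotated]) (use bound in auto)
  then show ?thesis by (simp add: LIM_zero_iff)
qed

lemma value_bound:
  assumes f: "f \<in> H" and x: "x \<in> D" shows "\<bar>f x\<bar> \<le> sqrt (ip f f * B)"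
proof (rule real_le_rsqrt)
  have "(f x)\<^sup>2 \<le> ip f f * K x x"
    using cauchy_schwarz[OF f section_in[OF x]] x f
    by (simp add: reproducing section_in)
  also have "\<dots> \<le> ip f f * B"
    using K_bound[OF x x] by (intro mult_left_mono ip_nonneg f) auto
  finally show "\<bar>f x\<bar>\<^sup>2 \<le> ip f f * B" by simp
qed

lemma H_measurable: "f \<in> H \<Longrightarrow> f \<in> borel_measurable \<mu>"
  by (rule borel_measurable_LIMSEQ_real[where u="\<lambda>m x. f (r m x)"])
     (auto simp: space_D r_point_conv r_measurable)

lemma bounded_integrable:
  assumes "f \<in> borel_measurable \<mu>" "\<And>x. x \<in> D \<Longrightarrow> \<bar>f x :: real\<bar> \<le> C"
  shows "integrable \<mu> f"
  by (rule integrable_const_bound[where B=C]) (use assms space_D in \<open>auto intro!: AE_I2\<close>)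

lemma H_integrable: "f \<in> H \<Longrightarrow> integrable \<mu> f"
  by (rule bounded_integrable[OF H_measurable value_bound])

lemma bounded_convergence:
  fixes u :: "nat \<Rightarrow> 'a \<Rightarrow> real"
  assumes "\<And>m. u m \<in> borel_measurable \<mu>" "\<And>x. x \<in> D \<Longrightarrow> (\<lambda>m. u m x) \<longlonglongrightarrow> v x"
    "\<And>m x. x \<in> D \<Longrightarrow> \<bar>u m x\<bar> \<le> C"
  shows "(\<lambda>m. \<integral>x. u m x \<partial>\<mu>) \<longlonglongrightarrow> (\<integral>x. v x \<partial>\<mu>)"
proof (rule integral_dominated_convergence[where w="\<lambda>_. C"])
  show "v \<in> borel_measurable \<mu>"
    by (rule borel_measurable_LIMSEQ_real[where u=u]) (use assms space_D in auto)
qed (use assms space_D in \<open>auto intro!: AE_I2\<close>)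

lemma kernel_section_integrable: "y \<in> D \<Longrightarrow> integrable \<mu> (\<lambda>x. K x y)"
  using H_integrable[OF section_in, of y]
  by (rule Bochner_Integration.integrable_cong[THEN iffD1, rotated 2]) (auto simp: space_D)

text \<open>
  The functional ``integral minus average'' applied to both arguments of the kernel. The function
  \<open>G\<close> is the result of applying it to one of them.
\<close>

theorem worst_case_error_eq:
  assumes X: "\<And>n. n < N \<Longrightarrow> X n \<in> D"
  defines "G \<equiv> \<lambda>x. (\<integral>y. K y x \<partial>\<mu>) - (1 / real N) * (\<Sum>n<N. K (X n) x)"
  defines "V \<equiv> (\<integral>x. G x \<partial>\<mu>) - (1 / real N) * (\<Sum>n<N. G (X n))"
  shows "0 \<le> V" "(SUP f \<in> {f \<in> H. ip_norm ip f \<le> 1}.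
    \<bar>(\<integral>x. f x \<partial>\<mu>) - (1 / real N) * (\<Sum>n<N. f (X n))\<bar>) = sqrt V"
proof -
  define A where "A m f = (\<integral>x. f (r m x) \<partial>\<mu>) - (1 / real N) * (\<Sum>n<N. f (X n))" for m and f :: "'a \<Rightarrow> real"
  define L where "L f = (\<integral>x. f x \<partial>\<mu>) - (1 / real N) * (\<Sum>n<N. f (X n))" for f :: "'a \<Rightarrow> real"
  have "\<exists>h. represents h (A m)" for m
  proof -
    obtain h1 where 1: "represents h1 (\<lambda>f. \<Sum>z\<in>r m ` D. measure \<mu> {x \<in> D. r m x = z} * f z)"
      using represents_sum[OF r_finite, of m "\<lambda>z. z" "\<lambda>z. measure \<mu> {x \<in> D. r m x = z}"] r_in
      by blast
    obtain h2 where 2: "represents h2 (\<lambda>f. \<Sum>n<N. 1 * f (X n))"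
      using represents_sum[of "{..<N}" X "\<lambda>_. 1"] X by auto
    have "(\<lambda>f. (\<Sum>z\<in>r m ` D. measure \<mu> {x \<in> D. r m x = z} * f z) + (- (1 / real N)) * (\<Sum>n<N. 1 * f (X n)))
        = A m" unfolding A_def r_integral by auto
    with represents_add_scale[OF 1 2, of "- (1 / real N)"] show ?thesis by metis
  qed
  then obtain h where rep: "\<And>m. represents (h m) (A m)" by metis
  have hH: "h m \<in> H" for m using rep by (simp add: represents_def)
  have h_val: "h m x = (\<integral>y. K (r m y) x \<partial>\<mu>) - (1 / real N) * (\<Sum>n<N. K (X n) x)" if "x \<in> D" for m x
  proof -
    have "(\<integral>y. section_at x (r m y) \<partial>\<mu>) = (\<integral>y. K (r m y) x \<partial>\<mu>)"
      by (rule Bochner_Integration.integral_cong) (auto simp: space_D r_in)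
    then show ?thesis using represents_value[OF rep that] X by (simp add: A_def)
  qed
  have h_conv: "(\<lambda>m. h m (q m)) \<longlonglongrightarrow> G x"
    if q: "\<And>m. q m \<in> D" and x: "x \<in> D" and k: "\<And>y. y \<in> D \<Longrightarrow> (\<lambda>m. K (r m y) (q m)) \<longlonglongrightarrow> K y x"
      and k': "\<And>y. y \<in> D \<Longrightarrow> (\<lambda>m. K y (q m)) \<longlonglongrightarrow> K y x" for q x
    unfolding h_val[OF q] G_def
    by (intro tendsto_intros bounded_convergence[where C=B] r_measurable K_bound r_in q k k' X) auto
  have h_bound: "\<bar>h m x\<bar> \<le> 2 * B" if x: "x \<in> D" for m x
  proof -
    have "integrable \<mu> (\<lambda>y. K (r m y) x)"
      by (rule bounded_integrable[where C=B]) (auto intro: r_measurable[of "\<lambda>z. K z x"] K_bound r_in x)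
    then have "\<bar>\<integral>y. K (r m y) x \<partial>\<mu>\<bar> \<le> (\<integral>y. B \<partial>\<mu>)"
      by (intro order_trans[OF integral_abs_bound] integral_mono)
         (auto simp: space_D intro!: K_bound r_in x)
    then have 1: "\<bar>\<integral>y. K (r m y) x \<partial>\<mu>\<bar> \<le> B" by (simp add: space_D mass_D)
    have B: "0 \<le> B" using K_bound[OF x x] by linarith
    have "\<bar>\<Sum>n<N. K (X n) x\<bar> \<le> (\<Sum>n<N. B)"
      by (rule order_trans[OF sum_abs sum_mono]) (auto intro!: K_bound X x)
    then have 2: "\<bar>(1 / real N) * (\<Sum>n<N. K (X n) x)\<bar> \<le> B"
      using B by (cases "N = 0") (auto simp: abs_mult field_simps)
    show ?thesis using 1 2 unfolding h_val[OF x] by linarith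
  qed
  have conv_r: "(\<lambda>m. h m (r m x)) \<longlonglongrightarrow> G x" if x: "x \<in> D" for x
  proof (rule h_conv)
    fix y assume y: "y \<in> D"
    have "K y (r m x) = K (r m x) y" for m by (rule kernel_sym[OF y r_in[OF x]])
    then show "(\<lambda>m. K y (r m x)) \<longlonglongrightarrow> K y x" using K_conv1[OF x y] kernel_sym[OF x y] by simp
  qed (use x in \<open>auto intro: K_conv2 r_in\<close>)
  have conv_c: "(\<lambda>m. h m x) \<longlonglongrightarrow> G x" if x: "x \<in> D" for x
    by (rule h_conv) (use x in \<open>auto intro: K_conv1\<close>)
  have V1: "(\<lambda>m. A m (h m)) \<longlonglongrightarrow> V"
    unfolding A_def V_def
    by (intro tendsto_intros bounded_convergence[where C="2*B"] r_measurable conv_r conv_c X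
        h_bound r_in) auto
  have V2: "(\<lambda>m. L (h m)) \<longlonglongrightarrow> V"
    unfolding L_def V_def
    by (intro tendsto_intros bounded_convergence[where C="2*B"] H_measurable hH conv_c X
        h_bound) auto
  have conv: "(\<lambda>m. A m f) \<longlonglongrightarrow> L f" if f: "f \<in> H" for f
    unfolding A_def L_def
    by (intro tendsto_intros bounded_convergence[where C="sqrt (ip f f * B)"] r_measurable
        r_point_conv value_bound f r_in)
  have hom: "L (fun_scale D c f) = c * L f" if "f \<in> H" for c f
  proof -
    have "(\<integral>x. fun_scale D c f x \<partial>\<mu>) = (\<integral>x. c * f x \<partial>\<mu>)"
      by (rule Bochner_Integration.integral_cong) (auto simp: space_D fun_scale_def)
    moreover have "(\<Sum>n<N. fun_scale D c f (X n)) = c * (\<Sum>n<N. f (X n))"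
      using X by (simp add: fun_scale_def sum_distrib_left)
    ultimately show ?thesis by (simp add: L_def algebra_simps)
  qed
  from dual_norm_eq_limit[OF rep conv V1 V2 hom] show "0 \<le> V" "(SUP f \<in> {f \<in> H. ip_norm ip f \<le> 1}.
    \<bar>(\<integral>x. f x \<partial>\<mu>) - (1 / real N) * (\<Sum>n<N. f (X n))\<bar>) = sqrt V"
    by (simp_all add: L_def)
qed

end

section \<open>The anchored Sobolev kernel\<close>

(* Keeps index sets {1..s} in the form in which they occur in the definitions. *)
declare One_nat_def [simp del]

lemma integral_min_one_minus:
  assumes y: "0 \<le> y" "y \<le> (1::real)"
  shows "(LINT t:{0..1}|lborel. 1 + g * min (1 - t) (1 - y)) = 1 + g * ((1 - y\<^sup>2) / 2)"
proof -
  have "((\<lambda>t. 1 + g * min (1 - t) (1 - y)) has_integral (y + g * ((1 - y) * y)) - (0 + g * ((1 - y) * 0))) {0..y}"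
  proof (rule fundamental_theorem_of_calculus)
    fix t assume t: "t \<in> {0..y}"
    have "((\<lambda>t. t + g * ((1 - y) * t)) has_vector_derivative 1 + g * (1 - y)) (at t within {0..y})"
      unfolding has_real_derivative_iff_has_vector_derivative[symmetric]
      by (auto intro!: derivative_eq_intros)
    then show "((\<lambda>t. t + g * ((1 - y) * t)) has_vector_derivative 1 + g * min (1 - t) (1 - y)) (at t within {0..y})"
      using t by (simp add: min_absorb2)
  qed (use y in auto)
  moreover have "((\<lambda>t. 1 + g * min (1 - t) (1 - y)) has_integral
      (1 + g * (1 - 1\<^sup>2 / 2)) - (y + g * (y - y\<^sup>2 / 2))) {y..1}"
  proof (rule fundamental_theorem_of_calculus)
    fix t assume t: "t \<in> {y..1}"
    have "((\<lambda>t. t + g * (t - t\<^sup>2 / 2)) has_vector_derivative 1 + g * (1 - t)) (at t within {y..1})"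
      unfolding has_real_derivative_iff_has_vector_derivative[symmetric]
      by (auto intro!: derivative_eq_intros)
    then show "((\<lambda>t. t + g * (t - t\<^sup>2 / 2)) has_vector_derivative 1 + g * min (1 - t) (1 - y)) (at t within {y..1})"
      using t by (simp add: min_def)
  qed (use y in auto)
  ultimately have "((\<lambda>t. 1 + g * min (1 - t) (1 - y)) has_integral
      (y + g * ((1 - y) * y)) - (0 + g * ((1 - y) * 0)) +
      ((1 + g * (1 - 1\<^sup>2 / 2)) - (y + g * (y - y\<^sup>2 / 2)))) {0..1}"
    using y by (rule has_integral_combine[rotated 2])
  then have "integral {0..1} (\<lambda>t. 1 + g * min (1 - t) (1 - y)) = 1 + g * ((1 - y\<^sup>2) / 2)"
    by (subst integral_unique) (auto simp: power2_eq_square field_simps)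
  moreover have "set_integrable lborel {0..1} (\<lambda>t. 1 + g * min (1 - t) (1 - y))"
    by (intro borel_integrable_atLeastAtMost' continuous_intros)
  ultimately show ?thesis by (simp add: set_borel_integral_eq_integral)
qed

lemma integral_one_minus_square:
  "(LINT t:{0..1}|lborel. 1 + g * ((1 - t\<^sup>2) / 2)) = 1 + g * (1/3::real)"
proof -
  have "((\<lambda>t::real. 1 + g * ((1 - t\<^sup>2) / 2)) has_integral
      (1 + g * ((1 - 1^3/3) / 2)) - (0 + g * ((0 - 0^3/3) / 2))) {0..1}"
  proof (rule fundamental_theorem_of_calculus)
    fix t :: real
    show "((\<lambda>t. t + g * ((t - t^3/3) / 2)) has_vector_derivative 1 + g * ((1 - t\<^sup>2) / 2)) (at t within {0..1})"
      unfolding has_real_derivative_iff_has_vector_derivative[symmetric]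
      by (auto intro!: derivative_eq_intros)
  qed auto
  then have "integral {0..1} (\<lambda>t::real. 1 + g * ((1 - t\<^sup>2) / 2)) = 1 + g * (1/3)"
    by (subst integral_unique) auto
  moreover have "set_integrable lborel {0..1} (\<lambda>t::real. 1 + g * ((1 - t\<^sup>2) / 2))"
    by (intro borel_integrable_atLeastAtMost' continuous_intros) auto
  ultimately show ?thesis by (simp add: set_borel_integral_eq_integral)
qed

lemma box_in_sets: "A \<in> sets borel \<Longrightarrow> PiE {1..s} (\<lambda>_. A) \<in> sets (lebesgue_dim s)"
  by (intro sets_PiM_I_finite) auto

lemma box_integral_prod:
  fixes g :: "nat \<Rightarrow> real \<Rightarrow> real"
  assumes g: "\<And>j. j \<in> {1..s} \<Longrightarrow> set_integrable lborel A (g j)"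
  shows "set_integrable (lebesgue_dim s) (PiE {1..s} (\<lambda>_. A)) (\<lambda>x. \<Prod>j=1..s. g j (x j))"
    "(LINT x : PiE {1..s} (\<lambda>_. A) | lebesgue_dim s. \<Prod>j=1..s. g j (x j)) =
     (\<Prod>j=1..s. LINT t:A|lborel. g j t)"
proof -
  interpret product_sigma_finite "\<lambda>_::nat. lborel :: real measure" by standard
  (* A point outside the box has a coordinate outside A, since points of the space are extensional. *)
  have eq: "indicator (PiE {1..s} (\<lambda>_. A)) x *\<^sub>R (\<Prod>j=1..s. g j (x j)) =
      (\<Prod>j=1..s. indicator A (x j) *\<^sub>R g j (x j))" if "x \<in> space (lebesgue_dim s)" for x
  proof (cases "x \<in> PiE {1..s} (\<lambda>_. A)")
    case True
    then show ?thesis by (auto simp: PiE_iff intro!: prod.cong)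
  next
    case False
    moreover have "x \<in> extensional {1..s}" using that by (simp add: space_PiM PiE_iff)
    ultimately obtain j where "j \<in> {1..s}" "x j \<notin> A" by (auto simp: PiE_iff)
    then have "(\<Prod>j=1..s. indicator A (x j) *\<^sub>R g j (x j)) = 0"
      by (intro prod_zero) (auto intro!: bexI[of _ j])
    then show ?thesis using False by simp
  qed
  have "integrable (lebesgue_dim s) (\<lambda>x. \<Prod>j=1..s. indicator A (x j) *\<^sub>R g j (x j))"
    by (rule product_integrable_prod) (use g in \<open>auto simp: set_integrable_def\<close>)
  then show "set_integrable (lebesgue_dim s) (PiE {1..s} (\<lambda>_. A)) (\<lambda>x. \<Prod>j=1..s. g j (x j))"
    unfolding set_integrable_def by (subst Bochner_Integration.integrable_cong[OF refl eq])
  have "(\<integral>x. (\<Prod>j=1..s. indicator A (x j) *\<^sub>R g j (x j)) \<partial>lebesgue_dim s) =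
      (\<Prod>j=1..s. \<integral>t. indicator A t *\<^sub>R g j t \<partial>lborel)"
    by (rule product_integral_prod) (use g in \<open>auto simp: set_integrable_def\<close>)
  then show "(LINT x : PiE {1..s} (\<lambda>_. A) | lebesgue_dim s. \<Prod>j=1..s. g j (x j)) =
     (\<Prod>j=1..s. LINT t:A|lborel. g j t)"
    unfolding set_lebesgue_integral_def
    by (subst Bochner_Integration.integral_cong[OF refl eq]) auto
qed

text \<open>
  The factor \<open>min (1 - x) (1 - y)\<close> is the integral over \<open>t\<close> of the product of the indicators of
  \<open>x < t\<close> and \<open>y < t\<close>. Multiplying a positive semidefinite kernel by such a product keeps it positive
  semidefinite, as the indicators can be moved into the coefficients.
\<close>

lemma psd_kernel_mult_min:
  fixes k :: "('a \<Rightarrow> real) \<Rightarrow> ('a \<Rightarrow> real) \<Rightarrow> real"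
  assumes k: "psd_kernel D k" and g: "0 \<le> g" and D: "\<And>x. x \<in> D \<Longrightarrow> x j \<in> {0..1}"
  shows "psd_kernel D (\<lambda>x y. k x y * (1 + g * min (1 - x j) (1 - y j)))"
  unfolding psd_kernel_def
proof (intro conjI ballI allI impI)
  show "k x y * (1 + g * min (1 - x j) (1 - y j)) = k y x * (1 + g * min (1 - y j) (1 - x j))"
    if "x \<in> D" "y \<in> D" for x y
    using k that by (auto simp: psd_kernel_def min.commute)
  fix F and c :: "('a \<Rightarrow> real) \<Rightarrow> real" assume F: "finite F" "F \<subseteq> D"
  have pos: "0 \<le> (\<Sum>x\<in>F. \<Sum>y\<in>F. c x * c y * k x y)" for c using k F by (auto simp: psd_kernel_def)
  define m where "m x y = (\<integral>t. indicator {x j<..1} t * indicator {y j<..1} t \<partial>lborel :: real)" for x y :: "'a \<Rightarrow> real"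
  have int: "integrable lborel (\<lambda>t. indicator {x j<..1} t * indicator {y j<..1} t :: real)" for x y :: "'a \<Rightarrow> real"
    unfolding indicator_inter_arith[symmetric]
    by (intro integrable_real_indicator) (auto intro: le_less_trans[OF emeasure_mono[of _ "{x j..1}"]]
        simp: emeasure_lborel_Icc_eq)
  have m: "m x y = min (1 - x j) (1 - y j)" if "x \<in> F" "y \<in> F" for x y
  proof -
    have "{x j<..1} \<inter> {y j<..1} = {max (x j) (y j)<..1}" by auto
    then have "m x y = measure lborel {max (x j) (y j)<..1}"
      unfolding m_def indicator_inter_arith[symmetric] by simp
    also have "\<dots> = 1 - max (x j) (y j)" using D[of x] D[of y] that F by (subst measure_lborel_Ioc) auto
    finally show ?thesis by (simp add: min_def max_def)
  qed
  have "0 \<le> (\<integral>t. (\<Sum>x\<in>F. \<Sum>y\<in>F. (c x * indicator {x j<..1} t) * (c y * indicator {y j<..1} t) * k x y) \<partial>lborel)"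
    by (intro integral_nonneg_AE AE_I2 pos)
  also have "\<dots> = (\<integral>t. (\<Sum>x\<in>F. \<Sum>y\<in>F. c x * c y * k x y * (indicator {x j<..1} t * indicator {y j<..1} t)) \<partial>lborel)"
    by (simp add: mult_ac)
  also have "\<dots> = (\<Sum>x\<in>F. \<Sum>y\<in>F. c x * c y * k x y * m x y)"
    unfolding m_def
    by (subst Bochner_Integration.integral_sum, use int in force)+ (simp add: int)
  also have "\<dots> = (\<Sum>x\<in>F. \<Sum>y\<in>F. c x * c y * k x y * min (1 - x j) (1 - y j))"
    by (intro sum.cong refl) (simp add: m)
  finally have 1: "0 \<le> g * (\<Sum>x\<in>F. \<Sum>y\<in>F. c x * c y * k x y * min (1 - x j) (1 - y j))"
    using g by simp
  have "(\<Sum>x\<in>F. \<Sum>y\<in>F. c x * c y * (k x y * (1 + g * min (1 - x j) (1 - y j)))) =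
     (\<Sum>x\<in>F. \<Sum>y\<in>F. c x * c y * k x y) +
     g * (\<Sum>x\<in>F. \<Sum>y\<in>F. c x * c y * k x y * min (1 - x j) (1 - y j))"
    by (simp add: sum.distrib sum_distrib_left algebra_simps)
  then show "0 \<le> (\<Sum>x\<in>F. \<Sum>y\<in>F. c x * c y * (k x y * (1 + g * min (1 - x j) (1 - y j))))"
    using 1 pos[of c] by linarith
qed

lemma psd_kernel_one: "psd_kernel D (\<lambda>x y. 1)"
  unfolding psd_kernel_def
proof (intro conjI allI impI ballI)
  fix F and c :: "'a \<Rightarrow> real"
  have "(\<Sum>x\<in>F. \<Sum>y\<in>F. c x * c y * 1) = (\<Sum>x\<in>F. c x) * (\<Sum>x\<in>F. c x)" by (simp add: sum_product)
  then show "0 \<le> (\<Sum>x\<in>F. \<Sum>y\<in>F. c x * c y * 1)" by simp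
qed simp

lemma unit_cubeD: "x \<in> unit_cube s \<Longrightarrow> j \<in> {1..s} \<Longrightarrow> 0 \<le> x j \<and> x j \<le> 1"
  by (auto simp: unit_cube_def PiE_iff)

lemma psd_anchored_sobolev_kernel:
  assumes "\<And>j. 1 \<le> j \<Longrightarrow> 0 < \<gamma> j"
  shows "psd_kernel (unit_cube s) (anchored_sobolev_kernel s \<gamma>)"
proof -
  have "psd_kernel (unit_cube s) (\<lambda>x y. \<Prod>j=1..n. 1 + \<gamma> j * min (1 - x j) (1 - y j))" if "n \<le> s" for n
    using that
  proof (induction n)
    case 0 then show ?case by (simp add: psd_kernel_one)
  next
    case (Suc n)
    have "psd_kernel (unit_cube s) (\<lambda>x y. (\<Prod>j=1..n. 1 + \<gamma> j * min (1 - x j) (1 - y j)) *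
        (1 + \<gamma> (Suc n) * min (1 - x (Suc n)) (1 - y (Suc n))))"
      using Suc assms[of "Suc n"] by (intro psd_kernel_mult_min) (auto dest: unit_cubeD[of _ s "Suc n"])
    then show ?case by simp
  qed
  then show ?thesis unfolding anchored_sobolev_kernel_def by blast
qed

definition grid_point :: "nat \<Rightarrow> nat \<Rightarrow> (nat \<Rightarrow> real) \<Rightarrow> nat \<Rightarrow> real" where
  "grid_point s m x = (\<lambda>j\<in>{1..s}. real_of_int \<lfloor>2 ^ m * x j\<rfloor> / 2 ^ m)"

lemma floor_grid_tendsto: "(\<lambda>m. real_of_int \<lfloor>2 ^ m * x\<rfloor> / 2 ^ m) \<longlonglongrightarrow> (x::real)"
proof (rule LIM_zero_cancel, rule Lim_null_comparison)
  show "(\<lambda>m. (1/2::real) ^ m) \<longlonglongrightarrow> 0" by (intro LIMSEQ_power_zero) simp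
  show "\<forall>\<^sub>F m in sequentially. norm (real_of_int \<lfloor>2 ^ m * x\<rfloor> / 2 ^ m - x) \<le> (1/2) ^ m"
  proof (rule always_eventually, rule allI)
    fix m :: nat
    have "real_of_int \<lfloor>2 ^ m * x\<rfloor> \<le> 2 ^ m * x" "2 ^ m * x < real_of_int \<lfloor>2 ^ m * x\<rfloor> + 1" by linarith+
    then have "\<bar>real_of_int \<lfloor>2 ^ m * x\<rfloor> - 2 ^ m * x\<bar> / 2 ^ m \<le> 1 / 2 ^ m"
      by (intro divide_right_mono) (linarith, simp)
    moreover have "real_of_int \<lfloor>2 ^ m * x\<rfloor> / 2 ^ m - x = (real_of_int \<lfloor>2 ^ m * x\<rfloor> - 2 ^ m * x) / 2 ^ m"
      by (simp add: field_simps)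
    ultimately show "norm (real_of_int \<lfloor>2 ^ m * x\<rfloor> / 2 ^ m - x) \<le> (1/2) ^ m"
      by (simp add: power_one_over)
  qed
qed

lemma grid_point_in:
  assumes "x \<in> unit_cube s" shows "grid_point s m x \<in> unit_cube s"
proof -
  have "0 \<le> real_of_int \<lfloor>2 ^ m * x j\<rfloor> / 2 ^ m \<and> real_of_int \<lfloor>2 ^ m * x j\<rfloor> / 2 ^ m \<le> 1" if "j \<in> {1..s}" for j
  proof -
    have x: "0 \<le> x j" "x j \<le> 1" using unit_cubeD[OF assms that] by auto
    then have "2 ^ m * x j \<le> 2 ^ m * 1" by (intro mult_left_mono) auto
    then have "real_of_int \<lfloor>2 ^ m * x j\<rfloor> \<le> 2 ^ m" by linarith
    then show ?thesis using x by simp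
  qed
  then show ?thesis by (auto simp: grid_point_def unit_cube_def)
qed

lemma grid_point_finite: "finite (grid_point s m ` unit_cube s)"
proof (rule finite_subset)
  show "grid_point s m ` unit_cube s \<subseteq> PiE {1..s} (\<lambda>_. (\<lambda>i. real_of_int i / 2 ^ m) ` {0..2 ^ m})"
  proof (intro subsetI, elim imageE, clarsimp simp: PiE_iff grid_point_def)
    fix x j assume x: "x \<in> unit_cube s" and j: "1 \<le> j" "j \<le> s"
    have x: "0 \<le> x j" "x j \<le> 1" using unit_cubeD[OF x, of j] j by auto
    then have "2 ^ m * x j \<le> 2 ^ m * 1" by (intro mult_left_mono) auto
    then have "real_of_int \<lfloor>2 ^ m * x j\<rfloor> \<le> real_of_int (2 ^ m)"
      using of_int_floor_le[of "2 ^ m * x j"] unfolding of_int_power of_int_numeral by linarith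
    then have up: "\<lfloor>2 ^ m * x j\<rfloor> \<le> 2 ^ m" unfolding of_int_le_iff .
    have lo: "0 \<le> \<lfloor>2 ^ m * x j\<rfloor>" using x by simp
    show "real_of_int \<lfloor>2 ^ m * x j\<rfloor> / 2 ^ m \<in> (\<lambda>i. real_of_int i / 2 ^ m) ` {0..2 ^ m}"
      by (rule imageI) (unfold atLeastAtMost_iff, intro conjI lo up)
  qed
qed (intro finite_PiE finite_imageI, auto)

abbreviation cube_measure :: "nat \<Rightarrow> (nat \<Rightarrow> real) measure" where
  "cube_measure s \<equiv> restrict_space (lebesgue_dim s) (unit_cube s)"

lemma unit_cube_sets: "unit_cube s \<in> sets (lebesgue_dim s)"
  unfolding unit_cube_def by (rule box_in_sets) simp

lemma unit_cube_space: "unit_cube s \<inter> space (lebesgue_dim s) = unit_cube s"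
  using sets.sets_into_space[OF unit_cube_sets] by auto

lemma space_cube_measure: "space (cube_measure s) = unit_cube s"
  by (simp add: space_restrict_space unit_cube_space)

lemma emeasure_cube: "emeasure (cube_measure s) (unit_cube s) = 1"
proof -
  interpret product_sigma_finite "\<lambda>_::nat. lborel :: real measure" by standard
  show ?thesis
    by (subst emeasure_restrict_space) (simp_all add: unit_cube_space unit_cube_sets,
      simp add: unit_cube_def emeasure_PiM)
qed

lemma cube_integral_eq:
  fixes f :: "(nat \<Rightarrow> real) \<Rightarrow> real"
  shows "(\<integral>x. f x \<partial>cube_measure s) = (LINT x : unit_cube s | lebesgue_dim s. f x)"
  unfolding set_lebesgue_integral_def
  by (rule integral_restrict_space) (simp add: unit_cube_space unit_cube_sets)

lemma grid_point_sets:
  assumes "z \<in> unit_cube s"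
  shows "{x \<in> unit_cube s. grid_point s m x = z} \<in> sets (cube_measure s)"
proof -
  have eq: "{x \<in> unit_cube s. grid_point s m x = z} = unit_cube s \<inter>
      {x \<in> space (lebesgue_dim s). \<forall>j\<in>{1..s}. real_of_int \<lfloor>2 ^ m * x j\<rfloor> / 2 ^ m = z j}"
    using assms
    by (auto simp: grid_point_def fun_eq_iff unit_cube_def PiE_iff extensional_def space_PiM)
  have "{x \<in> space (lebesgue_dim s). \<forall>j\<in>{1..s}. real_of_int \<lfloor>2 ^ m * x j\<rfloor> / 2 ^ m = z j} \<in> sets (lebesgue_dim s)"
    by measurable
  then have "{x \<in> unit_cube s. grid_point s m x = z} \<in> sets (lebesgue_dim s)"
    unfolding eq using unit_cube_sets by blast
  then show ?thesis
    by (subst sets_restrict_space_iff) (auto simp: unit_cube_space unit_cube_sets)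
qed

text \<open>
  The three terms are the kernel integrated in both arguments, integrated in one and averaged
  over the points in the other, and averaged in both.
\<close>

definition wce_square :: "nat \<Rightarrow> nat \<Rightarrow> (nat \<Rightarrow> real) \<Rightarrow> (nat \<Rightarrow> nat \<Rightarrow> real) \<Rightarrow> real" where
  "wce_square N s \<gamma> X = (\<Prod>j=1..s. 1 + \<gamma> j * (1/3))
     - 2 / real N * (\<Sum>n<N. \<Prod>j=1..s. 1 + \<gamma> j * ((1 - (X n j)\<^sup>2) / 2))
     + (1 / real N)\<^sup>2 * (\<Sum>n<N. \<Sum>m<N. \<Prod>j=1..s. 1 + \<gamma> j * min (1 - X n j) (1 - X m j))"

theorem worst_case_error_anchored:
  assumes pos: "\<And>j. 1 \<le> j \<Longrightarrow> 0 < \<gamma> j" and X: "\<And>n. n < N \<Longrightarrow> X n \<in> unit_cube s"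
  shows "0 \<le> wce_square N s \<gamma> X"
    "worst_case_error N s X (anchored_sobolev_kernel s \<gamma>) = sqrt (wce_square N s \<gamma> X)"
proof -
  let ?K = "anchored_sobolev_kernel s \<gamma>"
  (* The space chosen in the definition of the error has the required properties because one exists. *)
  define H where "H = rkhs_carrier (unit_cube s) ?K"
  define ip where "ip = snd (rkhs (unit_cube s) ?K)"
  have Hip: "rkhs (unit_cube s) ?K = (H, ip)" by (simp add: H_def ip_def rkhs_carrier_def)
  have factor: "0 \<le> 1 + \<gamma> j * min (1 - x j) (1 - y j) \<and> 1 + \<gamma> j * min (1 - x j) (1 - y j) \<le> 1 + \<gamma> j"
    if "x \<in> unit_cube s" "y \<in> unit_cube s" "j \<in> {1..s}" for x y j
  proof -
    have "0 \<le> min (1 - x j) (1 - y j)" "min (1 - x j) (1 - y j) \<le> 1"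
      using unit_cubeD[OF that(1,3)] unit_cubeD[OF that(2,3)] by auto
    then show ?thesis using pos[of j] that(3)
      mult_left_mono[of "min (1 - x j) (1 - y j)" 1 "\<gamma> j"] by (simp add: add_nonneg_nonneg)
  qed
  interpret finite_measure "cube_measure s"
    by (rule finite_measureI) (simp add: space_cube_measure emeasure_cube)
  interpret sampled_kernel_space "unit_cube s" ?K H ip "cube_measure s" "grid_point s" "\<Prod>j=1..s. 1 + \<gamma> j"
  proof
    show "is_rkhs (unit_cube s) ?K (H, ip)"
      unfolding Hip[symmetric] by (intro is_rkhs_rkhs psd_anchored_sobolev_kernel pos)
    show "space (cube_measure s) = unit_cube s" by (rule space_cube_measure)
    show "measure (cube_measure s) (unit_cube s) = 1" by (simp add: measure_def emeasure_cube)
    show "grid_point s m x \<in> unit_cube s" if "x \<in> unit_cube s" for x m by (rule grid_point_in[OF that])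
    show "finite (grid_point s m ` unit_cube s)" for m by (rule grid_point_finite)
    show "{x \<in> unit_cube s. grid_point s m x = z} \<in> sets (cube_measure s)" if "z \<in> unit_cube s" for z m
      by (rule grid_point_sets[OF that])
    show "\<bar>?K x y\<bar> \<le> (\<Prod>j=1..s. 1 + \<gamma> j)" if "x \<in> unit_cube s" "y \<in> unit_cube s" for x y
    proof -
      have "0 \<le> ?K x y" unfolding anchored_sobolev_kernel_def using factor[OF that] by (intro prod_nonneg) auto
      moreover have "?K x y \<le> (\<Prod>j=1..s. 1 + \<gamma> j)"
        unfolding anchored_sobolev_kernel_def using factor[OF that] by (intro prod_mono) auto
      ultimately show ?thesis by simp
    qed
    have lim: "(\<lambda>m. grid_point s m x j) \<longlonglongrightarrow> x j" if "j \<in> {1..s}" for x j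
      using floor_grid_tendsto[of "x j"] that by (simp add: grid_point_def)
    show "(\<lambda>m. ?K (grid_point s m x) (grid_point s m y)) \<longlonglongrightarrow> ?K x y" for x y
      unfolding anchored_sobolev_kernel_def by (intro tendsto_intros lim) auto
    show "(\<lambda>m. ?K (grid_point s m x) y) \<longlonglongrightarrow> ?K x y" for x y
      unfolding anchored_sobolev_kernel_def by (intro tendsto_intros lim) auto
  qed
  define G where "G x = (\<integral>y. ?K y x \<partial>cube_measure s) - (1 / real N) * (\<Sum>n<N. ?K (X n) x)" for x
  define V where "V = (\<integral>x. G x \<partial>cube_measure s) - (1 / real N) * (\<Sum>n<N. G (X n))"
  let ?q = "\<lambda>x. \<Prod>j=1..s. 1 + \<gamma> j * ((1 - (x j)\<^sup>2) / 2)"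
  let ?c = "\<Prod>j=1..s. 1 + \<gamma> j * (1/3)"
  have Kint: "(\<integral>y. ?K y x \<partial>cube_measure s) = ?q x" if x: "x \<in> unit_cube s" for x
  proof -
    have "(LINT y : PiE {1..s} (\<lambda>_. {0..1}) | lebesgue_dim s. \<Prod>j=1..s. 1 + \<gamma> j * min (1 - y j) (1 - x j)) =
       (\<Prod>j=1..s. LINT t:{0..1}|lborel. 1 + \<gamma> j * min (1 - t) (1 - x j))"
      by (rule box_integral_prod(2)) (intro borel_integrable_atLeastAtMost' continuous_intros)
    also have "\<dots> = ?q x"
      by (intro prod.cong refl integral_min_one_minus) (use unit_cubeD[OF x] in auto)
    finally show ?thesis
      unfolding cube_integral_eq unfolding anchored_sobolev_kernel_def unit_cube_def .
  qed
  have q_sint: "set_integrable lborel {0..1} (\<lambda>t. 1 + \<gamma> j * ((1 - t\<^sup>2) / 2))" for j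
    by (intro borel_integrable_atLeastAtMost' continuous_intros) auto
  have q_int: "integrable (cube_measure s) ?q"
    using box_integral_prod(1)[of s "{0..1}" "\<lambda>j t. 1 + \<gamma> j * ((1 - t\<^sup>2) / 2)"] q_sint
    by (subst integrable_restrict_space)
       (auto simp: unit_cube_space unit_cube_sets unit_cube_def[symmetric] set_integrable_def)
  have q_integral: "(\<integral>x. ?q x \<partial>cube_measure s) = ?c"
    unfolding cube_integral_eq unfolding unit_cube_def
    by (subst box_integral_prod(2)[OF q_sint]) (simp only: integral_one_minus_square)
  have K_int: "integrable (cube_measure s) (\<lambda>x. ?K (X n) x)" if "n < N" for n
    using kernel_section_integrable[OF X[OF that]]
    by (rule Bochner_Integration.integrable_cong[THEN iffD1, rotated 2])
       (auto simp: space_cube_measure intro!: kernel_sym X that)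
  have K_integral: "(\<integral>x. ?K (X n) x \<partial>cube_measure s) = ?q (X n)" if "n < N" for n
    unfolding Kint[OF X[OF that], symmetric]
    by (rule Bochner_Integration.integral_cong)
       (auto simp: space_cube_measure intro!: kernel_sym X that)
  have "(\<integral>x. G x \<partial>cube_measure s) = (\<integral>x. ?q x - (1 / real N) * (\<Sum>n<N. ?K (X n) x) \<partial>cube_measure s)"
    by (rule Bochner_Integration.integral_cong) (auto simp: G_def Kint space_cube_measure)
  also have "\<dots> = ?c - (1 / real N) * (\<Sum>n<N. ?q (X n))"
  proof -
    have sum_int: "integrable (cube_measure s) (\<lambda>x. \<Sum>n<N. ?K (X n) x)"
      by (intro Bochner_Integration.integrable_sum K_int) simp
    have sum_integral: "(\<integral>x. (\<Sum>n<N. ?K (X n) x) \<partial>cube_measure s) = (\<Sum>n<N. ?q (X n))"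
      by (subst Bochner_Integration.integral_sum) (auto simp: K_int K_integral)
    show ?thesis
      by (subst Bochner_Integration.integral_diff[OF q_int integrable_mult_right[OF sum_int]])
         (simp only: q_integral integral_mult_right_zero sum_integral)
  qed
  finally have "V = ?c - (1 / real N) * (\<Sum>n<N. ?q (X n))
      - (1 / real N) * (\<Sum>n<N. ?q (X n) - (1 / real N) * (\<Sum>m<N. ?K (X m) (X n)))"
    unfolding V_def G_def by (simp add: Kint X)
  also have "\<dots> = ?c - 2 / real N * (\<Sum>n<N. ?q (X n))
      + (1 / real N)\<^sup>2 * (\<Sum>n<N. \<Sum>m<N. ?K (X m) (X n))"
    unfolding sum_subtractf sum_distrib_left[symmetric] by (simp add: power2_eq_square diff_divide_distrib)
  also have "(\<Sum>n<N. \<Sum>m<N. ?K (X m) (X n)) = (\<Sum>n<N. \<Sum>m<N. ?K (X n) (X m))"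
    by (rule sum.swap)
  finally have V: "V = wce_square N s \<gamma> X"
    unfolding wce_square_def anchored_sobolev_kernel_def .
  have V': "(\<integral>x. (\<integral>y. ?K y x \<partial>cube_measure s) - 1 / real N * (\<Sum>n<N. ?K (X n) x) \<partial>cube_measure s) -
    1 / real N * (\<Sum>n<N. (\<integral>y. ?K y (X n) \<partial>cube_measure s) - 1 / real N * (\<Sum>na<N. ?K (X na) (X n))) = V"
    unfolding V_def G_def ..
  note E = worst_case_error_eq[of N X, OF X, unfolded V' V]
  show "0 \<le> wce_square N s \<gamma> X" by (rule E(1))
  show "worst_case_error N s X ?K = sqrt (wce_square N s \<gamma> X)"
    using E(2) unfolding worst_case_error_def rkhs_norm_def cube_integral_eq H_def ip_def .
qed

section \<open>Growth of the primes\<close>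

text \<open>
  The reciprocals of the numbers \<open>n * ((n - 1) choose k)\<close> form Leibniz's harmonic triangle, in
  which each entry is a difference of two entries with smaller \<open>k\<close>, starting from \<open>1 / n\<close>. Multiplied
  by the least common multiple of \<open>1, \<dots>, n\<close> they are therefore integers.
\<close>

lemma leibniz_triangle_dvd_Lcm:
  "k < n \<Longrightarrow> n * ((n - 1) choose k) dvd Lcm {1..n::nat}"
proof (induction k arbitrary: n)
  case 0
  then show ?case by (simp add: dvd_Lcm)
next
  case (Suc k)
  define m where "m = n - 2"
  have n: "n = Suc (Suc m)" using Suc.prems by (simp add: m_def)
  define a b c where "a = n * ((n - 1) choose k)" and "b = (n - 1) * ((n - 2) choose k)"
    and "c = n * ((n - 1) choose Suc k)"
  have km: "k \<le> m" using Suc.prems n by simp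
  have "a dvd Lcm {1..n}" unfolding a_def by (rule Suc.IH) (use Suc.prems in simp)
  then obtain y where y: "Lcm {1..n} = a * y" by (rule dvdE)
  have "b dvd Lcm {1..n-1}"
    using Suc.IH[of "n - 1"] Suc.prems n by (simp add: b_def)
  also have "Lcm {1..n-1} dvd Lcm {1..n}" by (rule Lcm_subset) auto
  finally obtain x where x: "Lcm {1..n} = b * x" by (rule dvdE)
  have ab: "a > 0" "b > 0" using km n by (auto simp: a_def b_def)
  have 1: "Suc k * c = n * b"
  proof -
    have "Suc k * c = n * (Suc k * (Suc m choose Suc k))" by (simp only: c_def n diff_Suc_1 mult.left_commute)
    also have "\<dots> = n * b" by (simp only: Suc_times_binomial b_def n diff_Suc_1) simp
    finally show ?thesis .
  qed
  have 2: "(Suc m - k) * a = n * b"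
  proof -
    have "(Suc m - k) * a = n * ((Suc m - k) * (Suc m choose k))" by (simp only: a_def n diff_Suc_1 mult.left_commute)
    also have "\<dots> = n * b" by (simp only: binomial_absorb_comp b_def n diff_Suc_1) simp
    finally show ?thesis .
  qed
  have i1: "int (Suc k) * int c = int n * int b" using 1 by (metis of_nat_mult)
  have i2: "(int n - int (Suc k)) * int a = int n * int b"
  proof -
    have "int (Suc m - k) = int n - int (Suc k)" using km n by simp
    then show ?thesis using 2 by (metis of_nat_mult)
  qed
  have "int (Suc k) * (int c * (int a - int b)) = int n * int b * int a - int b * (int n * int b)"
    using arg_cong[OF i1, of "\<lambda>t. t * (int a - int b)"] by (simp add: algebra_simps del: of_nat_Suc)
  also have "\<dots> = int (Suc k) * (int a * int b)"
    using arg_cong[OF i2, of "\<lambda>t. t * int b"] by (simp add: algebra_simps del: of_nat_Suc)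
  finally have c: "int c * (int a - int b) = int a * int b" by simp
  have "int a * int b * (int c * (int x - int y)) = int c * (int a * int (b * x) - int b * int (a * y))"
    by (simp add: algebra_simps)
  also have "\<dots> = int (Lcm {1..n}) * (int c * (int a - int b))"
    unfolding x[symmetric] y[symmetric] by (simp add: algebra_simps)
  also have "\<dots> = int a * int b * int (Lcm {1..n})" by (simp add: c)
  finally have "int c * (int x - int y) = int (Lcm {1..n})" using ab by simp
  from dvdI[OF this[symmetric]] have "int c dvd int (Lcm {1..n})" .
  then show ?case unfolding c_def of_nat_dvd_iff .
qed

text \<open>
  Sum the divisibility above over a row of the triangle.
\<close>

lemma Lcm_upto_ge: assumes "n \<ge> 1" shows "2 ^ (n - 1) \<le> Lcm {1..n::nat}"
proof -
  have pos: "Lcm {1..n} > 0" by (intro Nat.gr0I) (simp add: Lcm_0_iff)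
  have "n * 2 ^ (n - 1) = (\<Sum>k\<le>n - 1. n * ((n - 1) choose k))"
    by (simp add: choose_row_sum sum_distrib_left[symmetric])
  also have "\<dots> \<le> (\<Sum>k\<le>n - 1. Lcm {1..n})"
    by (intro sum_mono dvd_imp_le pos leibniz_triangle_dvd_Lcm) (use assms in auto)
  also have "\<dots> = n * Lcm {1..n}" using assms by simp
  finally show ?thesis using assms by simp
qed

text \<open>
  The power of a prime in the least common multiple is at most \<open>n\<close>, as it divides one of
  \<open>1, \<dots>, n\<close>.
\<close>

lemma Lcm_upto_le: assumes "n \<ge> 1" shows "Lcm {1..n} \<le> n ^ card {p. prime p \<and> p \<le> (n::nat)}"
proof -
  let ?P = "{p. prime p \<and> p \<le> n}"
  have fin: "finite ?P" by (rule finite_subset[of _ "{..n}"]) auto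
  (* The exponent of p in the least common multiple; it is bounded by n because k < 2 ^ k. *)
  define e where "e p = (GREATEST e. p ^ e \<le> n)" for p
  have bound: "k \<le> n" if "p ^ k \<le> n" "prime p" for p k
  proof -
    have "k < 2 ^ k" by (rule less_exp)
    also have "(2::nat) ^ k \<le> p ^ k" by (rule power_mono[OF prime_ge_2_nat[OF that(2)]]) simp
    finally show ?thesis using that(1) by linarith
  qed
  have e1: "p ^ e p \<le> n" if "prime p" for p
    unfolding e_def by (rule GreatestI_nat[of _ 0 n]) (use assms bound that in auto)
  have e2: "k \<le> e p" if "prime p" "p ^ k \<le> n" for p k
    unfolding e_def by (rule Greatest_le_nat[of _ _ n]) (use bound that in auto)
  have "Lcm {1..n} dvd (\<Prod>p\<in>?P. p ^ e p)"
  proof (rule Lcm_least)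
    fix m assume m: "m \<in> {1..n}"
    have mp: "m > 0" using m by auto
    have "m = (\<Prod>p\<in>prime_factors m. p ^ multiplicity p m)"
      using prime_factorization_nat[OF mp] .
    also have "\<dots> dvd (\<Prod>p\<in>?P. p ^ e p)"
    proof (rule prod_dvd_prod_subset2[OF fin])
      show "prime_factors m \<subseteq> ?P" using m mp by (auto dest: dvd_imp_le simp: prime_factors_dvd)
      fix p assume p: "p \<in> prime_factors m"
      have "p ^ multiplicity p m \<le> m" using mp by (intro dvd_imp_le multiplicity_dvd)
      then have "multiplicity p m \<le> e p" using p m by (intro e2) auto
      then show "p ^ multiplicity p m dvd p ^ e p" by (rule le_imp_power_dvd)
    qed
    finally show "m dvd (\<Prod>p\<in>?P. p ^ e p)" .
  qed
  then have "Lcm {1..n} \<le> (\<Prod>p\<in>?P. p ^ e p)"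
    by (rule dvd_imp_le) (auto intro!: prod_pos dest: prime_gt_0_nat)
  also have "\<dots> \<le> (\<Prod>p\<in>?P. n)" by (intro prod_mono) (auto intro: e1)
  finally show ?thesis by simp
qed

lemma nth_prime_prime: "prime (nth_prime j)"
  unfolding nth_prime_def using enumerate_in_set[OF primes_infinite] by simp

lemma nth_prime_inj: assumes "1 \<le> i" "1 \<le> j" "nth_prime i = nth_prime j" shows "i = j"
  using assms strict_mono_eq[OF strict_mono_enumerate[OF primes_infinite]]
  unfolding nth_prime_def by auto

lemma card_primes_le_nth_prime:
  assumes "1 \<le> j" shows "card {p. prime p \<and> p \<le> nth_prime j} \<le> j"
proof -
  let ?S = "{q::nat. prime q}"
  have "{p. prime p \<and> p \<le> nth_prime j} \<subseteq> enumerate ?S ` {..<j}"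
  proof
    fix p assume p: "p \<in> {p. prime p \<and> p \<le> nth_prime j}"
    then obtain i where i: "enumerate ?S i = p" using enumerate_Ex[of ?S p] primes_infinite by blast
    have "i \<le> j - 1"
      using p i strict_mono_less_eq[OF strict_mono_enumerate[OF primes_infinite], of i "j - 1"]
      unfolding nth_prime_def by auto
    then show "p \<in> enumerate ?S ` {..<j}" using i assms by (intro image_eqI[of _ _ i]) auto
  qed
  then have "card {p. prime p \<and> p \<le> nth_prime j} \<le> card (enumerate ?S ` {..<j})"
    by (intro card_mono) auto
  also have "\<dots> \<le> j" using card_image_le[of "{..<j}" "enumerate ?S"] by simp
  finally show ?thesis .
qed

text \<open>
  The two bounds on the least common multiple of \<open>1, \<dots>, p\<^sub>j\<close> give
  \<open>(p\<^sub>j - 1) ln 2 \<le> j ln p\<^sub>j\<close>, and the logarithm costs an arbitrarily small power.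
\<close>

lemma nth_prime_powr_le:
  assumes \<delta>: "0 < \<delta>" and j: "1 \<le> j"
  shows "real (nth_prime j) powr (1 - \<delta>) \<le> 2 / (\<delta> * ln 2) * real j"
proof -
  define n where "n = nth_prime j"
  have n2: "n \<ge> 2" using prime_ge_2_nat[OF nth_prime_prime[of j]] by (simp add: n_def)
  have "(2::nat) ^ (n - 1) \<le> Lcm {1..n}" by (rule Lcm_upto_ge) (use n2 in simp)
  also have "\<dots> \<le> n ^ card {p. prime p \<and> p \<le> n}" by (rule Lcm_upto_le) (use n2 in simp)
  also have "\<dots> \<le> n ^ j"
    using n2 card_primes_le_nth_prime[OF j] by (intro power_increasing) (auto simp: n_def)
  finally have "real (2 ^ (n - 1)) \<le> real (n ^ j)" by (simp only: of_nat_le_iff)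
  then have "ln (real (2 ^ (n - 1))) \<le> ln (real (n ^ j))" using n2 by (subst ln_le_cancel_iff) auto
  then have 1: "real (n - 1) * ln 2 \<le> real j * ln (real n)" using n2 by (simp add: ln_realpow)
  have "real n * ln 2 \<le> 2 * (real (n - 1) * ln 2)" using n2 by simp
  also have "\<dots> \<le> 2 * (real j * ln (real n))" using 1 by simp
  also have "\<dots> \<le> 2 * (real j * (real n powr \<delta> / \<delta>))"
    using ln_powr_bound[of "real n" \<delta>] n2 \<delta> by (intro mult_left_mono) auto
  finally have "real n * ln 2 \<le> 2 * real j * real n powr \<delta> / \<delta>" by simp
  then have "real n * ln 2 * real n powr (- \<delta>) \<le> 2 * real j * real n powr \<delta> / \<delta> * real n powr (- \<delta>)"
    by (intro mult_right_mono) auto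
  also have "\<dots> = 2 * real j / \<delta>" using n2 by (simp add: powr_minus field_simps)
  finally have "real n powr (1 - \<delta>) * ln 2 \<le> 2 * real j / \<delta>"
    using n2 by (simp add: powr_diff powr_minus divide_inverse mult_ac)
  then show ?thesis using \<delta> by (simp add: n_def field_simps)
qed

section \<open>Shell kernels\<close>

text \<open>
  The mean of the kernel \<open>min (1 - x) (1 - y)\<close>, minus its overall mean \<open>1/3\<close>, over pairs of
  points whose leading base \<open>p\<close> digits differ by \<open>a\<close> modulo \<open>p\<close> and which are otherwise uniformly
  distributed and independent.
\<close>

definition digit_coeff :: "nat \<Rightarrow> int \<Rightarrow> real" where
  "digit_coeff p a = 1/6 - of_int (a * (int p - a)) / (real p)\<^sup>2 - (if a = 0 then 1 / (6 * real p) else 0)"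

text \<open>
  The part of the mean kernel at distance \<open>d\<close> that is resolved by the \<open>g\<close>-th digit: the average
  over the residue class of \<open>d\<close> modulo \<open>p\<^sup>g\<close> minus the average over its class modulo \<open>p\<^sup>g\<^sup>-\<^sup>1\<close>.
\<close>

definition shell :: "nat \<Rightarrow> nat \<Rightarrow> int \<Rightarrow> real" where
  "shell p g d = (if int p ^ (g - 1) dvd d
     then digit_coeff p (d div int p ^ (g - 1) mod int p) / real p ^ (g - 1) else 0)"

lemma sum_digit_products: "6 * (\<Sum>a<p. real a * (real p - real a)) = real p * ((real p)\<^sup>2 - 1)"
proof -
  have 1: "2 * (\<Sum>a<p. real a) = real p * (real p - 1)"
    by (induction p) (auto simp: algebra_simps)
  have 2: "6 * (\<Sum>a<p. (real a)\<^sup>2) = real p * (real p - 1) * (2 * real p - 1)"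
    by (induction p) (auto simp: power2_eq_square algebra_simps)
  have "(\<Sum>a<p. real a * (real p - real a)) = real p * (\<Sum>a<p. real a) - (\<Sum>a<p. (real a)\<^sup>2)"
    by (simp add: sum_subtractf sum_distrib_left power2_eq_square algebra_simps)
  then have "6 * (\<Sum>a<p. real a * (real p - real a)) = 3 * real p * (2 * (\<Sum>a<p. real a)) - 6 * (\<Sum>a<p. (real a)\<^sup>2)"
    by simp
  also have "\<dots> = real p * ((real p)\<^sup>2 - 1)" unfolding 1 2 by (simp add: power2_eq_square algebra_simps)
  finally show ?thesis .
qed

lemma sum_digit_coeff: assumes "p \<ge> 2" shows "(\<Sum>a<p. digit_coeff p (int a)) = 0"
proof -
  have "(\<Sum>a<p. digit_coeff p (int a)) = real p / 6 - (\<Sum>a<p. real a * (real p - real a)) / (real p)\<^sup>2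
      - (\<Sum>a<p. if a = 0 then 1 / (6 * real p) else 0)"
    by (simp add: digit_coeff_def sum_subtractf sum_divide_distrib)
  also have "(\<Sum>a<p. if a = 0 then 1 / (6 * real p) else 0) = 1 / (6 * real p)"
    using assms by (simp add: sum.delta)
  also have "(\<Sum>a<p. real a * (real p - real a)) = real p * ((real p)\<^sup>2 - 1) / 6"
    using sum_digit_products[of p] by simp
  finally show ?thesis using assms by (simp add: field_simps power2_eq_square)
qed

lemma digit_coeff_abs_le: assumes "p \<ge> 2" "0 \<le> a" "a < int p" shows "\<bar>digit_coeff p a\<bar> \<le> 1"
proof -
  have "0 \<le> a * (int p - a)" "a * (int p - a) \<le> int p * int p"
    using assms by (auto intro!: mult_mono)
  then have "0 \<le> real_of_int (a * (int p - a))" "real_of_int (a * (int p - a)) \<le> real_of_int (int p * int p)"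
    by (simp_all only: of_int_0_le_iff of_int_le_iff)
  then have "0 \<le> real_of_int (a * (int p - a)) / (real p)\<^sup>2" "real_of_int (a * (int p - a)) / (real p)\<^sup>2 \<le> 1"
    using assms by (auto simp: power2_eq_square)
  moreover have "1 / (6 * real p) \<le> 1/6" "0 \<le> 1 / (6 * real p)" using assms by (auto simp: field_simps)
  moreover have "a = 0 \<Longrightarrow> digit_coeff p a = 1/6 - 1 / (6 * real p)"
    "a \<noteq> 0 \<Longrightarrow> digit_coeff p a = 1/6 - real_of_int (a * (int p - a)) / (real p)\<^sup>2"
    by (simp_all add: digit_coeff_def)
  ultimately show ?thesis unfolding abs_le_iff by (cases "a = 0") linarith+
qed

lemma shell_periodic:
  assumes "p \<ge> 2" "g \<ge> 1" "int p ^ g dvd k" shows "shell p g (d + k) = shell p g d"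
proof -
  obtain q where q: "k = int p ^ (g - 1) * (int p * q)"
    using assms by (metis dvdE mult.assoc power_Suc2 Suc_diff_1 One_nat_def Suc_le_eq)
  have "int p ^ (g - 1) dvd d + k \<longleftrightarrow> int p ^ (g - 1) dvd d" unfolding q by (intro dvd_add_left_iff dvd_triv_left)
  moreover have "(d + k) div int p ^ (g - 1) mod int p = d div int p ^ (g - 1) mod int p"
    unfolding q using assms by simp
  ultimately show ?thesis by (simp add: shell_def)
qed

lemma shell_abs_le:
  assumes "p \<ge> 2" shows "\<bar>shell p g d\<bar> \<le> (if int p ^ (g - 1) dvd d then 1 / real p ^ (g - 1) else 0)"
  using digit_coeff_abs_le[OF assms, of "d div int p ^ (g - 1) mod int p"] assms
  by (auto simp: shell_def divide_right_mono)

text \<open>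
  Along such a progression the \<open>g\<close>-th digit takes every value exactly once. The factor \<open>t\<close> is
  there because the steps come from moduli of other primes as well.
\<close>

lemma shell_sum_zero:
  assumes p: "p \<ge> 2" and t: "coprime t (int p)"
  shows "(\<Sum>i<p. shell p g (e + int p ^ (g - 1) * t * int i)) = 0"
proof (cases "int p ^ (g - 1) dvd e")
  case False
  then have "\<not> int p ^ (g - 1) dvd e + int p ^ (g - 1) * t * int i" for i
    by (simp add: dvd_add_left_iff mult.assoc)
  then show ?thesis by (simp add: shell_def)
next
  case True
  then obtain f where f: "e = int p ^ (g - 1) * f" by (rule dvdE)
  have eq: "e + int p ^ (g - 1) * t * int i = int p ^ (g - 1) * (f + t * int i)" for i
    by (simp add: f algebra_simps)
  have "(\<Sum>i<p. shell p g (e + int p ^ (g - 1) * t * int i)) =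
      (\<Sum>i<p. digit_coeff p ((f + t * int i) mod int p)) / real p ^ (g - 1)"
    unfolding eq using p by (simp add: shell_def sum_divide_distrib)
  also have "(\<Sum>i<p. digit_coeff p ((f + t * int i) mod int p)) = (\<Sum>a<p. digit_coeff p (int a))"
  proof -
    define h where "h i = nat ((f + t * int i) mod int p)" for i :: nat
    have hp: "int (h i) = (f + t * int i) mod int p" for i using p by (simp add: h_def)
    have inj: "inj_on h {..<p}"
    proof (rule inj_onI)
      fix i j assume ij: "i \<in> {..<p}" "j \<in> {..<p}" "h i = h j"
      have "(f + t * int i) mod int p = (f + t * int j) mod int p" using ij(3) hp by metis
      then have "int p dvd t * (int i - int j)"
        by (metis add_diff_cancel_left mod_eq_dvd_iff right_diff_distrib)
      then have "int p dvd int i - int j"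
        using t by (simp add: coprime_dvd_mult_right_iff coprime_commute)
      then show "i = j" using ij
        by (metis lessThan_iff mod_eq_dvd_iff mod_less of_nat_eq_iff of_nat_mod)
    qed
    moreover have sub: "h ` {..<p} \<subseteq> {..<p}"
    proof clarify
      fix i have "int (h i) < int p" unfolding hp using p by simp
      then show "h i < p" by simp
    qed
    ultimately have "h ` {..<p} = {..<p}" by (intro card_subset_eq) (auto simp: card_image)
    then have "(\<Sum>a<p. digit_coeff p (int a)) = (\<Sum>i<p. digit_coeff p (int (h i)))"
      using sum.reindex[OF inj, of "\<lambda>a. digit_coeff p (int a)"] by simp
    then show ?thesis by (simp add: hp)
  qed
  finally show ?thesis using sum_digit_coeff[OF p] by simp
qed

lemma sum_lessThan_mult:
  fixes f :: "nat \<Rightarrow> real"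
  shows "(\<Sum>d<M * q. f d) = (\<Sum>e<M. \<Sum>i<q. f (e + M * i))"
proof -
  have "(\<Sum>d<M * q. f d) = (\<Sum>i<q. \<Sum>d\<in>{i * M..<i * M + M}. f d)"
    using sum.nat_group[of f M q] by (simp add: mult.commute)
  also have "\<dots> = (\<Sum>i<q. \<Sum>e<M. f (e + M * i))"
  proof (rule sum.cong[OF refl])
    fix i
    show "(\<Sum>d\<in>{i * M..<i * M + M}. f d) = (\<Sum>e<M. f (e + M * i))"
      using sum.shift_bounds_nat_ivl[of f 0 "i * M" M]
      by (simp add: atLeast0LessThan add.commute mult.commute)
  qed
  finally show ?thesis by (simp add: sum.swap[of _ "{..<q}"])
qed

section \<open>Correlations of shell kernels\<close>

lemma prod_dvd_if_pairwise_coprime: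
  fixes a :: "'i \<Rightarrow> int"
  assumes "finite u" "\<And>i j. i \<in> u \<Longrightarrow> j \<in> u \<Longrightarrow> i \<noteq> j \<Longrightarrow> coprime (a i) (a j)"
    "\<And>j. j \<in> u \<Longrightarrow> a j dvd d"
  shows "(\<Prod>j\<in>u. a j) dvd d"
  using assms
proof (induction u)
  case (insert i u)
  have "coprime (a i) (\<Prod>j\<in>u. a j)"
    using insert.hyps insert.prems(1) by (intro prod_coprime_right) auto
  then show ?case using insert by (simp add: divides_mult)
qed simp

text \<open>
  Only one factor has to be summed: moving in steps of \<open>P / p\<^sub>j\<^sub>0\<close> leaves the other factors
  unchanged by their periodicity, while the factor of \<open>j0\<close> runs through a complete set of digits.
\<close>

lemma prod_periodic_sum_zero:
  fixes p g :: "'i \<Rightarrow> nat" and m :: int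
  assumes u: "finite u" "j0 \<in> u" and p: "\<And>j. j \<in> u \<Longrightarrow> prime (p j)" and inj: "inj_on p u"
    and g: "\<And>j. j \<in> u \<Longrightarrow> g j \<ge> 1"
  shows "(\<Sum>d<(\<Prod>j\<in>u. p j ^ g j). \<Prod>j\<in>u. shell (p j) (g j) (m + int d)) = 0"
proof -
  let ?v = "u - {j0}"
  (* The step M is the period P divided by one factor p j0. *)
  define t where "t = (\<Prod>j\<in>?v. p j ^ g j)"
  define M where "M = p j0 ^ (g j0 - 1) * t"
  have p2: "p j \<ge> 2" if "j \<in> u" for j using prime_ge_2_nat p that by blast
  have cop: "coprime t (p j0)"
    unfolding t_def
  proof (rule prod_coprime_left)
    fix j assume j: "j \<in> ?v"
    have "p j \<noteq> p j0" using inj j u by (auto simp: inj_on_def)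
    then have "coprime (p j) (p j0)" using p[of j] p[of j0] j u by (auto intro: primes_coprime)
    then show "coprime (p j ^ g j) (p j0)" by simp
  qed
  have P: "(\<Prod>j\<in>u. p j ^ g j) = M * p j0"
    using u g[of j0] unfolding M_def t_def
    by (subst prod.remove[OF u]) (simp add: power_eq_if mult_ac)
  have inner: "(\<Sum>i<p j0. \<Prod>j\<in>u. shell (p j) (g j) (m + int (e + M * i))) = 0" for e
  proof -
    have "(\<Prod>j\<in>u. shell (p j) (g j) (m + int (e + M * i))) =
       shell (p j0) (g j0) ((m + int e) + int (p j0) ^ (g j0 - 1) * int t * int i) *
       (\<Prod>j\<in>?v. shell (p j) (g j) (m + int e))" for i
    proof -
      have "(\<Prod>j\<in>?v. shell (p j) (g j) (m + int (e + M * i))) = (\<Prod>j\<in>?v. shell (p j) (g j) (m + int e))"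
      proof (rule prod.cong[OF refl])
        fix j assume j: "j \<in> ?v"
        have "p j ^ g j dvd t" unfolding t_def by (rule dvd_prodI) (use u j in auto)
        then have "int (p j) ^ g j dvd int t" by (metis of_nat_dvd_iff of_nat_power)
        then have "int (p j) ^ g j dvd int (M * i)" unfolding M_def by simp
        from shell_periodic[OF p2 g this, of "m + int e"] j
        show "shell (p j) (g j) (m + int (e + M * i)) = shell (p j) (g j) (m + int e)"
          by (simp add: add.assoc)
      qed
      then show ?thesis by (subst prod.remove[OF u]) (simp add: M_def add.assoc)
    qed
    then have "(\<Sum>i<p j0. \<Prod>j\<in>u. shell (p j) (g j) (m + int (e + M * i))) =
      (\<Sum>i<p j0. shell (p j0) (g j0) ((m + int e) + int (p j0) ^ (g j0 - 1) * int t * int i)) *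
       (\<Prod>j\<in>?v. shell (p j) (g j) (m + int e))" by (simp add: sum_distrib_right)
    then show ?thesis using shell_sum_zero[OF p2[OF u(2)], of "int t"] cop by simp
  qed
  show ?thesis unfolding P by (subst sum_lessThan_mult) (simp only: inner sum.neutral_const)
qed

lemma full_period_sums_vanish:
  fixes W :: "int \<Rightarrow> real"
  assumes per: "\<And>d. W (d + int P) = W d" and zero: "\<And>m. (\<Sum>d<P. W (m + int d)) = 0"
  shows "(\<Sum>n<N. W (m + int n)) = (\<Sum>n<N mod P. W (m + int n))"
proof -
  have perk: "W (d + int P * int k) = W d" for d k
    by (induction k) (simp_all add: per algebra_simps, metis per add.assoc add.commute)
  have "(\<Sum>n<P * q + r. W (m + int n)) = (\<Sum>n<r. W (m + int n))" for q r
  proof (induction r)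
    case 0
    have "(\<Sum>n<P * q. W (m + int n)) = (\<Sum>e<P. \<Sum>i<q. W (m + int e + int P * int i))"
      by (subst sum_lessThan_mult) (simp add: add.assoc)
    also have "\<dots> = (\<Sum>e<P. real q * W (m + int e))" by (simp add: perk)
    also have "\<dots> = 0" by (simp add: sum_distrib_left[symmetric] zero)
    finally show ?case by simp
  next
    case (Suc r)
    have "W (m + int (P * q + r)) = W (m + int r)"
      using perk[of "m + int r" q] by (simp add: algebra_simps)
    then show ?case using Suc by simp
  qed
  from this[of "N div P" "N mod P"] show ?thesis by simp
qed

text \<open>
  The cancellation of complete periods, once in each variable.
\<close>

lemma double_sum_reduce:
  fixes W :: "int \<Rightarrow> real"
  assumes per: "\<And>d. W (d + int P) = W d" and zero: "\<And>m. (\<Sum>d<P. W (m + int d)) = 0"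
  shows "(\<Sum>n<N. \<Sum>m<N. W (int n - int m)) = (\<Sum>n<N mod P. \<Sum>m<N mod P. W (int n - int m))"
proof -
  have 1: "(\<Sum>n<N. W (int n - m)) = (\<Sum>n<N mod P. W (int n - m))" for m
    using full_period_sums_vanish[of W P "- m" N, OF per zero] by (simp add: add.commute)
  (* Reflection turns sums over the second index into sums over consecutive integers. *)
  define W' where "W' d = W (- d)" for d
  have per': "W' (d + int P) = W' d" for d using per[of "- d - int P"] by (simp add: W'_def)
  have zero': "(\<Sum>d<P. W' (m + int d)) = 0" for m
  proof -
    have "(\<Sum>d<P. W' (m + int d)) = (\<Sum>d<P. W' (m + int (P - Suc d)))"
      by (rule sum.nat_diff_reindex[symmetric])
    also have "\<dots> = (\<Sum>d<P. W ((- m - int P + 1) + int d))"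
      by (rule sum.cong) (auto simp: W'_def of_nat_diff algebra_simps)
    finally show ?thesis by (simp only: zero)
  qed
  have 2: "(\<Sum>m<N. W (int n - int m)) = (\<Sum>m<N mod P. W (int n - int m))" for n
    using full_period_sums_vanish[of W' P "- int n" N, OF per' zero'] by (simp add: W'_def)
  have "(\<Sum>n<N. \<Sum>m<N. W (int n - int m)) = (\<Sum>n<N. \<Sum>m<N mod P. W (int n - int m))"
    by (simp only: 2)
  also have "\<dots> = (\<Sum>m<N mod P. \<Sum>n<N. W (int n - int m))" by (rule sum.swap)
  also have "\<dots> = (\<Sum>m<N mod P. \<Sum>n<N mod P. W (int n - int m))" by (simp only: 1)
  also have "\<dots> = (\<Sum>n<N mod P. \<Sum>m<N mod P. W (int n - int m))" by (rule sum.swap)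
  finally show ?thesis .
qed

text \<open>
  Members of one residue class are told apart by their quotients.
\<close>

lemma card_residue_class_le:
  assumes "Q \<ge> 1"
  shows "card {m. m < r \<and> int Q dvd n - int m} \<le> (r - 1) div Q + 1"
proof -
  let ?S = "{m. m < r \<and> int Q dvd n - int m}"
  have "inj_on (\<lambda>m. m div Q) ?S"
  proof (rule inj_onI)
    fix a b assume a: "a \<in> ?S" and b: "b \<in> ?S" and eq: "a div Q = b div Q"
    have "int Q dvd (n - int b) - (n - int a)" using a b by (intro dvd_diff[of "int Q" "n - int b" "n - int a"]) simp_all
    then have "int a mod int Q = int b mod int Q" by (simp add: mod_eq_dvd_iff)
    then have "a mod Q = b mod Q" by (simp flip: of_nat_mod)
    then show "a = b" using eq by (metis div_mult_mod_eq)
  qed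
  moreover have "(\<lambda>m. m div Q) ` ?S \<subseteq> {..(r - 1) div Q}"
    by (auto intro!: div_le_mono)
  ultimately have "card ?S \<le> card {..(r - 1) div Q}"
    by (rule card_inj_on_le) auto
  then show ?thesis by simp
qed

text \<open>
  For \<open>r \<le> Q\<close> only the diagonal contributes. Otherwise each of the \<open>r\<close> rows has at most
  \<open>r / Q + 1 \<le> 2 r / Q\<close> entries, each of size \<open>1 / Q\<close>.
\<close>

lemma double_sum_sparse_le:
  fixes W :: "int \<Rightarrow> real"
  assumes Q: "Q \<ge> 1" and W: "\<And>d. \<bar>W d\<bar> \<le> (if int Q dvd d then 1 / real Q else 0)"
  shows "\<bar>\<Sum>n<r. \<Sum>m<r. W (int n - int m)\<bar> \<le>
    (if r \<le> Q then real r / real Q else 2 * (real r / real Q)\<^sup>2)"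
proof -
  let ?k = "(r - 1) div Q + 1"
  have "\<bar>\<Sum>n<r. \<Sum>m<r. W (int n - int m)\<bar> \<le> (\<Sum>n<r. \<Sum>m<r. \<bar>W (int n - int m)\<bar>)"
    by (intro order_trans[OF sum_abs] sum_mono) auto
  also have "\<dots> \<le> (\<Sum>n<r. \<Sum>m<r. if int Q dvd int n - int m then 1 / real Q else 0)"
    by (intro sum_mono W)
  also have "\<dots> = (\<Sum>n<r. real (card {m. m < r \<and> int Q dvd int n - int m}) / real Q)"
    by (simp add: sum.If_cases Int_def)
  also have "\<dots> \<le> (\<Sum>n<r. real ?k / real Q)"
    by (intro sum_mono divide_right_mono) (use card_residue_class_le[OF Q] in \<open>auto simp only: of_nat_le_iff of_nat_0_le_iff\<close>)
  also have "\<dots> = real r / real Q * real ?k" by simp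
  finally have le: "\<bar>\<Sum>n<r. \<Sum>m<r. W (int n - int m)\<bar> \<le> real r / real Q * real ?k" .
  show ?thesis
  proof (cases "r \<le> Q")
    case True
    then have "(r - 1) div Q = 0" using Q by (cases r) auto
    then show ?thesis using le True by simp
  next
    case False
    have "(r - 1) div Q \<le> r div Q" by (rule div_le_mono) simp
    then have "real ?k \<le> real r / real Q + 1"
      using of_nat_div_le_of_nat[of r Q, where 'a=real] by (simp only: of_nat_add of_nat_1 flip: of_nat_le_iff[where 'a=real])
    also have "\<dots> \<le> 2 * (real r / real Q)" using False Q by (simp add: field_simps)
    finally have "real r / real Q * real ?k \<le> real r / real Q * (2 * (real r / real Q))"
      by (intro mult_left_mono) auto
    also have "real r / real Q * (2 * (real r / real Q)) = 2 * (real r / real Q)\<^sup>2"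
      by (simp add: power2_eq_square)
    finally show ?thesis using le False by simp
  qed
qed

text \<open>
  Trades part of the trivial bound for decay in the period \<open>P = Q * R\<close>. For \<open>r > Q\<close> it uses \<open>r \<le> P\<close>
  to the power \<open>2 - \<theta>\<close> and \<open>r \<le> N\<close> only to the power \<open>\<theta>\<close>, which is what makes the sum over all periods
  converge.
\<close>

lemma power_saving:
  fixes \<theta> :: real
  assumes \<theta>: "0 < \<theta>" "\<theta> \<le> 1" and Q: "Q \<ge> 1" and R: "R \<ge> 1"
    and r: "r \<le> N" "r \<le> Q * R"
  shows "(if r \<le> Q then real r / real Q else 2 * (real r / real Q)\<^sup>2)
    \<le> 2 * real N powr \<theta> * (real R)\<^sup>2 * real (Q * R) powr (- \<theta>)"
proof (cases "r = 0")
  case True then show ?thesis by simp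
next
  case False
  then have pos: "real r > 0" "real Q > 0" "real R > 0" "real R \<ge> 1" "real N > 0" using Q R r by auto
  have rN: "real r powr \<theta> \<le> real N powr \<theta>" using r \<theta> by (intro powr_mono2) auto
  show ?thesis
  proof (cases "r \<le> Q")
    case True
    have "real r / real Q \<le> (real r / real Q) powr \<theta>"
      using powr_mono'[of \<theta> 1 "real r / real Q"] \<theta> True pos by simp
    also have "\<dots> = real r powr \<theta> * real (Q * R) powr (- \<theta>) * real R powr \<theta>"
      using pos by (simp add: powr_divide powr_mult powr_minus field_simps)
    also have "\<dots> \<le> real N powr \<theta> * real (Q * R) powr (- \<theta>) * (2 * (real R)\<^sup>2)"
    proof (intro mult_mono rN order_refl)
      have "real R powr \<theta> \<le> real R powr 2" using \<theta> pos by (intro powr_mono) auto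
      then have "real R powr \<theta> \<le> (real R)\<^sup>2" using pos by simp
      then show "real R powr \<theta> \<le> 2 * (real R)\<^sup>2" by (smt (verit) zero_le_power2)
    qed auto
    finally show ?thesis using True by (simp add: mult_ac)
  next
    case False
    have "(real r)\<^sup>2 = real r powr \<theta> * real r powr (2 - \<theta>)"
      using pos by (simp flip: powr_add)
    also have "\<dots> \<le> real N powr \<theta> * real (Q * R) powr (2 - \<theta>)"
    proof (intro mult_mono rN)
      have "real r \<le> real (Q * R)" using r(2) by (simp only: of_nat_le_iff)
      then show "real r powr (2 - \<theta>) \<le> real (Q * R) powr (2 - \<theta>)" using \<theta> by (intro powr_mono2) auto
    qed auto
    also have "real (Q * R) powr (2 - \<theta>) = (real Q)\<^sup>2 * (real R)\<^sup>2 * real (Q * R) powr (- \<theta>)"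
    proof -
      have "real (Q * R) powr (2 - \<theta>) = real (Q * R) powr 2 * real (Q * R) powr (- \<theta>)"
        by (subst powr_add[symmetric]) simp
      also have "real (Q * R) powr 2 = (real Q)\<^sup>2 * (real R)\<^sup>2" using pos by (simp add: power_mult_distrib)
      finally show ?thesis .
    qed
    finally have "(real r)\<^sup>2 \<le> (real N powr \<theta> * (real R)\<^sup>2 * real (Q * R) powr (- \<theta>)) * (real Q)\<^sup>2"
      by (simp add: mult_ac)
    then have "(real r / real Q)\<^sup>2 \<le> real N powr \<theta> * (real R)\<^sup>2 * real (Q * R) powr (- \<theta>)"
      using pos by (simp add: power_divide pos_divide_le_eq)
    then show ?thesis using False by simp
  qed
qed

lemma shell_product_double_sum_le:
  fixes p g :: "'i \<Rightarrow> nat" and \<theta> :: real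
  assumes u: "finite u" "u \<noteq> {}" and p: "\<And>j. j \<in> u \<Longrightarrow> prime (p j)" and inj: "inj_on p u"
    and g: "\<And>j. j \<in> u \<Longrightarrow> g j \<ge> 1" and \<theta>: "0 < \<theta>" "\<theta> \<le> 1"
  shows "(\<Sum>n<N. \<Sum>m<N. \<Prod>j\<in>u. shell (p j) (g j) (int n - int m)) \<le>
    2 * real N powr \<theta> * (\<Prod>j\<in>u. (real (p j))\<^sup>2 * (real (p j) powr (- \<theta>)) ^ g j)"
proof -
  obtain j0 where j0: "j0 \<in> u" using u by blast
  define W where "W d = (\<Prod>j\<in>u. shell (p j) (g j) d)" for d
  define P where "P = (\<Prod>j\<in>u. p j ^ g j)"
  define Q where "Q = (\<Prod>j\<in>u. p j ^ (g j - 1))"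
  define R where "R = (\<Prod>j\<in>u. p j)"
  have p2: "p j \<ge> 2" if "j \<in> u" for j using prime_ge_2_nat p that by blast
  have PQR: "P = Q * R"
    unfolding P_def Q_def R_def prod.distrib[symmetric]
  proof (rule prod.cong[OF refl])
    fix j assume "j \<in> u" then show "p j ^ g j = p j ^ (g j - 1) * p j"
      using g[of j] by (simp add: power_eq_if mult.commute)
  qed
  have per: "W (d + int P) = W d" for d
    unfolding W_def
  proof (rule prod.cong[OF refl])
    fix j assume j: "j \<in> u"
    have "p j ^ g j dvd P" unfolding P_def by (rule dvd_prodI) (use u j in auto)
    then have "int (p j) ^ g j dvd int P" by (metis of_nat_dvd_iff of_nat_power)
    then show "shell (p j) (g j) (d + int P) = shell (p j) (g j) d"
      by (rule shell_periodic[OF p2[OF j] g[OF j]])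
  qed
  have zero: "(\<Sum>d<P. W (m + int d)) = 0" for m
    unfolding W_def P_def by (rule prod_periodic_sum_zero[OF u(1) j0 p inj g])
  have bound: "\<bar>W d\<bar> \<le> (if int Q dvd d then 1 / real Q else 0)" for d
  proof -
    have le: "\<bar>W d\<bar> \<le> (\<Prod>j\<in>u. if int (p j) ^ (g j - 1) dvd d then 1 / real (p j) ^ (g j - 1) else 0)"
      unfolding W_def abs_prod by (intro prod_mono conjI abs_ge_zero shell_abs_le p2)
    show ?thesis
    proof (cases "\<forall>j\<in>u. int (p j) ^ (g j - 1) dvd d")
      case True
      have "(\<Prod>j\<in>u. int (p j) ^ (g j - 1)) dvd d"
      proof (rule prod_dvd_if_pairwise_coprime[OF u(1)])
        fix i j assume ij: "i \<in> u" "j \<in> u" "i \<noteq> j"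
        then have "p i \<noteq> p j" using inj by (auto simp: inj_on_def)
        then have "coprime (p i) (p j)" using p ij by (intro primes_coprime) auto
        then show "coprime (int (p i) ^ (g i - 1)) (int (p j) ^ (g j - 1))" by simp
      qed (use True in auto)
      then have "int Q dvd d" by (simp add: Q_def)
      moreover have "(\<Prod>j\<in>u. if int (p j) ^ (g j - 1) dvd d then 1 / real (p j) ^ (g j - 1) else 0) = 1 / real Q"
        using True by (simp add: Q_def prod_dividef)
      ultimately show ?thesis using le by simp
    next
      case False
      then have "(\<Prod>j\<in>u. if int (p j) ^ (g j - 1) dvd d then 1 / real (p j) ^ (g j - 1) else 0) = 0"
        using u by (intro prod_zero) auto
      then have "\<bar>W d\<bar> \<le> 0" using le by simp
      then show ?thesis by (smt (verit) divide_nonneg_nonneg of_nat_0_le_iff)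
    qed
  qed
  have Q1: "Q \<ge> 1" and R1: "R \<ge> 1"
    using p2 unfolding Q_def R_def by (auto simp: Suc_le_eq One_nat_def intro!: prod_pos) (fastforce)+
  have Ppos: "P > 0" using Q1 R1 PQR by simp
  have "(\<Sum>n<N. \<Sum>m<N. W (int n - int m)) = (\<Sum>n<N mod P. \<Sum>m<N mod P. W (int n - int m))"
    by (rule double_sum_reduce[OF per zero])
  also have "\<dots> \<le> \<bar>\<Sum>n<N mod P. \<Sum>m<N mod P. W (int n - int m)\<bar>" by simp
  also have "\<dots> \<le> (if N mod P \<le> Q then real (N mod P) / real Q else 2 * (real (N mod P) / real Q)\<^sup>2)"
    by (rule double_sum_sparse_le[OF Q1 bound])
  also have "\<dots> \<le> 2 * real N powr \<theta> * ((real R)\<^sup>2 * real (Q * R) powr (- \<theta>))"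
    unfolding mult.assoc[symmetric]
    by (rule power_saving[OF \<theta> Q1 R1]) (use Ppos PQR in \<open>auto intro: less_imp_le\<close>)
  also have "(real R)\<^sup>2 * real (Q * R) powr (- \<theta>) = (\<Prod>j\<in>u. (real (p j))\<^sup>2 * (real (p j) powr (- \<theta>)) ^ g j)"
  proof -
    have "(real (p j) ^ g j) powr (- \<theta>) = (real (p j) powr (- \<theta>)) ^ g j" if "j \<in> u" for j
    proof -
      have pos: "real (p j) > 0" using p2[OF that] by simp
      have "(real (p j) ^ g j) powr (- \<theta>) = (real (p j) powr real (g j)) powr (- \<theta>)"
        using pos by (simp add: powr_realpow)
      also have "\<dots> = (real (p j) powr (- \<theta>)) powr real (g j)" by (simp add: powr_powr mult.commute)
      also have "\<dots> = (real (p j) powr (- \<theta>)) ^ g j" using pos by (simp add: powr_realpow)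
      finally show ?thesis .
    qed
    then have "real (Q * R) powr (- \<theta>) = (\<Prod>j\<in>u. (real (p j) powr (- \<theta>)) ^ g j)"
      unfolding PQR[symmetric] P_def by (simp add: prod_powr_distrib)
    then show ?thesis by (simp add: R_def prod.distrib prod_power_distrib)
  qed
  finally show ?thesis unfolding W_def .
qed

section \<open>Summing over all shells\<close>

text \<open>
  A choice of a level \<open>G j \<le> L\<close> for every coordinate, where level \<open>0\<close> stands for the constant
  part, selects one term of the expanded product. The term with all levels zero is the one that is
  subtracted, and in the others the coordinates of level zero only contribute constants. The bounds
  for the terms have product form and are summed by reading the expansion backwards.
\<close>

lemma shell_expansion_double_sum_le:
  fixes \<gamma> :: "nat \<Rightarrow> real" and p :: "nat \<Rightarrow> nat"
  assumes pos: "\<And>j. 1 \<le> j \<Longrightarrow> 0 < \<gamma> j" and p: "\<And>j. 1 \<le> j \<Longrightarrow> prime (p j)"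
    and inj: "inj_on p {1..s}" and \<theta>: "0 < \<theta>" "\<theta> \<le> 1"
  shows "(\<Sum>n<N. \<Sum>m<N. \<Prod>j=1..s. 1 + \<gamma> j * (1/3 + (\<Sum>g=1..L. shell (p j) g (int n - int m))))
      - (real N)\<^sup>2 * (\<Prod>j=1..s. 1 + \<gamma> j * (1/3))
    \<le> 2 * real N powr \<theta> *
       (\<Prod>j=1..s. 1 + \<gamma> j * (1/3 + (real (p j))\<^sup>2 * (\<Sum>g=1..L. (real (p j) powr (- \<theta>)) ^ g)))"
proof -
  define A where "A j g d = (if g = 0 then 1 + \<gamma> j * (1/3) else \<gamma> j * shell (p j) g d)" for j g d
  define b where "b j g = (if g = 0 then 1 + \<gamma> j * (1/3)
    else \<gamma> j * ((real (p j))\<^sup>2 * (real (p j) powr (- \<theta>)) ^ g))" for j g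
  let ?G = "PiE {1..s} (\<lambda>_. {0..L})"
  let ?z = "\<lambda>j\<in>{1..s}. 0::nat"
  have fin: "finite ?G" by (intro finite_PiE) auto
  have z: "?z \<in> ?G" by auto
  have split: "(\<Sum>g\<in>{0..L}. f g) = f 0 + (\<Sum>g=1..L. f g)" for f :: "nat \<Rightarrow> real"
    by (simp add: sum.atLeast_Suc_atMost One_nat_def)
  have A_sum: "(\<Prod>j=1..s. 1 + \<gamma> j * (1/3 + (\<Sum>g=1..L. shell (p j) g d))) = (\<Sum>G\<in>?G. \<Prod>j=1..s. A j (G j) d)" for d
  proof -
    have "(\<Prod>j=1..s. 1 + \<gamma> j * (1/3 + (\<Sum>g=1..L. shell (p j) g d))) = (\<Prod>j=1..s. \<Sum>g\<in>{0..L}. A j g d)"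
      unfolding split by (simp add: A_def sum_distrib_left algebra_simps cong: sum.cong_simp)
    then show ?thesis by (simp add: prod_sum_PiE)
  qed
  have b_sum: "(\<Prod>j=1..s. 1 + \<gamma> j * (1/3 + (real (p j))\<^sup>2 * (\<Sum>g=1..L. (real (p j) powr (- \<theta>)) ^ g)))
      = (\<Sum>G\<in>?G. \<Prod>j=1..s. b j (G j))"
  proof -
    have "(\<Prod>j=1..s. 1 + \<gamma> j * (1/3 + (real (p j))\<^sup>2 * (\<Sum>g=1..L. (real (p j) powr (- \<theta>)) ^ g)))
      = (\<Prod>j=1..s. \<Sum>g\<in>{0..L}. b j g)"
      unfolding split by (simp add: b_def sum_distrib_left algebra_simps cong: sum.cong_simp)
    then show ?thesis by (simp add: prod_sum_PiE)
  qed
  have b_nonneg: "0 \<le> b j g" if "1 \<le> j" for j g using pos[OF that] by (simp add: b_def add_nonneg_nonneg)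
  have term_le: "(\<Sum>n<N. \<Sum>m<N. \<Prod>j=1..s. A j (G j) (int n - int m)) \<le>
      2 * real N powr \<theta> * (\<Prod>j=1..s. b j (G j))" if G: "G \<in> ?G" "G \<noteq> ?z" for G
  proof -
    define u where "u = {j \<in> {1..s}. G j \<noteq> 0}"
    have u: "finite u" "u \<subseteq> {1..s}" by (auto simp: u_def)
    have une: "u \<noteq> {}"
    proof
      assume "u = {}"
      then have "G = ?z" using G(1) by (intro PiE_ext[OF G(1) z]) (auto simp: u_def)
      then show False using G(2) by simp
    qed
    define c where "c = (\<Prod>j\<in>{1..s} - u. 1 + \<gamma> j * (1/3)) * (\<Prod>j\<in>u. \<gamma> j)"
    have pos': "0 \<le> \<gamma> j" if "1 \<le> j" for j using pos[OF that] by simp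
    have c: "0 \<le> c" unfolding c_def using pos' u
      by (intro mult_nonneg_nonneg prod_nonneg) (auto intro!: add_nonneg_nonneg)
    have un: "{1..s} = ({1..s} - u) \<union> u" using u by auto
    have A_prod: "(\<Prod>j=1..s. A j (G j) d) = c * (\<Prod>j\<in>u. shell (p j) (G j) d)" for d
    proof -
      have "(\<Prod>j=1..s. A j (G j) d) = (\<Prod>j\<in>{1..s} - u. A j (G j) d) * (\<Prod>j\<in>u. A j (G j) d)"
        using u by (subst prod.subset_diff[of u]) auto
      also have "(\<Prod>j\<in>{1..s} - u. A j (G j) d) = (\<Prod>j\<in>{1..s} - u. 1 + \<gamma> j * (1/3))"
        by (rule prod.cong) (auto simp: A_def u_def)
      also have "(\<Prod>j\<in>u. A j (G j) d) = (\<Prod>j\<in>u. \<gamma> j * shell (p j) (G j) d)"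
        by (rule prod.cong) (auto simp: A_def u_def)
      finally show ?thesis by (simp add: c_def prod.distrib)
    qed
    have b_prod: "(\<Prod>j=1..s. b j (G j)) = c * (\<Prod>j\<in>u. (real (p j))\<^sup>2 * (real (p j) powr (- \<theta>)) ^ G j)"
    proof -
      have "(\<Prod>j=1..s. b j (G j)) = (\<Prod>j\<in>{1..s} - u. b j (G j)) * (\<Prod>j\<in>u. b j (G j))"
        using u by (subst prod.subset_diff[of u]) auto
      also have "(\<Prod>j\<in>{1..s} - u. b j (G j)) = (\<Prod>j\<in>{1..s} - u. 1 + \<gamma> j * (1/3))"
        by (rule prod.cong) (auto simp: b_def u_def)
      also have "(\<Prod>j\<in>u. b j (G j)) = (\<Prod>j\<in>u. \<gamma> j * ((real (p j))\<^sup>2 * (real (p j) powr (- \<theta>)) ^ G j))"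
        by (rule prod.cong) (auto simp: b_def u_def)
      finally show ?thesis by (simp add: c_def prod.distrib)
    qed
    have "(\<Sum>n<N. \<Sum>m<N. \<Prod>j=1..s. A j (G j) (int n - int m)) =
       c * (\<Sum>n<N. \<Sum>m<N. \<Prod>j\<in>u. shell (p j) (G j) (int n - int m))"
      by (simp add: A_prod sum_distrib_left)
    also have "\<dots> \<le> c * (2 * real N powr \<theta> * (\<Prod>j\<in>u. (real (p j))\<^sup>2 * (real (p j) powr (- \<theta>)) ^ G j))"
    proof (intro mult_left_mono c shell_product_double_sum_le u une \<theta>)
      show "inj_on p u" by (rule inj_on_subset[OF inj u(2)])
      show "prime (p j)" if "j \<in> u" for j using u that by (intro p) auto
      show "1 \<le> G j" if "j \<in> u" for j using that by (simp add: u_def Suc_le_eq One_nat_def)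
    qed
    finally show ?thesis by (simp add: b_prod mult_ac)
  qed
  have "(\<Sum>n<N. \<Sum>m<N. \<Prod>j=1..s. 1 + \<gamma> j * (1/3 + (\<Sum>g=1..L. shell (p j) g (int n - int m))))
      = (\<Sum>n<N. \<Sum>m<N. \<Sum>G\<in>?G. \<Prod>j=1..s. A j (G j) (int n - int m))"
    by (simp only: A_sum)
  also have "\<dots> = (\<Sum>n<N. \<Sum>G\<in>?G. \<Sum>m<N. \<Prod>j=1..s. A j (G j) (int n - int m))"
    by (intro sum.cong refl sum.swap)
  also have "\<dots> = (\<Sum>G\<in>?G. \<Sum>n<N. \<Sum>m<N. \<Prod>j=1..s. A j (G j) (int n - int m))"
    by (rule sum.swap)
  also have "\<dots> = (\<Sum>n<N. \<Sum>m<N. \<Prod>j=1..s. A j (?z j) (int n - int m))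
      + (\<Sum>G\<in>?G - {?z}. \<Sum>n<N. \<Sum>m<N. \<Prod>j=1..s. A j (G j) (int n - int m))"
    by (rule sum.remove[OF fin z])
  also have "(\<Sum>n<N. \<Sum>m<N. \<Prod>j=1..s. A j (?z j) (int n - int m)) = (real N)\<^sup>2 * (\<Prod>j=1..s. 1 + \<gamma> j * (1/3))"
    by (simp add: A_def power2_eq_square)
  finally have "(\<Sum>n<N. \<Sum>m<N. \<Prod>j=1..s. 1 + \<gamma> j * (1/3 + (\<Sum>g=1..L. shell (p j) g (int n - int m))))
      - (real N)\<^sup>2 * (\<Prod>j=1..s. 1 + \<gamma> j * (1/3))
      = (\<Sum>G\<in>?G - {?z}. \<Sum>n<N. \<Sum>m<N. \<Prod>j=1..s. A j (G j) (int n - int m))"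
    by (simp only: add_diff_cancel_left')
  also have "\<dots> \<le> (\<Sum>G\<in>?G - {?z}. 2 * real N powr \<theta> * (\<Prod>j=1..s. b j (G j)))"
    by (intro sum_mono term_le) auto
  also have "\<dots> \<le> (\<Sum>G\<in>?G. 2 * real N powr \<theta> * (\<Prod>j=1..s. b j (G j)))"
    by (intro sum_mono2 fin mult_nonneg_nonneg prod_nonneg b_nonneg) auto
  finally show ?thesis unfolding b_sum unfolding sum_distrib_left .
qed

lemma geometric_tail_le:
  assumes p: "p \<ge> 2" and \<theta>: "0 < \<theta>"
  shows "(\<Sum>g=1..L. (real p powr (- \<theta>)) ^ g) \<le> real p powr (- \<theta>) / (1 - 2 powr (- \<theta>))"
proof -
  define x where "x = real p powr (- \<theta>)"
  have x0: "0 < x" using p by (simp add: x_def)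
  have xle: "x \<le> 2 powr (- \<theta>)" unfolding x_def using p \<theta> by (intro powr_mono2') auto
  have t1: "2 powr (- \<theta>) < (1::real)" using \<theta> by (simp add: powr_less_one)
  have "(\<Sum>g=1..L. x ^ g) = x * (\<Sum>g<L. x ^ g)"
    unfolding sum_distrib_left
    by (rule sum.reindex_bij_witness[of _ Suc "\<lambda>g. g - 1"]) (auto simp: One_nat_def power_eq_if)
  also have "(\<Sum>g<L. x ^ g) = (1 - x ^ L) / (1 - x)"
    using xle t1 by (subst sum_gp_strict) auto
  also have "x * ((1 - x ^ L) / (1 - x)) \<le> x * (1 / (1 - 2 powr (- \<theta>)))"
    using x0 xle t1 by (intro mult_left_mono frac_le) auto
  finally show ?thesis by (simp add: x_def)
qed

text \<open>
  The logarithm is at least \<open>ln 2\<close> from the second term on.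
\<close>

lemma summable_weights_square:
  fixes \<gamma> :: "nat \<Rightarrow> real"
  assumes pos: "\<And>j. 1 \<le> j \<Longrightarrow> 0 < \<gamma> j"
    and summ: "summable (\<lambda>j. \<gamma> (Suc j) * real (Suc j) ^ 2 * ln (real (Suc j)))"
  shows "summable (\<lambda>j. \<gamma> (Suc j) * real (Suc j) ^ 2)"
proof (rule summable_comparison_test_ev)
  show "summable (\<lambda>j. (1 / ln 2) * (\<gamma> (Suc j) * real (Suc j) ^ 2 * ln (real (Suc j))))"
    by (intro summable_mult summ)
  show "\<forall>\<^sub>F j in sequentially. norm (\<gamma> (Suc j) * real (Suc j) ^ 2)
      \<le> (1 / ln 2) * (\<gamma> (Suc j) * real (Suc j) ^ 2 * ln (real (Suc j)))"
    using eventually_ge_at_top[of 1]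
  proof eventually_elim
    case (elim j)
    have "ln 2 \<le> ln (real (Suc j))" using elim by (subst ln_le_cancel_iff) auto
    moreover have g: "0 \<le> \<gamma> (Suc j) * real (Suc j) ^ 2" using pos[of "Suc j"] by simp
    ultimately have "\<gamma> (Suc j) * real (Suc j) ^ 2 * ln 2 \<le> \<gamma> (Suc j) * real (Suc j) ^ 2 * ln (real (Suc j))"
      by (intro mult_left_mono) auto
    then have "\<gamma> (Suc j) * real (Suc j) ^ 2 \<le> \<gamma> (Suc j) * real (Suc j) ^ 2 * ln (real (Suc j)) / ln 2"
      by (subst pos_le_divide_eq) auto
    then show ?case using g by simp
  qed
qed

text \<open>
  The geometric series leaves \<open>p\<^sub>j\<^sup>2\<^sup>-\<^sup>\<theta> = (p\<^sub>j\<^sup>1\<^sup>-\<^sup>\<theta>\<^sup>/\<^sup>2)\<^sup>2 = O(j\<^sup>2)\<close>, so the product is at most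
  the exponential of a convergent series.
\<close>

lemma weighted_prime_product_bounded:
  fixes \<gamma> :: "nat \<Rightarrow> real"
  assumes pos: "\<And>j. 1 \<le> j \<Longrightarrow> 0 < \<gamma> j"
    and summ: "summable (\<lambda>j. \<gamma> (Suc j) * real (Suc j) ^ 2)" and \<theta>: "0 < \<theta>" "\<theta> \<le> 1"
  shows "\<exists>C>0. \<forall>s L. (\<Prod>j=1..s. 1 + \<gamma> j * (1/3 + (real (nth_prime j))\<^sup>2 *
      (\<Sum>g=1..L. (real (nth_prime j) powr (- \<theta>)) ^ g))) \<le> C"
proof -
  define c where "c = 1 / (1 - 2 powr (- \<theta>))"
  have c: "0 < c" unfolding c_def using \<theta> by (simp add: powr_less_one)
  (* The constant of nth_prime_powr_le for the exponent \<theta>/2, squared. *)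
  define D where "D = 1/3 + c * (2 / (\<theta>/2 * ln 2))\<^sup>2"
  have D: "0 \<le> D" unfolding D_def using c by simp
  have factor: "\<gamma> j * (1/3 + (real (nth_prime j))\<^sup>2 * (\<Sum>g=1..L. (real (nth_prime j) powr (- \<theta>)) ^ g))
      \<le> D * (\<gamma> j * (real j)\<^sup>2)" if j: "1 \<le> j" for j L
  proof -
    define p where "p = nth_prime j"
    have p2: "p \<ge> 2" unfolding p_def using prime_ge_2_nat[OF nth_prime_prime] .
    have "(real p)\<^sup>2 * (\<Sum>g=1..L. (real p powr (- \<theta>)) ^ g) \<le> (real p)\<^sup>2 * (real p powr (- \<theta>) * c)"
      using geometric_tail_le[OF p2 \<theta>(1), of L] by (intro mult_left_mono) (auto simp: c_def)
    also have "\<dots> = c * (real p powr (1 - \<theta>/2))\<^sup>2"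
    proof -
      have "(real p powr (1 - \<theta>/2))\<^sup>2 = real p powr (2 + (- \<theta>))"
        using p2 by (simp add: power2_eq_square flip: powr_add)
      also have "\<dots> = (real p)\<^sup>2 * real p powr (- \<theta>)" using p2 by (subst powr_add) simp
      finally show ?thesis by simp
    qed
    also have "\<dots> \<le> c * (2 / (\<theta>/2 * ln 2) * real j)\<^sup>2"
      unfolding p_def using nth_prime_powr_le[of "\<theta>/2" j] j \<theta> c by (intro mult_left_mono power_mono) auto
    finally have 1: "(real p)\<^sup>2 * (\<Sum>g=1..L. (real p powr (- \<theta>)) ^ g) \<le> c * (2 / (\<theta>/2 * ln 2))\<^sup>2 * (real j)\<^sup>2"
      unfolding power_mult_distrib mult.assoc .
    have "1 \<le> (real j)\<^sup>2" using j by (simp add: one_le_power)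
    then have "1/3 + (real p)\<^sup>2 * (\<Sum>g=1..L. (real p powr (- \<theta>)) ^ g) \<le> D * (real j)\<^sup>2"
      using 1 unfolding D_def distrib_right by linarith
    then have "\<gamma> j * (1/3 + (real p)\<^sup>2 * (\<Sum>g=1..L. (real p powr (- \<theta>)) ^ g)) \<le> \<gamma> j * (D * (real j)\<^sup>2)"
      using pos[OF j] by (intro mult_left_mono) auto
    then show ?thesis by (simp add: p_def mult_ac)
  qed
  define S where "S = (\<Sum>j. \<gamma> (Suc j) * real (Suc j) ^ 2)"
  have "(\<Prod>j=1..s. 1 + \<gamma> j * (1/3 + (real (nth_prime j))\<^sup>2 *
      (\<Sum>g=1..L. (real (nth_prime j) powr (- \<theta>)) ^ g))) \<le> exp (D * S)" for s L
  proof -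
    have "(\<Prod>j=1..s. 1 + \<gamma> j * (1/3 + (real (nth_prime j))\<^sup>2 * (\<Sum>g=1..L. (real (nth_prime j) powr (- \<theta>)) ^ g)))
      \<le> (\<Prod>j=1..s. exp (D * (\<gamma> j * (real j)\<^sup>2)))"
    proof (intro prod_mono conjI)
      fix j assume j: "j \<in> {1..s}"
      show "0 \<le> 1 + \<gamma> j * (1/3 + (real (nth_prime j))\<^sup>2 * (\<Sum>g=1..L. (real (nth_prime j) powr (- \<theta>)) ^ g))"
        using pos[of j] j by (intro add_nonneg_nonneg mult_nonneg_nonneg sum_nonneg) auto
      show "1 + \<gamma> j * (1/3 + (real (nth_prime j))\<^sup>2 * (\<Sum>g=1..L. (real (nth_prime j) powr (- \<theta>)) ^ g))
         \<le> exp (D * (\<gamma> j * (real j)\<^sup>2))"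
        using order_trans[OF add_left_mono[OF factor] exp_ge_add_one_self] j by simp
    qed
    also have "\<dots> = exp (D * (\<Sum>j=1..s. \<gamma> j * (real j)\<^sup>2))"
      by (simp add: exp_sum sum_distrib_left)
    also have "\<dots> \<le> exp (D * S)"
    proof -
      have "(\<Sum>j=1..s. \<gamma> j * (real j)\<^sup>2) = (\<Sum>j<s. \<gamma> (Suc j) * real (Suc j) ^ 2)"
        by (rule sum.reindex_bij_witness[of _ Suc "\<lambda>g. g - 1"]) (auto simp: One_nat_def)
      also have "\<dots> \<le> S" unfolding S_def
        by (rule sum_le_suminf[OF summ]) (use pos in \<open>auto intro!: mult_nonneg_nonneg less_imp_le\<close>)
      finally show ?thesis using D by (simp add: mult_left_mono)
    qed
    finally show ?thesis .
  qed
  then show ?thesis by (intro exI[of _ "exp (D * S)"]) auto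
qed

section \<open>Digits of \<open>p\<close>-adically shifted points\<close>

(* The exponents r + 1 of the digit expansions are to be read as Suc r in what follows. *)
declare One_nat_def [simp]

text \<open>
  The van der Corput map restricted to the first \<open>L\<close> digits of \<open>w\<close>. The recursion
  splits off the leading digit, which is what the induction in \<open>spread_eq\<close> works on.
\<close>

primrec vdc :: "nat \<Rightarrow> nat \<Rightarrow> nat \<Rightarrow> real" where
  "vdc p 0 w = 0"
| "vdc p (Suc L) w = (real (w mod p) + vdc p L (w div p)) / real p"

text \<open>
  For a digit sequence \<open>z\<close>, \<open>digit_sum\<close> is the real number and \<open>digit_nat\<close> the \<open>p\<close>-adic integer
  with these digits, both truncated after \<open>L\<close> digits.
\<close>

definition digit_sum :: "nat \<Rightarrow> (nat \<Rightarrow> nat) \<Rightarrow> nat \<Rightarrow> real" where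
  "digit_sum p z L = (\<Sum>r<L. real (z r) / real p ^ (r + 1))"

definition digit_nat :: "nat \<Rightarrow> (nat \<Rightarrow> nat) \<Rightarrow> nat \<Rightarrow> nat" where
  "digit_nat p z L = (\<Sum>r<L. z r * p ^ r)"

lemma digit_nat_Suc_shift: "digit_nat p z (Suc L) = z 0 + p * digit_nat p (\<lambda>r. z (Suc r)) L"
  unfolding digit_nat_def sum.lessThan_Suc_shift by (simp add: sum_distrib_left mult_ac)

lemma digit_sum_Suc_shift: "digit_sum p z (Suc L) = (real (z 0) + digit_sum p (\<lambda>r. z (Suc r)) L) / real p"
  unfolding digit_sum_def sum.lessThan_Suc_shift
  by (simp add: sum_divide_distrib add_divide_distrib mult_ac)

lemma digit_sum_Suc: "digit_sum p z (Suc L) = digit_sum p z L + real (z L) / real p ^ (L + 1)"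
  by (simp add: digit_sum_def)

lemma vdc_digit_nat:
  assumes "\<And>r. z r < p" shows "vdc p L (digit_nat p z L) = digit_sum p z L"
  using assms
proof (induction L arbitrary: z)
  case 0 then show ?case by (simp add: digit_sum_def)
next
  case (Suc L)
  have "z 0 < p" by (rule Suc.prems)
  then have "(z 0 + p * q) mod p = z 0" "(z 0 + p * q) div p = q" for q by simp_all
  then show ?case using Suc.IH[of "\<lambda>r. z (Suc r)"] Suc.prems
    by (simp add: digit_nat_Suc_shift digit_sum_Suc_shift)
qed

lemma vdc_mod: "vdc p L (w mod p ^ L) = vdc p L w"
proof (induction L arbitrary: w)
  case (Suc L)
  have "w mod p ^ Suc L = p * (w div p mod p ^ L) + w mod p" by (simp add: mod_mult2_eq)
  then have "(w mod p ^ Suc L) mod p = w mod p" "(w mod p ^ Suc L) div p = w div p mod p ^ L"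
    by (cases "p = 0"; simp)+
  then show ?case using Suc.IH[of "w div p"] by simp
qed simp

lemma vdc_bounds: assumes "p \<ge> 2" shows "0 \<le> vdc p L w" "vdc p L w < 1"
proof -
  have "0 \<le> vdc p L w \<and> vdc p L w < 1"
  proof (induction L arbitrary: w)
    case (Suc L)
    have "real (w mod p) \<le> real p - 1" using assms pos_mod_bound[of "int p" "int w"]
      by (metis One_nat_def Suc_leI mod_less_divisor of_nat_1 of_nat_add of_nat_le_iff le_diff_eq
          Suc_eq_plus1 pos2 less_le_trans)
    then show ?case using Suc.IH[of "w div p"] assms by (simp add: field_simps)
  qed simp
  then show "0 \<le> vdc p L w" "vdc p L w < 1" by auto
qed

lemma digit_nat_digits: "digit_nat p (\<lambda>r. n div p ^ r mod p) L = n mod p ^ L"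
proof (induction L)
  case (Suc L)
  have "n mod (p ^ L * p) = p ^ L * (n div p ^ L mod p) + n mod p ^ L" by (rule mod_mult2_eq)
  then show ?case using Suc by (simp add: digit_nat_def mult.commute)
qed (simp add: digit_nat_def)

lemma digit_nat_less: assumes "\<And>r. z r < p" shows "digit_nat p z L < p ^ L"
proof (induction L)
  case (Suc L)
  have "digit_nat p z (Suc L) = digit_nat p z L + z L * p ^ L" by (simp add: digit_nat_def)
  also have "\<dots> < p ^ L + z L * p ^ L" using Suc by simp
  also have "\<dots> = Suc (z L) * p ^ L" by simp
  also have "\<dots> \<le> p * p ^ L" using assms[of L] by (intro mult_le_mono1) simp
  finally show ?case by simp
qed (simp add: digit_nat_def)

lemma digit_sum_mono: "k \<le> L \<Longrightarrow> digit_sum p z k \<le> digit_sum p z L"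
  unfolding digit_sum_def by (intro sum_mono2) auto

lemma digit_sum_upper:
  assumes "\<And>r. z r < p" "k \<le> L"
  shows "digit_sum p z L + 1 / real p ^ L \<le> digit_sum p z k + 1 / real p ^ k"
  using assms(2)
proof (induction L rule: dec_induct)
  case (step L)
  have p: "real p > 0" using assms(1)[of 0] by simp
  have "real (z L) + 1 \<le> real p" using assms(1)[of L] by simp
  then have "(real (z L) + 1) / real p ^ (L + 1) \<le> real p / real p ^ (L + 1)"
    using p by (intro divide_right_mono) auto
  then have "real (z L) / real p ^ (L + 1) + 1 / real p ^ (L + 1) \<le> 1 / real p ^ L"
    using p by (simp add: add_divide_distrib)
  then show ?case using step.IH by (simp add: digit_sum_Suc)
qed simp

lemma digit_sum_integral:
  assumes "p > 0" shows "\<exists>k. real p ^ L * digit_sum p z L = real (k::nat)"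
proof (induction L)
  case (Suc L)
  then obtain k where k: "real p ^ L * digit_sum p z L = real k" by blast
  have "real p ^ Suc L * digit_sum p z (Suc L) = real p * (real p ^ L * digit_sum p z L) + real (z L)"
    using assms by (simp add: digit_sum_Suc field_simps)
  also have "\<dots> = real (p * k + z L)" by (simp add: k)
  finally show ?case by blast
qed (simp add: digit_sum_def)

text \<open>
  The half-open interval of the points with given first digits determines the digits. This is
  used for the Halton points as well as for the shift.
\<close>

lemma digit_unique:
  assumes z: "z r < p"
    and x: "digit_sum p z (Suc r) \<le> x" "x < digit_sum p z (Suc r) + 1 / real p ^ Suc r"
  shows "padic_phi_plus p x r = z r"
proof -
  have p: "p > 0" using z by simp
  obtain k where k: "real p ^ r * digit_sum p z r = real (k::nat)"
    using digit_sum_integral[OF p] by blast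
  have e: "real p ^ Suc r * digit_sum p z (Suc r) = real (p * k + z r)"
  proof -
    have "real p ^ Suc r * digit_sum p z (Suc r) = real p * (real p ^ r * digit_sum p z r) + real (z r)"
      using p by (simp add: digit_sum_Suc field_simps)
    then show ?thesis by (simp add: k)
  qed
  have pr: "real p ^ Suc r > 0" using p by simp
  have "real p ^ Suc r * digit_sum p z (Suc r) \<le> real p ^ Suc r * x"
    using x(1) pr by (intro mult_left_mono) auto
  moreover have "real p ^ Suc r * x < real p ^ Suc r * (digit_sum p z (Suc r) + 1 / real p ^ Suc r)"
    using x(2) pr by (intro mult_strict_left_mono) auto
  moreover have "real p ^ Suc r * (digit_sum p z (Suc r) + 1 / real p ^ Suc r) = real (p * k + z r) + 1"
    using pr e p by (simp add: distrib_left)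
  ultimately have "\<lfloor>x * real p ^ (r + 1)\<rfloor> = int (p * k + z r)"
    unfolding e by (intro floor_unique) (simp_all add: mult.commute)
  then show ?thesis unfolding padic_phi_plus_def using z by (simp only: nat_int mod_mult_self4 mod_less)
qed

lemma padic_phi_plus_less: "p > 0 \<Longrightarrow> padic_phi_plus p x r < p"
  by (simp add: padic_phi_plus_def)

text \<open>
  Both inequalities say that the digits of \<open>x\<close> make up \<open>\<lfloor>x p\<^sup>L\<rfloor>\<close>.
\<close>

lemma digit_sum_padic_phi_plus:
  assumes p: "p > 0" and x: "0 \<le> x" "x < 1"
  shows "digit_sum p (padic_phi_plus p x) L \<le> x" "x < digit_sum p (padic_phi_plus p x) L + 1 / real p ^ L"
proof -
  have fl: "real_of_int \<lfloor>x * real p ^ L\<rfloor> = real p ^ L * digit_sum p (padic_phi_plus p x) L"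
  proof (induction L)
    case 0
    have "\<lfloor>x\<rfloor> = 0" using x by (simp add: floor_eq_iff)
    then show ?case by (simp add: digit_sum_def)
  next
    case (Suc L)
    define y where "y = x * real p ^ Suc L"
    have y0: "0 \<le> \<lfloor>y\<rfloor>" unfolding y_def using x by simp
    have "\<lfloor>y\<rfloor> div int p = \<lfloor>y / real_of_int (int p)\<rfloor>" by (rule floor_divide_real_eq_div[symmetric]) simp
    also have "y / real_of_int (int p) = x * real p ^ L" using p by (simp add: y_def)
    finally have d: "\<lfloor>y\<rfloor> div int p = \<lfloor>x * real p ^ L\<rfloor>" .
    have m: "int (padic_phi_plus p x L) = \<lfloor>y\<rfloor> mod int p"
      using y0 unfolding padic_phi_plus_def y_def by (simp add: zmod_int)
    have "\<lfloor>y\<rfloor> = int p * \<lfloor>x * real p ^ L\<rfloor> + int (padic_phi_plus p x L)"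
      unfolding m d[symmetric] by simp
    then have "real_of_int \<lfloor>y\<rfloor> = real p * real_of_int \<lfloor>x * real p ^ L\<rfloor> + real (padic_phi_plus p x L)"
      by simp
    then show ?case unfolding Suc.IH y_def[symmetric] using p by (simp add: digit_sum_Suc field_simps)
  qed
  have pr: "real p ^ L > 0" using p by simp
  have "real_of_int \<lfloor>x * real p ^ L\<rfloor> \<le> x * real p ^ L" "x * real p ^ L < real_of_int \<lfloor>x * real p ^ L\<rfloor> + 1"
    by linarith+
  then have a: "digit_sum p (padic_phi_plus p x) L * real p ^ L \<le> x * real p ^ L"
    and b: "x * real p ^ L < (digit_sum p (padic_phi_plus p x) L + 1 / real p ^ L) * real p ^ L"
    unfolding fl using p by (simp_all add: mult.commute distrib_left)
  show "digit_sum p (padic_phi_plus p x) L \<le> x" using a pr by (simp only: mult_le_cancel_right_pos)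
  show "x < digit_sum p (padic_phi_plus p x) L + 1 / real p ^ L"
    using b pr by (simp only: mult_less_cancel_right_pos)
qed

lemma digits_vanish: assumes "p \<ge> 2" "n \<le> r" shows "n div p ^ r mod p = (0::nat)"
proof -
  have "n < 2 ^ r" using assms(2) less_exp[of r] by linarith
  also have "(2::nat) ^ r \<le> p ^ r" by (rule power_mono[OF assms(1)]) simp
  finally show ?thesis by simp
qed

lemma padic_phi_plus_radical_inverse:
  assumes p: "p \<ge> 2" shows "padic_phi_plus p (radical_inverse p n) r = n div p ^ r mod p"
proof -
  let ?z = "\<lambda>r. n div p ^ r mod p"
  have zp: "?z r < p" for r using p by simp
  have rad: "radical_inverse p n = digit_sum p ?z L" if "n \<le> L" for L
    unfolding radical_inverse_def digit_sum_def
    by (rule suminf_finite) (use digits_vanish[OF p] that in auto)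
  let ?L = "max n (Suc r)"
  have x: "radical_inverse p n = digit_sum p ?z ?L" by (rule rad) simp
  show ?thesis
  proof (rule digit_unique)
    show "digit_sum p ?z (Suc r) \<le> radical_inverse p n" unfolding x by (rule digit_sum_mono) simp
    have "digit_sum p ?z ?L < digit_sum p ?z ?L + 1 / real p ^ ?L" using p by simp
    also have "\<dots> \<le> digit_sum p ?z (Suc r) + 1 / real p ^ Suc r"
      by (rule digit_sum_upper) (use zp in auto)
    finally show "radical_inverse p n < digit_sum p ?z (Suc r) + 1 / real p ^ Suc r" unfolding x .
  qed (rule zp)
qed

lemma padic_add_less: "p > 0 \<Longrightarrow> padic_add p y z r < p"
  by (simp add: padic_add_def)

text \<open>
  Truncated \<open>p\<close>-adic addition is addition of natural numbers up to the final carry.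
\<close>

lemma digit_nat_padic_add:
  "digit_nat p (padic_add p y z) L + p ^ L * padic_carry p y z L = digit_nat p y L + digit_nat p z L"
proof (induction L)
  case (Suc L)
  let ?t = "y L + z L + padic_carry p y z L"
  have "digit_nat p (padic_add p y z) (Suc L) + p ^ Suc L * padic_carry p y z (Suc L)
      = digit_nat p (padic_add p y z) L + p ^ L * (?t mod p + p * (?t div p))"
    by (simp only: digit_nat_def sum.lessThan_Suc padic_add_def padic_carry.simps power_Suc
        distrib_left mult_ac add_ac)
  also have "?t mod p + p * (?t div p) = ?t" by (rule mod_mult_div_eq)
  also have "digit_nat p (padic_add p y z) L + p ^ L * ?t
      = digit_nat p (padic_add p y z) L + p ^ L * padic_carry p y z L + p ^ L * (y L + z L)"
    by (simp add: algebra_simps)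
  finally show ?case using Suc by (simp add: digit_nat_def algebra_simps)
qed (simp add: digit_nat_def)

lemma digit_nat_padic_add_mod:
  assumes "p > 0"
  shows "digit_nat p (padic_add p y z) L = (digit_nat p y L + digit_nat p z L) mod p ^ L"
  unfolding digit_nat_padic_add[symmetric]
  using digit_nat_less[of "padic_add p y z" p L] padic_add_less[OF assms] by simp

abbreviation shift_digits :: "nat \<Rightarrow> real \<Rightarrow> nat \<Rightarrow> nat" where
  "shift_digits p \<sigma> L \<equiv> digit_nat p (padic_phi_plus p \<sigma>) L"

abbreviation shifted_digits :: "nat \<Rightarrow> nat \<Rightarrow> real \<Rightarrow> nat \<Rightarrow> nat" where
  "shifted_digits p n \<sigma> \<equiv> padic_add p (padic_phi_plus p (radical_inverse p n)) (padic_phi_plus p \<sigma>)"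

lemma digit_nat_shifted:
  assumes p: "p \<ge> 2"
  shows "digit_nat p (shifted_digits p n \<sigma>) L = (n + shift_digits p \<sigma> L) mod p ^ L"
proof -
  have "digit_nat p (padic_phi_plus p (radical_inverse p n)) L = n mod p ^ L"
    using p by (simp add: padic_phi_plus_radical_inverse digit_nat_digits[symmetric] digit_nat_def)
  then show ?thesis using p by (simp add: digit_nat_padic_add_mod mod_add_left_eq)
qed

lemma digit_sum_shifted:
  assumes p: "p \<ge> 2"
  shows "digit_sum p (shifted_digits p n \<sigma>) L = vdc p L (n + shift_digits p \<sigma> L)"
  using vdc_digit_nat[of "shifted_digits p n \<sigma>" p L] padic_add_less[of p] p
  by (simp add: vdc_mod digit_nat_shifted)

lemma geometric_digits_sums: assumes "p \<ge> 2" shows "(\<lambda>r. (real p - 1) / real p ^ (r + 1)) sums 1"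
proof -
  have "(\<lambda>r. (real p - 1) / real p * (1 / real p) ^ r) sums ((real p - 1) / real p * (1 / (1 - 1 / real p)))"
    by (intro sums_mult geometric_sums) (use assms in simp)
  moreover have "(real p - 1) / real p * (1 / (1 - 1 / real p)) = 1"
    using assms by (simp add: field_simps)
  moreover have "(real p - 1) / real p * (1 / real p) ^ r = (real p - 1) / real p ^ (r + 1)" for r
    by (simp add: power_divide)
  ultimately show ?thesis by (simp only:)
qed

text \<open>
  The map to the unit interval would wrap around from \<open>1\<close> to \<open>0\<close> only if all digits were
  \<open>p - 1\<close>, that is, if the sum were the \<open>p\<close>-adic integer \<open>-1\<close>. Then \<open>\<sigma>\<close> would have the digits of
  \<open>-1 - n\<close>, which are eventually \<open>p - 1\<close>, and these are not the digits of a number in \<open>[0,1)\<close>.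
\<close>

lemma not_all_digits_maximal:
  assumes p: "p \<ge> 2" and \<sigma>: "0 \<le> \<sigma>" "\<sigma> < 1"
  shows "\<exists>r. shifted_digits p n \<sigma> r < p - 1"
proof (rule ccontr)
  let ?w = "shifted_digits p n \<sigma>"
  let ?z = "padic_phi_plus p \<sigma>"
  have p0: "p > 0" using p by simp
  assume "\<not> ?thesis"
  then have w: "?w r = p - 1" for r
    using padic_add_less[OF p0, of "padic_phi_plus p (radical_inverse p n)" ?z r]
    by (metis Suc_pred' linorder_not_less not_less_eq order_antisym p0 less_Suc_eq_le)
  have w_nat: "digit_nat p ?w L + 1 = p ^ L" for L
  proof (induction L)
    case (Suc L)
    have "digit_nat p ?w (Suc L) + 1 = (digit_nat p ?w L + 1) + (p - 1) * p ^ L"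
      by (simp add: digit_nat_def w)
    also have "\<dots> = p ^ Suc L" unfolding Suc using p by (simp add: diff_mult_distrib)
    finally show ?case .
  qed (simp add: digit_nat_def)
  have nL: "n < p ^ L" if "n \<le> L" for L
  proof -
    have "n < 2 ^ L" using that less_exp[of L] by linarith
    also have "(2::nat) ^ L \<le> p ^ L" by (rule power_mono[OF p]) simp
    finally show ?thesis .
  qed
  (* The first L digits of the shift are those of p ^ L - 1 - n as soon as n < p ^ L. *)
  have z_nat: "digit_nat p ?z L + n + 1 = p ^ L" if L: "n \<le> L" for L
  proof -
    have m: "(n + digit_nat p ?z L) mod p ^ L + 1 = p ^ L"
      using w_nat[of L] digit_nat_shifted[OF p, of n \<sigma> L] by simp
    have "n + digit_nat p ?z L < 2 * p ^ L"
      using nL[OF L] digit_nat_less[of ?z p L] padic_phi_plus_less[OF p0] by (simp add: add_strict_mono)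
    show ?thesis
    proof (cases "n + digit_nat p ?z L < p ^ L")
      case True then show ?thesis using m by simp
    next
      case False
      then have "(n + digit_nat p ?z L) mod p ^ L = n + digit_nat p ?z L - p ^ L"
        using \<open>n + digit_nat p ?z L < 2 * p ^ L\<close> by (simp add: le_mod_geq)
      moreover have "digit_nat p ?z L < p ^ L" using padic_phi_plus_less[OF p0] by (rule digit_nat_less)
      ultimately show ?thesis using m nL[OF L] False by linarith
    qed
  qed
  have z: "?z r = p - 1" if r: "n \<le> r" for r
  proof -
    have "digit_nat p ?z (Suc r) = digit_nat p ?z r + ?z r * p ^ r" by (simp add: digit_nat_def)
    then have "p ^ Suc r = p ^ r + ?z r * p ^ r" using z_nat[of r] z_nat[of "Suc r"] r by linarith
    then have "p * p ^ r = Suc (?z r) * p ^ r" by simp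
    then have "p = Suc (?z r)" using p by (simp only: mult_cancel2) auto
    then show ?thesis by simp
  qed
  have S: "digit_sum p ?z L = digit_sum p ?z n + 1 / real p ^ n - 1 / real p ^ L" if "n \<le> L" for L
    using that
  proof (induction L rule: dec_induct)
    case (step L)
    have "real (?z L) = real p - 1" using z[of L] step p by (simp add: of_nat_diff)
    then have "real (?z L) / real p ^ (L + 1) = 1 / real p ^ L - 1 / real p ^ Suc L"
      using p by (simp add: diff_divide_distrib)
    then show ?case using step.IH by (simp only: digit_sum_Suc)
  qed simp
  have le: "digit_sum p ?z n + 1 / real p ^ n - 1 / real p ^ L \<le> \<sigma>" if "n \<le> L" for L
    using digit_sum_padic_phi_plus(1)[OF p0 \<sigma>, of L] S[OF that] by simp
  have lim: "(\<lambda>L. digit_sum p ?z n + 1 / real p ^ n - 1 / real p ^ L) \<longlonglongrightarrow> digit_sum p ?z n + 1 / real p ^ n - 0"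
  proof (intro tendsto_intros)
    have "(\<lambda>L. (1 / real p) ^ L) \<longlonglongrightarrow> 0" using p by (intro LIMSEQ_power_zero) simp
    then show "(\<lambda>L. 1 / real p ^ L) \<longlonglongrightarrow> 0" by (simp add: power_divide)
  qed
  have "digit_sum p ?z n + 1 / real p ^ n - 0 \<le> \<sigma>"
    by (rule LIMSEQ_le_const2[OF lim]) (intro exI[of _ n] allI impI le)
  then show False using digit_sum_padic_phi_plus(2)[OF p0 \<sigma>, of n] by simp
qed

text \<open>
  Reduces statements about shifted points to statements about finitely many digits, where the
  shift acts as addition modulo \<open>p\<^sup>L\<close>.
\<close>

lemma padic_shift_tendsto:
  assumes p: "p \<ge> 2" and \<sigma>: "0 \<le> \<sigma>" "\<sigma> < 1"
  shows "(\<lambda>L. vdc p L (n + shift_digits p \<sigma> L)) \<longlonglongrightarrow> padic_shift p (radical_inverse p n) \<sigma>"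
proof -
  let ?w = "shifted_digits p n \<sigma>"
  let ?f = "\<lambda>r. real (?w r) / real p ^ (r + 1)"
  let ?g = "\<lambda>r. (real p - 1) / real p ^ (r + 1)"
  have p0: "p > 0" using p by simp
  have le: "?f r \<le> ?g r" for r
    using padic_add_less[OF p0, of "padic_phi_plus p (radical_inverse p n)" "padic_phi_plus p \<sigma>" r]
    by (intro divide_right_mono) auto
  note g = geometric_digits_sums[OF p]
  have sf: "summable ?f"
    by (rule summable_comparison_test'[OF sums_summable[OF g], of 0]) (use le in auto)
  have sd: "summable (\<lambda>r. ?g r - ?f r)" by (intro summable_diff sums_summable[OF g] sf)
  obtain k where k: "?w k < p - 1" using not_all_digits_maximal[OF p \<sigma>] by blast
  have "0 < (\<Sum>r. ?g r - ?f r)"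
  proof (rule suminf_pos2[OF sd])
    show "0 \<le> ?g r - ?f r" for r using le[of r] by simp
    have "real (?w k) < real p - 1" using k by linarith
    then show "0 < ?g k - ?f k" using p0 by (simp add: divide_strict_right_mono)
  qed
  also have "(\<Sum>r. ?g r - ?f r) = 1 - (\<Sum>r. ?f r)"
    using suminf_diff[OF sums_summable[OF g] sf] sums_unique[OF g] by simp
  finally have lt: "(\<Sum>r. ?f r) < 1" by simp
  have "0 \<le> (\<Sum>r. ?f r)" by (rule suminf_nonneg[OF sf]) simp
  then have "padic_shift p (radical_inverse p n) \<sigma> = (\<Sum>r. ?f r)"
    using lt unfolding padic_shift_def padic_phi_def by (simp add: frac_eq)
  moreover have "(\<lambda>L. digit_sum p ?w L) \<longlonglongrightarrow> (\<Sum>r. ?f r)"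
    using summable_LIMSEQ[OF sf] unfolding digit_sum_def .
  ultimately show ?thesis by (simp add: digit_sum_shifted[OF p])
qed

lemma padic_shift_bounds: "0 \<le> padic_shift p x \<sigma>" "padic_shift p x \<sigma> < 1"
  by (simp_all add: padic_shift_def padic_phi_def frac_lt_1)

section \<open>Expectation over the shift\<close>

lemma sum_periodic_shift:
  fixes h :: "nat \<Rightarrow> real"
  assumes "\<And>z. h (z + M) = h z" shows "(\<Sum>z<M. h (z + c)) = (\<Sum>z<M. h z)"
proof (induction c)
  case (Suc c)
  have "(\<Sum>z<Suc M. h (z + c)) = h c + (\<Sum>z<M. h (z + Suc c))"
    by (subst sum.lessThan_Suc_shift) simp
  moreover have "(\<Sum>z<Suc M. h (z + c)) = (\<Sum>z<M. h (z + c)) + h c"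
    using assms[of c] by (simp add: add.commute)
  ultimately show ?case using Suc by simp
qed simp

lemma vdc_periodic: "vdc p L (w + p ^ L) = vdc p L w"
  by (metis vdc_mod mod_add_self2)

lemma sum_vdc_shift: "(\<Sum>z<p ^ L. f (vdc p L (z + c))) = (\<Sum>z<p ^ L. f (vdc p L z) :: real)"
  by (rule sum_periodic_shift) (simp add: vdc_periodic)

lemma sum_vdc:
  assumes "p > 0" shows "(\<Sum>z<p ^ L. vdc p L z) = (real p ^ L - 1) / 2"
proof (induction L)
  case (Suc L)
  have digits: "2 * (\<Sum>a<p. real a) = real p * (real p - 1)"
    by (induction p) (auto simp: algebra_simps)
  have "(\<Sum>z<p ^ Suc L. vdc p (Suc L) z) = (\<Sum>a<p. \<Sum>z<p ^ L. vdc p (Suc L) (a + p * z))"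
    unfolding power_Suc by (rule sum_lessThan_mult)
  also have "\<dots> = (\<Sum>a<p. \<Sum>z<p ^ L. (real a + vdc p L z) / real p)"
    by (intro sum.cong refl) simp
  also have "\<dots> = (\<Sum>a<p. (real p ^ L * real a + (real p ^ L - 1) / 2) / real p)"
    unfolding sum_divide_distrib[symmetric] by (simp add: sum.distrib Suc)
  also have "\<dots> = (real p ^ L * (\<Sum>a<p. real a) + real p * ((real p ^ L - 1) / 2)) / real p"
    unfolding sum_divide_distrib[symmetric] by (simp add: sum.distrib sum_distrib_left)
  also have "\<dots> = (real p ^ L * (real p * (real p - 1) / 2) + real p * ((real p ^ L - 1) / 2)) / real p"
    using digits by simp
  also have "\<dots> = (real p ^ Suc L - 1) / 2" using assms by (simp add: field_simps)
  finally show ?case .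
qed simp

text \<open>
  After a translation the second digit is \<open>a\<close> itself. Then the distance is \<open>r\<close> for the \<open>p - r\<close>
  digits without wrap-around and \<open>p - r\<close> for the other \<open>r\<close>.
\<close>

lemma sum_cyclic_digit_distance:
  assumes p: "p \<ge> 2" and r: "int r = (int n - int m) mod int p"
  shows "(\<Sum>a<p. \<bar>real ((a + n) mod p) - real ((a + m) mod p)\<bar>) = 2 * real r * (real p - real r)"
proof -
  define h where "h a = \<bar>real ((a + n) mod p) - real ((a + m) mod p)\<bar>" for a
  have "int r < int p" unfolding r using p by simp
  then have rp: "r < p" by simp
  (* Translating by -m modulo p; p * m is added to stay within the natural numbers. *)
  define c where "c = p * m - m"
  have cm: "c + m = p * m" using p by (simp add: c_def)
  have "(a + c + m) mod p = a" if "a < p" for a using that by (simp add: add.assoc cm)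
  moreover have "(a + c + n) mod p = (a + r) mod p" for a
  proof -
    have "int (a + c + n) = (int a + (int n - int m)) + int p * int m"
      using arg_cong[OF cm, of int] by simp
    then have "int (a + c + n) mod int p = (int a + (int n - int m)) mod int p"
      by (simp only: mod_mult_self2)
    also have "\<dots> = (int a + int r) mod int p" unfolding r by (rule mod_add_right_eq[symmetric])
    finally show ?thesis by (metis of_nat_add of_nat_eq_iff of_nat_mod)
  qed
  ultimately have hc: "h (a + c) = \<bar>real ((a + r) mod p) - real a\<bar>" if "a < p" for a
    using that by (simp add: h_def)
  have hd: "\<bar>real ((a + r) mod p) - real a\<bar> = (if a < p - r then real r else real p - real r)" if "a < p" for a
  proof (cases "a < p - r")
    case False
    then have "(a + r) mod p = a + r - p" using that rp by (simp add: le_mod_geq)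
    then show ?thesis using False rp that by (simp add: of_nat_diff)
  qed simp
  have "(\<Sum>a<p. h a) = (\<Sum>a<p. h (a + c))"
  proof (rule sum_periodic_shift[symmetric])
    have "(z + p + k) mod p = (z + k) mod p" for z k
      using mod_add_self2[of "z + k" p] by (simp only: add.assoc add.commute[of p k])
    then show "h (z + p) = h z" for z by (simp only: h_def)
  qed
  also have "\<dots> = (\<Sum>a<p. if a < p - r then real r else real p - real r)"
    by (rule sum.cong) (simp_all add: hc hd)
  also have "\<dots> = (\<Sum>a<p - r. real r) + (\<Sum>a\<in>{p - r..<p}. real p - real r)"
  proof -
    have "{..<p} = {..<p - r} \<union> {p - r..<p}" using rp by auto
    then show ?thesis by (simp add: sum.union_disjoint ivl_disj_int)
  qed
  also have "\<dots> = 2 * real r * (real p - real r)" using rp by (simp add: of_nat_diff algebra_simps)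
  finally show ?thesis unfolding h_def .
qed

text \<open>
  The last term is what the shells beyond \<open>L\<close> would add if \<open>d\<close> were zero; with it the recursion
  over \<open>L\<close> is exact.
\<close>

definition truncated_shells :: "nat \<Rightarrow> nat \<Rightarrow> int \<Rightarrow> real" where
  "truncated_shells p L d = (\<Sum>g=1..L. shell p g d) + (if int p ^ L dvd d then 1 / (6 * real p ^ L) else 0)"

lemma shell_Suc:
  assumes p: "p \<ge> 2" and g: "g \<ge> 1"
  shows "shell p (Suc g) d = (if int p dvd d then shell p g (d div int p) / real p else 0)"
proof (cases "int p dvd d")
  case True
  then obtain e where d: "d = int p * e" by (rule dvdE)
  have gp: "int p ^ g = int p * int p ^ (g - 1)" using g by (simp add: power_eq_if)
  have "int p ^ g dvd d \<longleftrightarrow> int p ^ (g - 1) dvd e" unfolding d gp using p by simp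
  moreover have "d div int p ^ g = e div int p ^ (g - 1)" unfolding d gp using p by simp
  moreover have "real p ^ g = real p * real p ^ (g - 1)" using g by (simp add: power_eq_if)
  ultimately show ?thesis using True p by (simp add: shell_def d)
next
  case False
  have "int p dvd int p ^ g" using g by (simp add: dvd_power)
  then have "\<not> int p ^ g dvd d" using False dvd_trans by blast
  then show ?thesis using False by (simp add: shell_def)
qed

lemma truncated_shells_Suc:
  assumes p: "p \<ge> 2"
  shows "truncated_shells p (Suc L) d = digit_coeff p (d mod int p) +
    (if int p dvd d then truncated_shells p L (d div int p) / real p else 0)"
proof -
  have "(\<Sum>g=1..Suc L. shell p g d) = shell p 1 d + (\<Sum>g=1..L. shell p (Suc g) d)"
    by (simp add: sum.atLeast_Suc_atMost sum.shift_bounds_cl_Suc_ivl del: sum.cl_ivl_Suc)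
  also have "(\<Sum>g=1..L. shell p (Suc g) d) = (if int p dvd d then (\<Sum>g=1..L. shell p g (d div int p)) / real p else 0)"
    by (simp add: shell_Suc[OF p] sum_divide_distrib)
  also have "shell p 1 d = digit_coeff p (d mod int p)" by (simp add: shell_def)
  finally have 1: "(\<Sum>g=1..Suc L. shell p g d) = digit_coeff p (d mod int p) +
    (if int p dvd d then (\<Sum>g=1..L. shell p g (d div int p)) / real p else 0)" .
  have 2: "int p ^ Suc L dvd d \<longleftrightarrow> int p dvd d \<and> int p ^ L dvd d div int p"
  proof (cases "int p dvd d")
    case True
    then obtain e where d: "d = int p * e" by (rule dvdE)
    show ?thesis unfolding d using p by simp
  next
    case False
    then show ?thesis by (metis dvd_mult_left power_Suc)
  qed
  show ?thesis unfolding truncated_shells_def 1 2 by (simp add: add_divide_distrib)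
qed

text \<open>
  Compare the leading digits of the two points. If \<open>n\<close> and \<open>m\<close> agree modulo \<open>p\<close> they are
  equal, and the distance is that of the remaining digits, scaled by \<open>1 / p\<close>. Otherwise the leading
  digits decide which point is larger, and the contributions of the remaining digits cancel on average
  as both points are equidistributed.
\<close>

lemma spread_eq:
  assumes p: "p \<ge> 2"
  shows "(\<Sum>z<p ^ L. \<bar>vdc p L (z + n) - vdc p L (z + m)\<bar>) =
    real p ^ L * (1/3 - 2 * truncated_shells p L (int n - int m))"
proof (induction L arbitrary: n m)
  case 0 then show ?case by (simp add: truncated_shells_def)
next
  case (Suc L)
  let ?d = "int n - int m"
  have p0: "real p > 0" using p by simp
  have vdc_step: "vdc p (Suc L) (a + p * z + k) = (real ((a + k) mod p) + vdc p L (z + (a + k) div p)) / real p" for a z k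
  proof -
    have "a + p * z + k = (a + k) + z * p" by simp
    then have "(a + p * z + k) mod p = (a + k) mod p" "(a + p * z + k) div p = z + (a + k) div p"
      using p by (simp_all only: mod_mult_self1 div_mult_self1)
    then show ?thesis by simp
  qed
  have expand: "(\<Sum>z<p ^ Suc L. \<bar>vdc p (Suc L) (z + n) - vdc p (Suc L) (z + m)\<bar>) =
    (\<Sum>a<p. (\<Sum>z<p ^ L. \<bar>(real ((a + n) mod p) - real ((a + m) mod p)) +
       (vdc p L (z + (a + n) div p) - vdc p L (z + (a + m) div p))\<bar>) / real p)"
  proof -
    have "(\<Sum>z<p ^ Suc L. \<bar>vdc p (Suc L) (z + n) - vdc p (Suc L) (z + m)\<bar>) =
      (\<Sum>a<p. \<Sum>z<p ^ L. \<bar>vdc p (Suc L) (a + p * z + n) - vdc p (Suc L) (a + p * z + m)\<bar>)"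
      unfolding power_Suc by (rule sum_lessThan_mult)
    also have "\<dots> = (\<Sum>a<p. \<Sum>z<p ^ L. \<bar>(real ((a + n) mod p) - real ((a + m) mod p)) +
       (vdc p L (z + (a + n) div p) - vdc p L (z + (a + m) div p))\<bar> / real p)"
    proof (intro sum.cong refl)
      fix a z
      have "vdc p (Suc L) (a + p * z + n) - vdc p (Suc L) (a + p * z + m) =
        ((real ((a + n) mod p) - real ((a + m) mod p)) +
        (vdc p L (z + (a + n) div p) - vdc p L (z + (a + m) div p))) / real p"
        unfolding vdc_step by (simp add: diff_divide_distrib add_divide_distrib)
      then show "\<bar>vdc p (Suc L) (a + p * z + n) - vdc p (Suc L) (a + p * z + m)\<bar> =
        \<bar>(real ((a + n) mod p) - real ((a + m) mod p)) +
        (vdc p L (z + (a + n) div p) - vdc p L (z + (a + m) div p))\<bar> / real p" by simp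
    qed
    finally show ?thesis by (simp add: sum_divide_distrib)
  qed
  show ?case
  proof (cases "int p dvd ?d")
    case True
    then obtain e where e: "?d = int p * e" by (rule dvdE)
    have same: "(a + n) mod p = (a + m) mod p" for a
    proof -
      have "int (a + n) mod int p = int (a + m) mod int p" using True by (simp add: mod_eq_dvd_iff)
      then show ?thesis by (metis of_nat_eq_iff of_nat_mod)
    qed
    have diff: "int ((a + n) div p) - int ((a + m) div p) = e" for a
    proof -
      have "int p * int ((a + n) div p) + int ((a + n) mod p) = int (a + n)"
        "int p * int ((a + m) div p) + int ((a + m) mod p) = int (a + m)"
        by (simp_all only: of_nat_mult[symmetric] of_nat_add[symmetric] mult_div_mod_eq)
      then have "int p * (int ((a + n) div p) - int ((a + m) div p)) = int p * e"
        using e same[of a] unfolding right_diff_distrib by linarith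
      then show ?thesis using p by simp
    qed
    have "(\<Sum>z<p ^ Suc L. \<bar>vdc p (Suc L) (z + n) - vdc p (Suc L) (z + m)\<bar>) =
      (\<Sum>a<p. real p ^ L * (1/3 - 2 * truncated_shells p L e) / real p)"
      unfolding expand same by (simp add: Suc.IH diff)
    also have "\<dots> = real p ^ L * (1/3 - 2 * truncated_shells p L e)" using p by simp
    also have "truncated_shells p (Suc L) ?d = 1/6 - 1 / (6 * real p) + truncated_shells p L e / real p"
      using p by (simp add: truncated_shells_Suc e digit_coeff_def)
    then have "real p * (1/3 - 2 * truncated_shells p (Suc L) ?d) = 1/3 - 2 * truncated_shells p L e"
      using p0 by (simp add: field_simps)
    then have "real p ^ L * (1/3 - 2 * truncated_shells p L e) =
      real p ^ Suc L * (1/3 - 2 * truncated_shells p (Suc L) ?d)"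
      by (simp only: power_Suc2 mult.assoc)
    finally show ?thesis .
  next
    case False
    define r where "r = nat (?d mod int p)"
    have r: "int r = ?d mod int p" using p by (simp add: r_def)
    have "?d mod int p \<noteq> 0" using False by (simp add: dvd_eq_mod_eq_0)
    have inner: "(\<Sum>z<p ^ L. \<bar>(real ((a + n) mod p) - real ((a + m) mod p)) +
       (vdc p L (z + (a + n) div p) - vdc p L (z + (a + m) div p))\<bar>) =
       real p ^ L * \<bar>real ((a + n) mod p) - real ((a + m) mod p)\<bar>" for a
    proof -
      let ?u = "(a + n) mod p" and ?v = "(a + m) mod p"
      let ?e = "\<lambda>z. vdc p L (z + (a + n) div p) - vdc p L (z + (a + m) div p)"
      have ne: "?u \<noteq> ?v"
      proof
        assume "?u = ?v"
        then have "int (a + n) mod int p = int (a + m) mod int p" by (metis of_nat_mod)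
        then show False using False by (simp add: mod_eq_dvd_iff)
      qed
      have e0: "(\<Sum>z<p ^ L. ?e z) = 0"
        using sum_vdc_shift[where f="\<lambda>x. x"] by (simp add: sum_subtractf)
      have e1: "\<bar>?e z\<bar> < 1" for z
        using vdc_bounds[OF p, of L "z + (a + n) div p"] vdc_bounds[OF p, of L "z + (a + m) div p"] by linarith
      show ?thesis
      proof (cases "?u > ?v")
        case True
        then have 1: "1 \<le> real ?u - real ?v" by linarith
        have "\<bar>(real ?u - real ?v) + ?e z\<bar> = (real ?u - real ?v) + ?e z" for z
          using 1 e1[of z] by linarith
        then show ?thesis using 1 e0 by (simp only: sum.distrib) simp
      next
        case F: False
        then have 1: "1 \<le> real ?v - real ?u" using ne by linarith
        have "\<bar>(real ?u - real ?v) + ?e z\<bar> = (real ?v - real ?u) - ?e z" for z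
          using 1 e1[of z] by linarith
        then show ?thesis using 1 e0 by (simp only: sum_subtractf) (simp add: algebra_simps)
      qed
    qed
    have "(\<Sum>z<p ^ Suc L. \<bar>vdc p (Suc L) (z + n) - vdc p (Suc L) (z + m)\<bar>) =
       real p ^ L * (\<Sum>a<p. \<bar>real ((a + n) mod p) - real ((a + m) mod p)\<bar>) / real p"
      unfolding expand inner by (simp add: sum_distrib_left sum_divide_distrib)
    also have "\<dots> = real p ^ L * (2 * real r * (real p - real r)) / real p"
      by (simp only: sum_cyclic_digit_distance[OF p r])
    also have "\<dots> = real p ^ Suc L * (1/3 - 2 * truncated_shells p (Suc L) ?d)"
    proof -
      have "truncated_shells p (Suc L) ?d = 1/6 - real r * (real p - real r) / (real p)\<^sup>2"
        using False r[symmetric] \<open>?d mod int p \<noteq> 0\<close>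
        by (simp add: truncated_shells_Suc[OF p] digit_coeff_def)
      then have "real p * (1/3 - 2 * truncated_shells p (Suc L) ?d) = 2 * (real r * (real p - real r)) / real p"
        using p0 by (simp add: field_simps power2_eq_square)
      then show ?thesis by (simp only: power_Suc2 mult.assoc times_divide_eq_right)
    qed
    finally show ?thesis .
  qed
qed

text \<open>
  Since \<open>min (1 - a) (1 - b) = 1 - (a + b) / 2 - \<bar>a - b\<bar> / 2\<close>, only the mean distance matters.
\<close>

lemma mean_min_vdc:
  assumes p: "p \<ge> 2"
  shows "(\<Sum>z<p ^ L. min (1 - vdc p L (n + z)) (1 - vdc p L (m + z))) / real p ^ L =
    1/3 + 1 / (2 * real p ^ L) + truncated_shells p L (int n - int m)"
proof -
  have pL: "real p ^ L > 0" using p by simp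
  have "min (1 - a) (1 - b) = 1 - (a + b) / 2 - \<bar>a - b\<bar> / 2" for a b :: real by (simp add: min_def abs_if field_simps)
  then have "(\<Sum>z<p ^ L. min (1 - vdc p L (n + z)) (1 - vdc p L (m + z))) =
     real p ^ L - ((\<Sum>z<p ^ L. vdc p L (z + n)) + (\<Sum>z<p ^ L. vdc p L (z + m))) / 2
     - (\<Sum>z<p ^ L. \<bar>vdc p L (z + n) - vdc p L (z + m)\<bar>) / 2"
    by (simp add: sum_subtractf sum.distrib sum_divide_distrib add.commute add_divide_distrib)
  also have "\<dots> = real p ^ L - (real p ^ L - 1) / 2
     - real p ^ L * (1/3 - 2 * truncated_shells p L (int n - int m)) / 2"
    using sum_vdc_shift[where f="\<lambda>x. x" and p=p and L=L] sum_vdc[of p L] p by (simp add: spread_eq)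
  finally have e: "(\<Sum>z<p ^ L. min (1 - vdc p L (n + z)) (1 - vdc p L (m + z))) = \<dots>" .
  show ?thesis unfolding e using pL by (simp add: field_simps)
qed

abbreviation vdc_interval :: "nat \<Rightarrow> nat \<Rightarrow> nat \<Rightarrow> real set" where
  "vdc_interval p L z \<equiv> {vdc p L z..<vdc p L z + 1 / real p ^ L}"

lemma vdc_interval_subset:
  assumes p: "p \<ge> 2" shows "vdc_interval p L z \<subseteq> {0..<1}"
proof -
  let ?d = "\<lambda>r. z div p ^ r mod p"
  have "digit_sum p ?d L + 1 / real p ^ L \<le> digit_sum p ?d 0 + 1 / real p ^ 0"
    by (rule digit_sum_upper) (use p in auto)
  moreover have "vdc p L z = digit_sum p ?d L"
    using vdc_digit_nat[of ?d p L] p by (simp add: digit_nat_digits vdc_mod)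
  ultimately show ?thesis using vdc_bounds(1)[OF p, of L z] by (auto simp: digit_sum_def)
qed

text \<open>
  The first \<open>L\<close> digits of a uniformly distributed shift are uniformly distributed, since each
  value corresponds to an interval of length \<open>p\<^sup>-\<^sup>L\<close>.
\<close>

lemma shift_digits_eq_iff:
  assumes p: "p \<ge> 2" and \<sigma>: "0 \<le> \<sigma>" "\<sigma> < 1" and z: "z < p ^ L"
  shows "shift_digits p \<sigma> L = z \<longleftrightarrow> \<sigma> \<in> vdc_interval p L z"
proof
  have p0: "p > 0" using p by simp
  assume "shift_digits p \<sigma> L = z"
  then have "vdc p L z = digit_sum p (padic_phi_plus p \<sigma>) L"
    using vdc_digit_nat[of "padic_phi_plus p \<sigma>" p L] padic_phi_plus_less[OF p0] by simp
  then show "\<sigma> \<in> vdc_interval p L z" using digit_sum_padic_phi_plus[OF p0 \<sigma>, of L] by simp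
next
  assume I: "\<sigma> \<in> vdc_interval p L z"
  let ?d = "\<lambda>r. z div p ^ r mod p"
  have dp: "?d r < p" for r using p by simp
  have v: "vdc p L z = digit_sum p ?d L"
    using vdc_digit_nat[of ?d p L] p by (simp add: digit_nat_digits vdc_mod)
  have "padic_phi_plus p \<sigma> r = ?d r" if r: "r < L" for r
  proof (rule digit_unique)
    show "digit_sum p ?d (Suc r) \<le> \<sigma>"
      using digit_sum_mono[of "Suc r" L p ?d] r I v by simp
    show "\<sigma> < digit_sum p ?d (Suc r) + 1 / real p ^ Suc r"
      using digit_sum_upper[of ?d p "Suc r" L] dp r I v by simp
  qed (rule dp)
  then have "shift_digits p \<sigma> L = digit_nat p ?d L" by (simp add: digit_nat_def)
  then show "shift_digits p \<sigma> L = z" using z by (simp add: digit_nat_digits)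
qed

lemma shift_digits_expand:
  assumes p: "p \<ge> 2"
  shows "indicator {0..<1} \<sigma> *\<^sub>R F (shift_digits p \<sigma> L) =
    (\<Sum>z<p ^ L. F z * indicator (vdc_interval p L z) \<sigma> :: real)"
proof (cases "\<sigma> \<in> {0..<1}")
  case True
  have "shift_digits p \<sigma> L < p ^ L" using p by (intro digit_nat_less padic_phi_plus_less) simp
  moreover have "indicator (vdc_interval p L z) \<sigma> = (if z = shift_digits p \<sigma> L then 1 else 0 :: real)"
    if "z < p ^ L" for z using shift_digits_eq_iff[OF p _ _ that, of \<sigma>] True by (auto simp: indicator_def)
  then have "(\<Sum>z<p ^ L. F z * indicator (vdc_interval p L z) \<sigma>) =
      (\<Sum>z<p ^ L. if z = shift_digits p \<sigma> L then F z else 0)"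
    by (intro sum.cong) (simp_all del: indicator_simps)
  ultimately have "(\<Sum>z<p ^ L. F z * indicator (vdc_interval p L z) \<sigma>) = F (shift_digits p \<sigma> L)"
    by (simp add: sum.delta)
  then show ?thesis using True by simp
next
  case False
  then have "indicator (vdc_interval p L z) \<sigma> = (0::real)" for z
  proof -
    have "\<sigma> \<notin> vdc_interval p L z" using vdc_interval_subset[OF p, of L z] False by blast
    then show ?thesis by (rule indicator_simps(2))
  qed
  then show ?thesis using False by simp
qed

lemma shift_digits_measurable:
  assumes p: "p \<ge> 2"
  shows "(\<lambda>\<sigma>. indicator {0..<1} \<sigma> *\<^sub>R (F (shift_digits p \<sigma> L) :: real)) \<in> borel_measurable lborel"
  unfolding shift_digits_expand[OF p] by measurable

lemma shift_digits_integral: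
  assumes p: "p \<ge> 2"
  shows "(LINT \<sigma>:{0..<1}|lborel. F (shift_digits p \<sigma> L)) = (\<Sum>z<p ^ L. F z :: real) / real p ^ L"
proof -
  have "(LINT \<sigma>:{0..<1}|lborel. F (shift_digits p \<sigma> L)) =
    (\<integral>\<sigma>. (\<Sum>z<p ^ L. F z * indicator (vdc_interval p L z) \<sigma>) \<partial>lborel)"
    unfolding set_lebesgue_integral_def shift_digits_expand[OF p] ..
  also have "\<dots> = (\<Sum>z<p ^ L. F z * (1 / real p ^ L))"
  proof (subst Bochner_Integration.integral_sum)
    show "integrable lborel (\<lambda>\<sigma>. F z * indicator (vdc_interval p L z) \<sigma>)" for z
      by (intro integrable_mult_right integrable_real_indicator) (auto simp: emeasure_lborel_Ico)
  qed (simp add: measure_lborel_Ico)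
  finally show ?thesis by (simp add: sum_divide_distrib)
qed

text \<open>
  Expectations over the shift are limits of averages over all values of the first \<open>L\<close> digits.
\<close>

lemma shifted_bounded_convergence:
  fixes f :: "real \<Rightarrow> real" and F :: "nat \<Rightarrow> nat \<Rightarrow> real"
  assumes p: "p \<ge> 2"
    and lim: "\<And>\<sigma>. 0 \<le> \<sigma> \<Longrightarrow> \<sigma> < 1 \<Longrightarrow> (\<lambda>L. F L (shift_digits p \<sigma> L)) \<longlonglongrightarrow> f \<sigma>"
    and bound: "\<And>L z. \<bar>F L z\<bar> \<le> B"
  shows "set_integrable lborel {0..<1} f"
    "(\<lambda>L. (\<Sum>z<p ^ L. F L z) / real p ^ L) \<longlonglongrightarrow> (LINT \<sigma>:{0..<1}|lborel. f \<sigma>)"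
proof -
  let ?u = "\<lambda>L \<sigma>. indicator {0..<1} \<sigma> *\<^sub>R F L (shift_digits p \<sigma> L)"
  let ?v = "\<lambda>\<sigma>. indicator {0..<1} \<sigma> *\<^sub>R f \<sigma>"
  have conv: "(\<lambda>L. ?u L \<sigma>) \<longlonglongrightarrow> ?v \<sigma>" for \<sigma>
    using lim[of \<sigma>] by (cases "\<sigma> \<in> {0..<1}") auto
  have u_meas: "?u L \<in> borel_measurable lborel" for L by (rule shift_digits_measurable[OF p])
  have v_meas: "?v \<in> borel_measurable lborel"
    by (rule borel_measurable_LIMSEQ_real[OF conv u_meas])
  have w: "integrable lborel (\<lambda>\<sigma>. B * indicator {0..<1::real} \<sigma>)"
    by (intro integrable_mult_right integrable_real_indicator) (auto simp: emeasure_lborel_Ico)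
  have dom: "norm (?u L \<sigma>) \<le> B * indicator {0..<1} \<sigma>" for L \<sigma>
    using bound[of L "shift_digits p \<sigma> L"] by (auto simp: indicator_def)
  have "integrable lborel ?v"
    by (rule integrable_dominated_convergence[where s="?u", OF v_meas u_meas w]) (use conv dom in auto)
  then show "set_integrable lborel {0..<1} f" by (simp add: set_integrable_def)
  have "(\<lambda>L. \<integral>\<sigma>. ?u L \<sigma> \<partial>lborel) \<longlonglongrightarrow> (\<integral>\<sigma>. ?v \<sigma> \<partial>lborel)"
    by (rule integral_dominated_convergence[where s="?u", OF v_meas u_meas w]) (use conv dom in auto)
  then show "(\<lambda>L. (\<Sum>z<p ^ L. F L z) / real p ^ L) \<longlonglongrightarrow> (LINT \<sigma>:{0..<1}|lborel. f \<sigma>)"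
    by (simp only: set_lebesgue_integral_def[symmetric] shift_digits_integral[OF p])
qed

theorem shifted_pair_expectation:
  assumes p: "p \<ge> 2"
  defines "y \<equiv> \<lambda>n \<sigma>. padic_shift p (radical_inverse p n) \<sigma>"
  shows "set_integrable lborel {0..<1} (\<lambda>\<sigma>. 1 + g * min (1 - y n \<sigma>) (1 - y m \<sigma>))"
    "(\<lambda>L. 1 + g * (1/3 + (\<Sum>k=1..L. shell p k (int n - int m)))) \<longlonglongrightarrow>
      (LINT \<sigma>:{0..<1}|lborel. 1 + g * min (1 - y n \<sigma>) (1 - y m \<sigma>))"
proof -
  let ?F = "\<lambda>L z. 1 + g * min (1 - vdc p L (n + z)) (1 - vdc p L (m + z))"
  have lim: "(\<lambda>L. ?F L (shift_digits p \<sigma> L)) \<longlonglongrightarrow> 1 + g * min (1 - y n \<sigma>) (1 - y m \<sigma>)"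
    if "0 \<le> \<sigma>" "\<sigma> < 1" for \<sigma>
    unfolding y_def by (intro tendsto_intros padic_shift_tendsto[OF p that])
  have bound: "\<bar>?F L z\<bar> \<le> 1 + \<bar>g\<bar>" for L z
  proof -
    have "\<bar>min (1 - vdc p L (n + z)) (1 - vdc p L (m + z))\<bar> \<le> 1"
      using vdc_bounds[OF p, of L "n + z"] vdc_bounds[OF p, of L "m + z"] by (simp add: min_def abs_if)
    then have "\<bar>g * min (1 - vdc p L (n + z)) (1 - vdc p L (m + z))\<bar> \<le> \<bar>g\<bar>"
      by (simp add: abs_mult mult_left_le)
    then show ?thesis by linarith
  qed
  note conv = shifted_bounded_convergence[where F="?F" and f="\<lambda>\<sigma>. 1 + g * min (1 - y n \<sigma>) (1 - y m \<sigma>)", OF p lim bound]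
  show "set_integrable lborel {0..<1} (\<lambda>\<sigma>. 1 + g * min (1 - y n \<sigma>) (1 - y m \<sigma>))" by (rule conv(1))
  have mean: "(\<Sum>z<p ^ L. ?F L z) / real p ^ L =
      1 + g * (1/3 + 1 / (2 * real p ^ L) + truncated_shells p L (int n - int m))" for L
  proof -
    have "(\<Sum>z<p ^ L. ?F L z) / real p ^ L =
      1 + g * ((\<Sum>z<p ^ L. min (1 - vdc p L (n + z)) (1 - vdc p L (m + z))) / real p ^ L)"
      using p by (simp add: sum.distrib sum_distrib_left[symmetric] add_divide_distrib)
    then show ?thesis by (simp only: mean_min_vdc[OF p])
  qed
  have "(\<lambda>L. (1 / real p) ^ L) \<longlonglongrightarrow> 0" using p by (intro LIMSEQ_power_zero) simp
  then have small: "(\<lambda>L. 1 / real p ^ L) \<longlonglongrightarrow> 0" by (simp add: power_divide)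
  (* What separates the averages over L digits from the partial sums of the shell series. *)
  define err where "err L = g * (1 / (2 * real p ^ L) + (if int p ^ L dvd int n - int m then 1 / (6 * real p ^ L) else 0))" for L
  have err: "err \<longlonglongrightarrow> 0"
  proof (rule Lim_null_comparison)
    show "(\<lambda>L. \<bar>g\<bar> * (1 / real p ^ L)) \<longlonglongrightarrow> 0" using tendsto_mult_left[OF small, of "\<bar>g\<bar>"] by simp
    show "\<forall>\<^sub>F L in sequentially. norm (err L) \<le> \<bar>g\<bar> * (1 / real p ^ L)"
      using p by (intro always_eventually allI)
        (auto simp: err_def abs_mult intro!: mult_left_mono, auto simp: field_simps)
  qed
  have "(\<lambda>L. (\<Sum>z<p ^ L. ?F L z) / real p ^ L - err L) \<longlonglongrightarrow>
      (LINT \<sigma>:{0..<1}|lborel. 1 + g * min (1 - y n \<sigma>) (1 - y m \<sigma>)) - 0"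
    by (intro tendsto_diff conv(2) err)
  moreover have "(\<Sum>z<p ^ L. ?F L z) / real p ^ L - err L = 1 + g * (1/3 + (\<Sum>k=1..L. shell p k (int n - int m)))" for L
    unfolding mean err_def truncated_shells_def by (simp add: algebra_simps)
  ultimately show "(\<lambda>L. 1 + g * (1/3 + (\<Sum>k=1..L. shell p k (int n - int m)))) \<longlonglongrightarrow>
      (LINT \<sigma>:{0..<1}|lborel. 1 + g * min (1 - y n \<sigma>) (1 - y m \<sigma>))" by simp
qed

text \<open>
  A shifted point and the shift itself have the same averages over the first \<open>L\<close> digits,
  because adding \<open>n\<close> permutes the residues modulo \<open>p\<^sup>L\<close>. So shifted points are uniformly distributed.
\<close>

theorem shifted_point_expectation:
  assumes p: "p \<ge> 2"
  defines "y \<equiv> \<lambda>n \<sigma>. padic_shift p (radical_inverse p n) \<sigma>"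
  shows "set_integrable lborel {0..<1} (\<lambda>\<sigma>. 1 + g * ((1 - (y n \<sigma>)\<^sup>2) / 2))"
    "(LINT \<sigma>:{0..<1}|lborel. 1 + g * ((1 - (y n \<sigma>)\<^sup>2) / 2)) = 1 + g * (1/3)"
proof -
  let ?q = "\<lambda>x. 1 + g * ((1 - x\<^sup>2) / 2)"
  have bound: "\<bar>?q (vdc p L w)\<bar> \<le> 1 + \<bar>g\<bar>" for L w
  proof -
    have "(vdc p L w)\<^sup>2 \<le> 1" using vdc_bounds[OF p, of L w] by (simp add: power_le_one)
    moreover have "\<bar>(1 - t) / 2\<bar> \<le> 1" if "0 \<le> t" "t \<le> 1" for t :: real
      using that by (simp add: abs_le_iff)
    ultimately have "\<bar>(1 - (vdc p L w)\<^sup>2) / 2\<bar> \<le> 1" by (metis zero_le_power2)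
    from mult_left_le[OF this abs_ge_zero[of g]] have "\<bar>g * ((1 - (vdc p L w)\<^sup>2) / 2)\<bar> \<le> \<bar>g\<bar>" unfolding abs_mult .
    then show ?thesis by linarith
  qed
  have lim: "(\<lambda>L. ?q (vdc p L (n + shift_digits p \<sigma> L))) \<longlonglongrightarrow> ?q (y n \<sigma>)" if "0 \<le> \<sigma>" "\<sigma> < 1" for \<sigma>
    unfolding y_def by (intro tendsto_intros padic_shift_tendsto[OF p that]) auto
  have "(\<lambda>L. (1 / real p) ^ L) \<longlonglongrightarrow> 0" using p by (intro LIMSEQ_power_zero) simp
  then have small: "(\<lambda>L. 1 / real p ^ L) \<longlonglongrightarrow> 0" by (simp add: power_divide)
  have id_lim: "(\<lambda>L. vdc p L (shift_digits p \<sigma> L)) \<longlonglongrightarrow> \<sigma>" if \<sigma>: "0 \<le> \<sigma>" "\<sigma> < 1" for \<sigma>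
  proof (rule LIM_zero_cancel, rule Lim_null_comparison[OF _ small], rule always_eventually, rule allI)
    fix L
    have p0: "p > 0" using p by simp
    show "norm (vdc p L (shift_digits p \<sigma> L) - \<sigma>) \<le> 1 / real p ^ L"
      using vdc_digit_nat[of "padic_phi_plus p \<sigma>" p L] padic_phi_plus_less[OF p0]
        digit_sum_padic_phi_plus[OF p0 \<sigma>, of L] by simp
  qed
  have lim': "(\<lambda>L. ?q (vdc p L (shift_digits p \<sigma> L))) \<longlonglongrightarrow> ?q \<sigma>" if "0 \<le> \<sigma>" "\<sigma> < 1" for \<sigma>
    by (intro tendsto_intros id_lim that) auto
  show "set_integrable lborel {0..<1} (\<lambda>\<sigma>. ?q (y n \<sigma>))"
    by (rule shifted_bounded_convergence(1)[where F="\<lambda>L z. ?q (vdc p L (n + z))", OF p lim bound])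
  have "(\<lambda>L. (\<Sum>z<p ^ L. ?q (vdc p L (n + z))) / real p ^ L) \<longlonglongrightarrow> (LINT \<sigma>:{0..<1}|lborel. ?q (y n \<sigma>))"
    by (rule shifted_bounded_convergence(2)[where F="\<lambda>L z. ?q (vdc p L (n + z))", OF p lim bound])
  moreover have "(\<lambda>L. (\<Sum>z<p ^ L. ?q (vdc p L z)) / real p ^ L) \<longlonglongrightarrow> (LINT \<sigma>:{0..<1}|lborel. ?q \<sigma>)"
    by (rule shifted_bounded_convergence(2)[where F="\<lambda>L z. ?q (vdc p L z)", OF p lim' bound])
  moreover have "(\<Sum>z<p ^ L. ?q (vdc p L (n + z))) = (\<Sum>z<p ^ L. ?q (vdc p L z))" for L
    using sum_vdc_shift[where f="?q" and c=n] by (simp add: add.commute)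
  ultimately have "(LINT \<sigma>:{0..<1}|lborel. ?q (y n \<sigma>)) = (LINT \<sigma>:{0..<1}|lborel. ?q \<sigma>)"
    using LIMSEQ_unique by simp
  also have "\<dots> = (LINT \<sigma>:{0..1}|lborel. ?q \<sigma>)"
    unfolding set_lebesgue_integral_def
  proof (rule integral_cong_AE)
    have "AE x in lborel. x \<noteq> (1::real)" by (rule AE_lborel_singleton)
    then show "AE x in lborel. indicator {0..<1} x *\<^sub>R ?q x = indicator {0..1} x *\<^sub>R ?q x"
      by eventually_elim (auto simp: indicator_def)
  qed measurable
  finally show "(LINT \<sigma>:{0..<1}|lborel. ?q (y n \<sigma>)) = 1 + g * (1/3)"
    by (simp only: integral_one_minus_square)
qed

section \<open>Lower bound and tractability\<close>

declare One_nat_def [simp del]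

text \<open>
  Remove a point with the largest value: it is the maximum in \<open>2 N - 1\<close> pairs, where \<open>N\<close> counts
  the points, and completing the square in its value gives the summand. This avoids sorting the
  points.
\<close>

lemma sum_max_upper:
  fixes x :: "'i \<Rightarrow> real"
  assumes "finite I" and c: "c > 0"
  shows "- (\<Sum>i<card I. (2 * real i + 1)\<^sup>2) / (4 * c) \<le> c * (\<Sum>i\<in>I. (x i)\<^sup>2) - (\<Sum>i\<in>I. \<Sum>j\<in>I. max (x i) (x j))"
  using assms(1)
proof (induction rule: finite_ranking_induct[where f=x])
  case empty then show ?case by simp
next
  case (insert k S)
  show ?case
  proof (cases "k \<in> S")
    case True
    then show ?thesis using insert by (simp add: insert_absorb)
  next
    case False
    let ?n = "real (card S)"
    have "(\<Sum>i\<in>insert k S. \<Sum>j\<in>insert k S. max (x i) (x j)) =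
      x k + (\<Sum>j\<in>S. max (x k) (x j)) + ((\<Sum>i\<in>S. max (x i) (x k)) + (\<Sum>i\<in>S. \<Sum>j\<in>S. max (x i) (x j)))"
      using False insert.hyps(1) by (simp add: sum.distrib)
    also have "(\<Sum>j\<in>S. max (x k) (x j)) = ?n * x k"
    proof -
      have "(\<Sum>j\<in>S. max (x k) (x j)) = (\<Sum>j\<in>S. x k)"
        by (rule sum.cong) (use insert.hyps(2) in \<open>auto simp: max_absorb1\<close>)
      then show ?thesis by simp
    qed
    also have "(\<Sum>i\<in>S. max (x i) (x k)) = ?n * x k"
    proof -
      have "(\<Sum>j\<in>S. max (x j) (x k)) = (\<Sum>j\<in>S. x k)"
        by (rule sum.cong) (use insert.hyps(2) in \<open>auto simp: max_absorb2\<close>)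
      then show ?thesis by simp
    qed
    finally have d: "(\<Sum>i\<in>insert k S. \<Sum>j\<in>insert k S. max (x i) (x j)) =
      (2 * ?n + 1) * x k + (\<Sum>i\<in>S. \<Sum>j\<in>S. max (x i) (x j))" by (simp add: algebra_simps)
    have sq: "- (2 * ?n + 1)\<^sup>2 / (4 * c) \<le> c * (x k)\<^sup>2 - (2 * ?n + 1) * x k"
    proof -
      have "0 \<le> (2 * c * x k - (2 * ?n + 1))\<^sup>2 / (4 * c)" using c by simp
      also have "\<dots> = c * (x k)\<^sup>2 - (2 * ?n + 1) * x k + (2 * ?n + 1)\<^sup>2 / (4 * c)"
        using c by (simp add: power2_diff add_divide_distrib diff_divide_distrib) (simp add: power2_eq_square field_simps)
      finally show ?thesis by simp
    qed
    have "- (\<Sum>i<card (insert k S). (2 * real i + 1)\<^sup>2) / (4 * c) =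
      - (\<Sum>i<card S. (2 * real i + 1)\<^sup>2) / (4 * c) + (- (2 * ?n + 1)\<^sup>2 / (4 * c))"
      using False insert.hyps(1) by (simp add: diff_divide_distrib)
    also have "\<dots> \<le> (c * (\<Sum>i\<in>S. (x i)\<^sup>2) - (\<Sum>i\<in>S. \<Sum>j\<in>S. max (x i) (x j))) +
        (c * (x k)\<^sup>2 - (2 * ?n + 1) * x k)"
      by (intro add_mono insert.IH sq)
    also have "\<dots> = c * (\<Sum>i\<in>insert k S. (x i)\<^sup>2) - (\<Sum>i\<in>insert k S. \<Sum>j\<in>insert k S. max (x i) (x j))"
      unfolding d using False insert.hyps(1) by (simp add: algebra_simps)
    finally show ?thesis .
  qed
qed

lemma sum_odd_squares: "3 * (\<Sum>i<N. (2 * real i + 1)\<^sup>2) = real N * (4 * (real N)\<^sup>2 - 1)"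
  by (induction N) (auto simp: power2_eq_square algebra_simps)

text \<open>
  In dimension one only the sum of squares and the sum of pairwise maxima of the points enter.
  The constant comes from the sum of the first odd squares.
\<close>

lemma wce_square_one_dim_ge:
  assumes N: "N \<ge> 1" and g: "0 \<le> \<gamma> 1"
  shows "\<gamma> 1 / (12 * (real N)\<^sup>2) \<le> wce_square N 1 \<gamma> X"
proof -
  define x where "x n = X n 1" for n
  define A where "A = (\<Sum>n<N. (x n)\<^sup>2)"
  define M where "M = (\<Sum>n<N. \<Sum>m<N. max (x n) (x m))"
  have Np: "real N > 0" using N by simp
  have "(\<Sum>n<N. 1 + \<gamma> 1 * ((1 - (x n)\<^sup>2) / 2)) = real N + \<gamma> 1 * ((real N - A) / 2)"
    unfolding A_def by (simp add: sum.distrib sum_distrib_left[symmetric] sum_subtractf sum_divide_distrib[symmetric])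
  moreover have "(\<Sum>n<N. \<Sum>m<N. 1 + \<gamma> 1 * min (1 - x n) (1 - x m)) = (real N)\<^sup>2 + \<gamma> 1 * ((real N)\<^sup>2 - M)"
  proof -
    have "min (1 - a) (1 - b) = 1 - max a b" for a b :: real by (simp add: min_def max_def)
    then show ?thesis unfolding M_def
      by (simp add: sum.distrib sum_distrib_left[symmetric] sum_subtractf power2_eq_square)
  qed
  ultimately have "wce_square N 1 \<gamma> X = 1 + \<gamma> 1 * (1/3) - 2 / real N * (real N + \<gamma> 1 * ((real N - A) / 2))
     + (1 / real N)\<^sup>2 * ((real N)\<^sup>2 + \<gamma> 1 * ((real N)\<^sup>2 - M))"
    unfolding wce_square_def x_def by simp
  also have "\<dots> = \<gamma> 1 * (1/3 + (real N * A - M) / (real N)\<^sup>2)"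
    using Np by (simp add: field_simps power2_eq_square)
  finally have e: "wce_square N 1 \<gamma> X = \<gamma> 1 * (1/3 + (real N * A - M) / (real N)\<^sup>2)" .
  have "- (\<Sum>i<N. (2 * real i + 1)\<^sup>2) / (4 * real N) \<le> real N * A - M"
    using sum_max_upper[of "{..<N}" "real N" x] Np by (simp add: A_def M_def)
  moreover have "(\<Sum>i<N. (2 * real i + 1)\<^sup>2) = real N * (4 * (real N)\<^sup>2 - 1) / 3"
    using sum_odd_squares[of N] by simp
  moreover have "- (real N * (4 * (real N)\<^sup>2 - 1) / 3) / (4 * real N) = - (4 * (real N)\<^sup>2 - 1) / 12"
    using Np by (simp add: field_simps)
  ultimately have "- (4 * (real N)\<^sup>2 - 1) / 12 \<le> real N * A - M" by (simp only:)
  then have "(- (4 * (real N)\<^sup>2 - 1) / 12) / (real N)\<^sup>2 \<le> (real N * A - M) / (real N)\<^sup>2"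
    by (intro divide_right_mono) auto
  moreover have "(- (4 * (real N)\<^sup>2 - 1) / 12) / (real N)\<^sup>2 = 1 / (12 * (real N)\<^sup>2) - 1/3"
    using Np by (simp add: field_simps)
  ultimately have "1 / (12 * (real N)\<^sup>2) \<le> 1/3 + (real N * A - M) / (real N)\<^sup>2" by linarith
  then have "\<gamma> 1 * (1 / (12 * (real N)\<^sup>2)) \<le> \<gamma> 1 * (1/3 + (real N * A - M) / (real N)\<^sup>2)"
    by (intro mult_left_mono g)
  then show ?thesis by (simp add: e)
qed

lemma half_open_cube_subset: "x \<in> half_open_cube s \<Longrightarrow> x \<in> unit_cube s"
  unfolding half_open_cube_def unit_cube_def by (rule PiE_mono[THEN subsetD, rotated]) auto

lemma worst_case_error_one_dim_ge:
  assumes pos: "\<And>j. 1 \<le> j \<Longrightarrow> 0 < \<gamma> j" and X: "\<And>n. X n \<in> unit_cube 1" and N: "N \<ge> 1"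
  shows "sqrt (\<gamma> 1 / 12) / real N \<le> worst_case_error N 1 X (anchored_sobolev_kernel 1 \<gamma>)"
proof -
  have "sqrt (\<gamma> 1 / 12) / real N = sqrt (\<gamma> 1 / (12 * (real N)\<^sup>2))"
    by (simp add: real_sqrt_divide real_sqrt_mult)
  also have "\<dots> \<le> sqrt (wce_square N 1 \<gamma> X)"
    by (intro real_sqrt_le_mono wce_square_one_dim_ge N) (use pos[of 1] in simp)
  finally show ?thesis by (simp only: worst_case_error_anchored(2)[OF pos X])
qed

abbreviation shift_measure :: "nat \<Rightarrow> (nat \<Rightarrow> real) measure" where
  "shift_measure s \<equiv> restrict_space (lebesgue_dim s) (half_open_cube s)"

lemma half_open_cube_sets: "half_open_cube s \<inter> space (lebesgue_dim s) \<in> sets (lebesgue_dim s)"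
  unfolding half_open_cube_def by (intro sets.Int box_in_sets) auto

lemma shift_integral_eq:
  fixes f :: "(nat \<Rightarrow> real) \<Rightarrow> real"
  shows "(\<integral>x. f x \<partial>shift_measure s) = (LINT x : half_open_cube s | lebesgue_dim s. f x)"
  unfolding set_lebesgue_integral_def by (rule integral_restrict_space[OF half_open_cube_sets])

lemma shift_prod_has_integral:
  fixes g :: "nat \<Rightarrow> real \<Rightarrow> real"
  assumes g: "\<And>j. j \<in> {1..s} \<Longrightarrow> set_integrable lborel {0..<1} (g j)"
  shows "has_bochner_integral (shift_measure s) (\<lambda>x. \<Prod>j=1..s. g j (x j))
    (\<Prod>j=1..s. LINT t:{0..<1}|lborel. g j t)"
  unfolding has_bochner_integral_iff shift_integral_eq integrable_restrict_space[OF half_open_cube_sets]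
  using box_integral_prod[of s "{0..<1}" g, OF g] unfolding half_open_cube_def set_integrable_def by blast

lemma set_integral_const_unit:
  "set_integrable lborel {0..<1::real} (\<lambda>t. c :: real)" "(LINT t:{0..<1::real}|lborel. c) = (c :: real)"
proof -
  show "set_integrable lborel {0..<1::real} (\<lambda>t. c :: real)"
    unfolding set_integrable_def real_scaleR_def
    by (intro integrable_mult_left integrable_real_indicator) (auto simp: emeasure_lborel_Ico)
  show "(LINT t:{0..<1::real}|lborel. c) = (c :: real)"
    unfolding set_lebesgue_integral_def by simp
qed

definition pair_mean :: "(nat \<Rightarrow> real) \<Rightarrow> (nat \<Rightarrow> nat) \<Rightarrow> nat \<Rightarrow> nat \<Rightarrow> nat \<Rightarrow> real" where
  "pair_mean \<gamma> p j n m = (LINT \<sigma>:{0..<1}|lborel. 1 + \<gamma> j *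
     min (1 - padic_shift (p j) (radical_inverse (p j) n) \<sigma>) (1 - padic_shift (p j) (radical_inverse (p j) m) \<sigma>))"

lemma shifted_halton_in: "shifted_halton p s \<sigma> n \<in> unit_cube s"
  unfolding shifted_halton_def unit_cube_def
  by (auto simp: padic_shift_bounds less_imp_le)

text \<open>
  The mixed term and the constant term combine to a single multiple of the constant, since
  shifted points are uniformly distributed.
\<close>

lemma wce_square_shifted_has_integral:
  assumes p: "\<And>j. 1 \<le> j \<Longrightarrow> p j \<ge> 2" and N: "N \<ge> 1"
  shows "has_bochner_integral (shift_measure s) (\<lambda>\<sigma>. wce_square N s \<gamma> (shifted_halton p s \<sigma>))
    ((1 / real N)\<^sup>2 * ((\<Sum>n<N. \<Sum>m<N. \<Prod>j=1..s. pair_mean \<gamma> p j n m)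
       - (real N)\<^sup>2 * (\<Prod>j=1..s. 1 + \<gamma> j * (1/3))))"
proof -
  let ?y = "\<lambda>j n \<sigma>. padic_shift (p j) (radical_inverse (p j) n) \<sigma>"
  let ?c = "\<Prod>j=1..s. 1 + \<gamma> j * (1/3)"
  have val: "shifted_halton p s \<sigma> n j = ?y j n (\<sigma> j)" if "j \<in> {1..s}" for \<sigma> n j
    using that by (simp add: shifted_halton_def halton_def)
  have 1: "has_bochner_integral (shift_measure s) (\<lambda>\<sigma>. ?c) ?c"
    using shift_prod_has_integral[of s "\<lambda>j t. 1 + \<gamma> j * (1/3)"] by (simp add: set_integral_const_unit)
  have 2: "has_bochner_integral (shift_measure s)
      (\<lambda>\<sigma>. \<Prod>j=1..s. 1 + \<gamma> j * ((1 - (?y j n (\<sigma> j))\<^sup>2) / 2)) ?c" for n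
    using shift_prod_has_integral[of s "\<lambda>j t. 1 + \<gamma> j * ((1 - (?y j n t)\<^sup>2) / 2)"]
      shifted_point_expectation[OF p] by simp
  have 3: "has_bochner_integral (shift_measure s)
      (\<lambda>\<sigma>. \<Prod>j=1..s. 1 + \<gamma> j * min (1 - ?y j n (\<sigma> j)) (1 - ?y j m (\<sigma> j))) (\<Prod>j=1..s. pair_mean \<gamma> p j n m)" for n m
    unfolding pair_mean_def
    by (rule shift_prod_has_integral[of s "\<lambda>j t. 1 + \<gamma> j * min (1 - ?y j n t) (1 - ?y j m t)"])
       (use shifted_pair_expectation(1)[OF p] in auto)
  have "has_bochner_integral (shift_measure s) (\<lambda>\<sigma>. ?c
     - 2 / real N * (\<Sum>n<N. \<Prod>j=1..s. 1 + \<gamma> j * ((1 - (?y j n (\<sigma> j))\<^sup>2) / 2))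
     + (1 / real N)\<^sup>2 * (\<Sum>n<N. \<Sum>m<N. \<Prod>j=1..s. 1 + \<gamma> j * min (1 - ?y j n (\<sigma> j)) (1 - ?y j m (\<sigma> j))))
     (?c - 2 / real N * (\<Sum>n<N. ?c) + (1 / real N)\<^sup>2 * (\<Sum>n<N. \<Sum>m<N. \<Prod>j=1..s. pair_mean \<gamma> p j n m))"
    by (intro has_bochner_integral_add has_bochner_integral_diff has_bochner_integral_mult_right
        has_bochner_integral_sum 1 2 3)
  moreover have "?c - 2 / real N * (\<Sum>n<N. ?c) + (1 / real N)\<^sup>2 * (\<Sum>n<N. \<Sum>m<N. \<Prod>j=1..s. pair_mean \<gamma> p j n m)
     = (1 / real N)\<^sup>2 * ((\<Sum>n<N. \<Sum>m<N. \<Prod>j=1..s. pair_mean \<gamma> p j n m) - (real N)\<^sup>2 * ?c)"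
    using N by (simp add: right_diff_distrib power_divide)
  ultimately show ?thesis unfolding wce_square_def by (simp add: val cong: prod.cong_simp)
qed

lemma rms_worst_case_error_eq:
  assumes pos: "\<And>j. 1 \<le> j \<Longrightarrow> 0 < \<gamma> j"
  shows "rms_worst_case_error N s p (anchored_sobolev_kernel s \<gamma>) =
    sqrt (\<integral>\<sigma>. wce_square N s \<gamma> (shifted_halton p s \<sigma>) \<partial>shift_measure s)"
proof -
  have "(worst_case_error N s (shifted_halton p s \<sigma>) (anchored_sobolev_kernel s \<gamma>))\<^sup>2 =
      wce_square N s \<gamma> (shifted_halton p s \<sigma>)" for \<sigma>
    using worst_case_error_anchored[of \<gamma> N "shifted_halton p s \<sigma>" s, OF pos shifted_halton_in] by simp
  then show ?thesis unfolding rms_worst_case_error_def shift_integral_eq by simp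
qed

text \<open>
  With \<open>\<theta> = 2 \<delta>\<close>, capped at \<open>1\<close>, the mean squared error is at most \<open>2 C N\<^sup>\<theta> / N\<^sup>2\<close>. The bound
  holds for every truncation of the shell series and survives the limit.
\<close>

theorem rms_worst_case_error_le:
  assumes pos: "\<And>j. 1 \<le> j \<Longrightarrow> 0 < \<gamma> j"
    and summ: "summable (\<lambda>j. \<gamma> (Suc j) * real (Suc j) ^ 2 * ln (real (Suc j)))" and \<delta>: "0 < \<delta>"
  shows "\<exists>C>0. \<forall>s\<ge>1. \<forall>N\<ge>2. rms_worst_case_error N s nth_prime (anchored_sobolev_kernel s \<gamma>)
    \<le> C / real N powr (1 - \<delta>)"
proof -
  define \<theta> where "\<theta> = min (2 * \<delta>) 1"
  have \<theta>: "0 < \<theta>" "\<theta> \<le> 1" "\<theta> / 2 \<le> \<delta>" using \<delta> by (auto simp: \<theta>_def min_def)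
  have prime: "prime (nth_prime j)" for j by (rule nth_prime_prime)
  have p2: "nth_prime j \<ge> 2" for j using prime_ge_2_nat[OF prime] .
  have inj: "inj_on nth_prime {1..s}" for s by (rule inj_onI) (auto intro: nth_prime_inj)
  obtain C where C: "C > 0" and bound: "\<And>s L. (\<Prod>j=1..s. 1 + \<gamma> j * (1/3 + (real (nth_prime j))\<^sup>2 *
      (\<Sum>g=1..L. (real (nth_prime j) powr (- \<theta>)) ^ g))) \<le> C"
    using weighted_prime_product_bounded[OF pos summable_weights_square[OF pos summ] \<theta>(1,2)] by blast
  have main: "rms_worst_case_error N s nth_prime (anchored_sobolev_kernel s \<gamma>) \<le> sqrt (2 * C) / real N powr (1 - \<delta>)"
    if N: "N \<ge> 2" for N s
  proof -
    have Np: "real N \<ge> 1" using N by simp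
    let ?P = "(real N)\<^sup>2 * (\<Prod>j=1..s. 1 + \<gamma> j * (1/3))"
    let ?T = "\<Sum>n<N. \<Sum>m<N. \<Prod>j=1..s. pair_mean \<gamma> nth_prime j n m"
    have "(\<lambda>L. (\<Sum>n<N. \<Sum>m<N. \<Prod>j=1..s. 1 + \<gamma> j * (1/3 + (\<Sum>g=1..L. shell (nth_prime j) g (int n - int m)))) - ?P)
      \<longlonglongrightarrow> ?T - ?P"
      unfolding pair_mean_def by (intro tendsto_intros shifted_pair_expectation(2)[OF p2])
    moreover have "(\<Sum>n<N. \<Sum>m<N. \<Prod>j=1..s. 1 + \<gamma> j * (1/3 + (\<Sum>g=1..L. shell (nth_prime j) g (int n - int m)))) - ?P
        \<le> 2 * real N powr \<theta> * C" for L
      by (rule order_trans[OF shell_expansion_double_sum_le[OF pos prime inj \<theta>(1,2)]])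
         (assumption, intro mult_left_mono bound, auto)
    ultimately have TP: "?T - ?P \<le> 2 * real N powr \<theta> * C"
      by (intro LIMSEQ_le_const2) auto
    have "(\<integral>\<sigma>. wce_square N s \<gamma> (shifted_halton nth_prime s \<sigma>) \<partial>shift_measure s) = (1 / real N)\<^sup>2 * (?T - ?P)"
      by (rule has_bochner_integral_integral_eq[OF wce_square_shifted_has_integral]) (use p2 N in auto)
    also have "\<dots> \<le> (1 / real N)\<^sup>2 * (2 * real N powr \<theta> * C)" by (intro mult_left_mono TP) auto
    also have "\<dots> \<le> (sqrt (2 * C) / real N powr (1 - \<delta>))\<^sup>2"
    proof -
      have "(real N powr (1 - \<delta>))\<^sup>2 = real N powr (2 - 2 * \<delta>)"
        using Np by (simp add: power2_eq_square flip: powr_add)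
      moreover have "(sqrt (2 * C) / real N powr (1 - \<delta>))\<^sup>2 = 2 * C / (real N powr (1 - \<delta>))\<^sup>2"
        unfolding power_divide using C by (subst real_sqrt_pow2) auto
      moreover have "real N powr (2 * \<delta> - 2) = 1 / real N powr (2 - 2 * \<delta>)"
        by (subst powr_minus_divide[symmetric]) simp
      ultimately have "(sqrt (2 * C) / real N powr (1 - \<delta>))\<^sup>2 = 2 * C * real N powr (2 * \<delta> - 2)"
        by simp
      moreover have "(1 / real N)\<^sup>2 * (2 * real N powr \<theta> * C) = 2 * C * real N powr (\<theta> - 2)"
        using Np by (simp add: power_divide powr_diff)
      moreover have "real N powr (\<theta> - 2) \<le> real N powr (2 * \<delta> - 2)"
        using Np \<theta> by (intro powr_mono) auto
      ultimately show ?thesis using C by simp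
    qed
    finally have "sqrt (\<integral>\<sigma>. wce_square N s \<gamma> (shifted_halton nth_prime s \<sigma>) \<partial>shift_measure s)
        \<le> sqrt ((sqrt (2 * C) / real N powr (1 - \<delta>))\<^sup>2)" by (rule real_sqrt_le_mono)
    moreover have "rms_worst_case_error N s nth_prime (anchored_sobolev_kernel s \<gamma>) =
        sqrt (\<integral>\<sigma>. wce_square N s \<gamma> (shifted_halton nth_prime s \<sigma>) \<partial>shift_measure s)"
      by (rule rms_worst_case_error_eq) (rule pos)
    ultimately show ?thesis using C by simp
  qed
  show ?thesis by (rule exI[of _ "sqrt (2 * C)"]) (use C main in auto)
qed

lemma rms_worst_case_error_one_dim_ge:
  assumes pos: "\<And>j. 1 \<le> j \<Longrightarrow> 0 < \<gamma> j" and p: "\<And>j. 1 \<le> j \<Longrightarrow> p j \<ge> 2" and N: "N \<ge> 1"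
  shows "sqrt (\<gamma> 1 / 12) / real N \<le> rms_worst_case_error N 1 p (anchored_sobolev_kernel 1 \<gamma>)"
proof -
  let ?c = "\<gamma> 1 / (12 * (real N)\<^sup>2)"
  have c: "has_bochner_integral (shift_measure 1) (\<lambda>\<sigma>. ?c) ?c"
    using shift_prod_has_integral[of 1 "\<lambda>j t. ?c"] by (simp add: set_integral_const_unit)
  have w: "integrable (shift_measure 1) (\<lambda>\<sigma>. wce_square N 1 \<gamma> (shifted_halton p 1 \<sigma>))"
    using wce_square_shifted_has_integral[of p N 1 \<gamma>, OF p N] unfolding has_bochner_integral_iff by blast
  have "?c = (\<integral>\<sigma>. ?c \<partial>shift_measure 1)" using c by (rule has_bochner_integral_integral_eq[symmetric])
  also have "\<dots> \<le> (\<integral>\<sigma>. wce_square N 1 \<gamma> (shifted_halton p 1 \<sigma>) \<partial>shift_measure 1)"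
  proof (rule integral_mono[OF _ w])
    show "integrable (shift_measure 1) (\<lambda>\<sigma>. ?c)" using c by (simp only: has_bochner_integral_iff)
  qed (use pos[of 1] N in \<open>auto intro: wce_square_one_dim_ge\<close>)
  finally have "sqrt ?c \<le> sqrt (\<integral>\<sigma>. wce_square N 1 \<gamma> (shifted_halton p 1 \<sigma>) \<partial>shift_measure 1)"
    by (rule real_sqrt_le_mono)
  moreover have "rms_worst_case_error N 1 p (anchored_sobolev_kernel 1 \<gamma>) =
      sqrt (\<integral>\<sigma>. wce_square N 1 \<gamma> (shifted_halton p 1 \<sigma>) \<partial>shift_measure 1)"
    by (rule rms_worst_case_error_eq) (rule pos)
  moreover have "sqrt (\<gamma> 1 / 12) / real N = sqrt ?c"
    by (simp add: real_sqrt_divide real_sqrt_mult)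
  ultimately show ?thesis by simp
qed

text \<open>
  An error of at least \<open>c / N\<close> forces \<open>N \<ge> c / \<epsilon>\<close>, which exceeds \<open>C \<epsilon>\<^sup>-\<^sup>\<tau>\<close> for small \<open>\<epsilon>\<close> if
  \<open>\<tau> < 1\<close>.
\<close>

lemma spt_exponent_ge_one:
  assumes c: "c > 0" and E: "\<And>N. N \<ge> 1 \<Longrightarrow> c / real N \<le> E N 1" and \<tau>: "\<tau> \<in> spt_exponents E"
  shows "1 \<le> \<tau>"
proof (rule ccontr)
  assume "\<not> 1 \<le> \<tau>"
  then have t1: "\<tau> < 1" by simp
  obtain C where C: "C > 0"
    and I: "\<And>\<epsilon>. 0 < \<epsilon> \<Longrightarrow> \<epsilon> < 1 \<Longrightarrow> ereal_of_enat (information_complexity E \<epsilon> 1) \<le> ereal (C * \<epsilon> powr (- \<tau>))"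
    using \<tau> by (auto simp: spt_exponents_def)
  have key: "c \<le> C * \<epsilon> powr (1 - \<tau>)" if e: "0 < \<epsilon>" "\<epsilon> < 1" for \<epsilon>
  proof -
    let ?S = "{N. 1 \<le> N \<and> E N 1 \<le> \<epsilon>}"
    have "?S \<noteq> {}"
    proof
      assume S: "?S = {}"
      have "information_complexity E \<epsilon> 1 = \<infinity>"
        unfolding information_complexity_def S by (simp add: Inf_enat_def)
      then show False using I[OF e] by simp
    qed
    then have "information_complexity E \<epsilon> 1 \<in> enat ` ?S"
      unfolding information_complexity_def Inf_enat_def by (auto intro: LeastI)
    then obtain N where N: "information_complexity E \<epsilon> 1 = enat N" "1 \<le> N" "E N 1 \<le> \<epsilon>" by auto
    have "real N \<le> C * \<epsilon> powr (- \<tau>)" using I[OF e] N(1) by simp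
    moreover have "c / real N \<le> \<epsilon>" using E[OF N(2)] N(3) by linarith
    then have "c \<le> \<epsilon> * real N" using N(2) by (simp add: pos_divide_le_eq)
    ultimately have "c \<le> \<epsilon> * (C * \<epsilon> powr (- \<tau>))" using e by (meson less_imp_le mult_left_mono order_trans)
    also have "\<dots> = C * \<epsilon> powr (1 - \<tau>)" using e by (simp add: powr_diff powr_minus field_simps)
    finally show ?thesis .
  qed
  (* Chosen such that C * \<epsilon> powr (1 - \<tau>) is at most c / 2. *)
  define \<epsilon> where "\<epsilon> = min (1/2) ((c / (2 * C)) powr (1 / (1 - \<tau>)))"
  have e: "0 < \<epsilon>" "\<epsilon> < 1" using c C by (auto simp: \<epsilon>_def min_def)
  have "\<epsilon> powr (1 - \<tau>) \<le> ((c / (2 * C)) powr (1 / (1 - \<tau>))) powr (1 - \<tau>)"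
    using e t1 by (intro powr_mono2) (auto simp: \<epsilon>_def)
  also have "\<dots> = c / (2 * C)" using c C t1 by (simp add: powr_powr)
  finally have "C * \<epsilon> powr (1 - \<tau>) \<le> C * (c / (2 * C))" using C by (intro mult_left_mono) auto
  also have "\<dots> = c / 2" using C by simp
  finally show False using key[OF e] c by linarith
qed

text \<open>
  Use the rate \<open>N\<^sup>-\<^sup>1\<^sup>/\<^sup>\<tau>\<close> with an \<open>N\<close> just large enough for an error of \<open>\<epsilon>\<close>.
\<close>

lemma spt_exponent_of_rate:
  assumes rate: "\<And>\<delta>. \<delta> > 0 \<Longrightarrow> \<exists>C>0. \<forall>s\<ge>1. \<forall>N\<ge>2. E N s \<le> C / real N powr (1 - \<delta>)" and \<tau>: "\<tau> > 1"
  shows "\<tau> \<in> spt_exponents E"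
proof -
  have "1 - 1 / \<tau> > 0" using \<tau> by simp
  then obtain C where C: "C > 0" and E: "\<And>s N. s \<ge> 1 \<Longrightarrow> N \<ge> 2 \<Longrightarrow> E N s \<le> C / real N powr (1 / \<tau>)"
    using rate[of "1 - 1 / \<tau>"] by auto
  have "ereal_of_enat (information_complexity E \<epsilon> s) \<le> ereal ((3 + C powr \<tau>) * \<epsilon> powr (- \<tau>))"
    if e: "0 < \<epsilon>" "\<epsilon> < 1" and s: "s \<ge> 1" for \<epsilon> s
  proof -
    (* The rate is available from N = 2 on, hence the summand 2. *)
    define N where "N = nat \<lceil>(C / \<epsilon>) powr \<tau>\<rceil> + 2"
    have N1: "(C / \<epsilon>) powr \<tau> \<le> real N" unfolding N_def by linarith
    have N2: "real N \<le> (C / \<epsilon>) powr \<tau> + 3"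
    proof -
      have "0 \<le> (C / \<epsilon>) powr \<tau>" by simp
      then show ?thesis unfolding N_def by linarith
    qed
    have "C / \<epsilon> = ((C / \<epsilon>) powr \<tau>) powr (1 / \<tau>)" using C e \<tau> by (simp add: powr_powr)
    also have "\<dots> \<le> real N powr (1 / \<tau>)" using N1 \<tau> by (intro powr_mono2) auto
    finally have "C \<le> \<epsilon> * real N powr (1 / \<tau>)" using e by (simp add: field_simps)
    moreover have "N \<ge> 2" by (simp add: N_def)
    ultimately have "C / real N powr (1 / \<tau>) \<le> \<epsilon>" by (subst pos_divide_le_eq) auto
    then have "E N s \<le> \<epsilon>" using E[OF s \<open>N \<ge> 2\<close>] by linarith
    then have "information_complexity E \<epsilon> s \<le> enat N"
      unfolding information_complexity_def by (intro INF_lower) (auto simp: N_def)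
    then have "ereal_of_enat (information_complexity E \<epsilon> s) \<le> ereal_of_enat (enat N)"
      by (simp only: ereal_of_enat_le_iff)
    also have "\<dots> = ereal (real N)" by simp
    also have "\<dots> \<le> ereal ((3 + C powr \<tau>) * \<epsilon> powr (- \<tau>))"
    proof -
      have "(C / \<epsilon>) powr \<tau> = C powr \<tau> * \<epsilon> powr (- \<tau>)"
        using C e by (simp add: powr_divide powr_minus field_simps)
      moreover have "\<epsilon> powr \<tau> \<le> 1" "0 < \<epsilon> powr \<tau>" using e \<tau> by (auto simp: powr_le1)
      then have "1 \<le> \<epsilon> powr (- \<tau>)" by (simp add: powr_minus one_le_inverse)
      ultimately show ?thesis using N2 by (simp add: distrib_right)
    qed
    finally show ?thesis .
  qed
  moreover have "3 + C powr \<tau> > 0" by (simp add: add_pos_nonneg)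
  ultimately show ?thesis unfolding spt_exponents_def using \<tau> by (auto intro!: exI[of _ "3 + C powr \<tau>"])
qed

theorem corollary1:
  fixes \<gamma> :: "nat \<Rightarrow> real"
  assumes pos: "\<And>j. 1 \<le> j \<Longrightarrow> 0 < \<gamma> j"
    and summ: "summable (\<lambda>j. \<gamma> (Suc j) * real (Suc j) ^ 2 * ln (real (Suc j)))"
  shows "(\<forall>\<delta>>0. \<exists>C>0. \<forall>s\<ge>1. \<forall>N\<ge>2.
            rms_worst_case_error N s nth_prime (anchored_sobolev_kernel s \<gamma>)
              \<le> C / real N powr (1 - \<delta>)) \<and>
         strongly_polynomially_tractable
            (\<lambda>N s. rms_worst_case_error N s nth_prime (anchored_sobolev_kernel s \<gamma>)) \<and>
         eps_exponent
            (\<lambda>N s. rms_worst_case_error N s nth_prime (anchored_sobolev_kernel s \<gamma>)) = 1 \<and>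
         (\<forall>X. open_type_rule X \<longrightarrow>
            \<not> (strongly_polynomially_tractable
                  (\<lambda>N s. worst_case_error N s (X s) (anchored_sobolev_kernel s \<gamma>)) \<and>
               eps_exponent
                  (\<lambda>N s. worst_case_error N s (X s) (anchored_sobolev_kernel s \<gamma>)) < 1))"
proof -
  let ?E = "\<lambda>N s. rms_worst_case_error N s nth_prime (anchored_sobolev_kernel s \<gamma>)"
  have rate: "\<exists>C>0. \<forall>s\<ge>1. \<forall>N\<ge>2. ?E N s \<le> C / real N powr (1 - \<delta>)" if "\<delta> > 0" for \<delta>
    by (rule rms_worst_case_error_le[OF pos summ that])
  have c: "sqrt (\<gamma> 1 / 12) > 0" using pos[of 1] by simp
  have upper: "\<tau> \<in> spt_exponents ?E" if "\<tau> > 1" for \<tau>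
    by (rule spt_exponent_of_rate[OF rate that])
  have lower: "1 \<le> \<tau>" if "\<tau> \<in> spt_exponents ?E" for \<tau>
  proof (rule spt_exponent_ge_one[OF c _ that])
    fix N :: nat assume N: "N \<ge> 1"
    show "sqrt (\<gamma> 1 / 12) / real N \<le> ?E N 1"
      by (rule rms_worst_case_error_one_dim_ge[OF pos _ N]) (simp_all add: prime_ge_2_nat[OF nth_prime_prime])
  qed
  have spt: "spt_exponents ?E \<noteq> {}" using upper[of 2] by auto
  have bdd: "bdd_below (spt_exponents ?E)" using lower by (rule bdd_belowI)
  have "Inf (spt_exponents ?E) = 1"
  proof (rule antisym)
    show "Inf (spt_exponents ?E) \<le> 1"
      by (rule dense_ge) (rule cInf_lower[OF upper bdd])
    show "1 \<le> Inf (spt_exponents ?E)" by (rule cInf_greatest[OF spt lower])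
  qed
  moreover have "\<not> (strongly_polynomially_tractable (\<lambda>N s. worst_case_error N s (X s) (anchored_sobolev_kernel s \<gamma>)) \<and>
      eps_exponent (\<lambda>N s. worst_case_error N s (X s) (anchored_sobolev_kernel s \<gamma>)) < 1)"
    if X: "open_type_rule X" for X
  proof
    let ?F = "\<lambda>N s. worst_case_error N s (X s) (anchored_sobolev_kernel s \<gamma>)"
    assume "strongly_polynomially_tractable ?F \<and> eps_exponent ?F < 1"
    then have "spt_exponents ?F \<noteq> {}" "Inf (spt_exponents ?F) < 1"
      by (auto simp: strongly_polynomially_tractable_def eps_exponent_def)
    then obtain \<tau> where \<tau>: "\<tau> \<in> spt_exponents ?F" "\<tau> < 1" using cInf_lessD by blast
    have "1 \<le> \<tau>"
    proof (rule spt_exponent_ge_one[OF c _ \<tau>(1)])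
      fix N :: nat assume N: "N \<ge> 1"
      show "sqrt (\<gamma> 1 / 12) / real N \<le> ?F N 1"
        by (rule worst_case_error_one_dim_ge[OF pos _ N])
           (use X in \<open>auto simp: open_type_rule_def intro!: half_open_cube_subset\<close>)
    qed
    then show False using \<tau>(2) by simp
  qed
  ultimately show ?thesis
    using rate spt by (simp add: strongly_polynomially_tractable_def eps_exponent_def)
qed

end
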